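(* Let $\Delta$ be a large parabolic polar space, a large symplectic polar space over a field of characteristic not $2$, or a large hyperbolic polar space, of rank $n\geq 3$, and let $\theta$ be a point-domestic collineation of $\Delta$ with opposition diagram $\mathsf{B}_{n;i}^2$ with $1\le i\le (n-1)/2$, $\mathsf{C}_{n;i}^2$ with $1\le i\le (n-1)/2$, or $\mathsf{D}_{n;i}^2$ with $1\le i\le (n-2)/2$, respectively. Then $\theta$ is the product of $i$ pairwise orthogonal long root elations, an $(I_{2n-2i},-I_{2i})$-homology, or the product of $i$ pairwise orthogonal long root elations, respectively. The conclusion also holds for the diagram $\mathsf{C}_{n;n/2}^2$ if it is assumed that $\theta$ fixes at least one point.
   Context: All polar spaces here are over a commutative field $\mathbb K$. Hyperbolic of rank $n$: the quadric in $\mathrm{PG}(2n-1,\mathbb K)$ with equation $X_{-n}X_n+\cdots+X_{-1}X_1=0$. Parabolic of rank $n$: the quadric in $\mathrm{PG}(2n,\mathbb K)$ with equation $X_{-n}X_n+\cdots+X_{-1}X_1=X_0^2$. Symplectic of rank $n$: all points of $\mathrm{PG}(2n-1,\mathbb K)$, singular subspaces being those totally isotropic for a nondegenerate alternating form. Large: rank at least 3 and no Fano plane residues, i.e. $|\mathbb K|>2$. Types: parabolic $\mathsf B_n$, symplectic $\mathsf C_n$, hyperbolic $\mathsf D_n$. Points are opposite iff non-collinear; singular subspaces $X,Y$ are opposite iff they have the same (projective) dimension and every point of $X$ is opposite some point of $Y$. A collineation is point-domestic if it maps no point to an opposite point. $\mathrm{Diag}(\theta)=\mathsf X_{n;i}^2$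 means that for $k\in\{1,\dots,n\}$, $\theta$ maps some singular subspace of projective dimension $k-1$ to an opposite one if and only if $k\in\{2,4,\dots,2i\}$. In a parabolic or hyperbolic polar space the long root elations are the nontrivial axial collineations: collineations stabilising each line that meets a given line $L$ (the axis). Two axial collineations with axes $L_1,L_2$ are orthogonal (perpendicular) if either $L_1$ and $L_2$ meet in a point and are not contained in a common singular plane, or $L_1$ and $L_2$ are disjoint and contained in a common singular $3$-space. An $(I_{2n-2i},-I_{2i})$-homology is a collineation induced by a linear map of $\mathbb K^{2n}$ that in a suitable basis is diagonal with $2n-2i$ entries $1$ and $2i$ entries $-1$. *)

theory Defs
  imports "HOL-Analysis.Analysis"
begin

(* A polar space is given by its points and, for each d, its singular subspaces of
   projective dimension d, each one being the set of its points. *)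

record 'p polar_space =
  points :: "'p set"
  sing :: "nat \<Rightarrow> 'p set set"

abbreviation lines :: "'p polar_space \<Rightarrow> 'p set set" where
  "lines \<Delta> \<equiv> sing \<Delta> 1"

(* Every point is collinear with itself as soon as it lies on some line. *)
definition collinear_pts :: "'p polar_space \<Rightarrow> 'p \<Rightarrow> 'p \<Rightarrow> bool" where
  "collinear_pts \<Delta> p q \<longleftrightarrow> (\<exists>L\<in>lines \<Delta>. p \<in> L \<and> q \<in> L)"

definition opposite_pts :: "'p polar_space \<Rightarrow> 'p \<Rightarrow> 'p \<Rightarrow> bool" where
  "opposite_pts \<Delta> p q \<longleftrightarrow> p \<in> points \<Delta> \<and> q \<in> points \<Delta> \<and> \<not> collinear_pts \<Delta> p q"

definition opposite_sing :: "'p polar_space \<Rightarrow> 'p set \<Rightarrow> 'p set \<Rightarrow> bool" where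
  "opposite_sing \<Delta> X Y \<longleftrightarrow>
     (\<exists>d. X \<in> sing \<Delta> d \<and> Y \<in> sing \<Delta> d) \<and> (\<forall>p\<in>X. \<exists>q\<in>Y. opposite_pts \<Delta> p q)"

(* Collineations act on points only; their values off the point set are irrelevant. *)
definition collineation :: "'p polar_space \<Rightarrow> ('p \<Rightarrow> 'p) \<Rightarrow> bool" where
  "collineation \<Delta> \<theta> \<longleftrightarrow>
     bij_betw \<theta> (points \<Delta>) (points \<Delta>) \<and> (\<lambda>L. \<theta> ` L) ` lines \<Delta> = lines \<Delta>"

definition point_domestic :: "'p polar_space \<Rightarrow> ('p \<Rightarrow> 'p) \<Rightarrow> bool" where
  "point_domestic \<Delta> \<theta> \<longleftrightarrow> (\<forall>p\<in>points \<Delta>. \<not> opposite_pts \<Delta> p (\<theta> p))"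

(* The opposition diagram of theta, for a polar space of rank n, is X_{n;i}^2. *)
definition opp_diagram2 :: "'p polar_space \<Rightarrow> nat \<Rightarrow> nat \<Rightarrow> ('p \<Rightarrow> 'p) \<Rightarrow> bool" where
  "opp_diagram2 \<Delta> n i \<theta> \<longleftrightarrow>
     (\<forall>k\<in>{1..n}. (\<exists>X\<in>sing \<Delta> (k - 1). opposite_sing \<Delta> X (\<theta> ` X)) \<longleftrightarrow> k \<in> {2 * j | j. j \<in> {1..i}})"

definition long_root_elation :: "'p polar_space \<Rightarrow> 'p set \<Rightarrow> ('p \<Rightarrow> 'p) \<Rightarrow> bool" where
  "long_root_elation \<Delta> L g \<longleftrightarrow>
     L \<in> lines \<Delta> \<and> collineation \<Delta> g \<and> (\<exists>p\<in>points \<Delta>. g p \<noteq> p) \<and>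
     (\<forall>M\<in>lines \<Delta>. M \<inter> L \<noteq> {} \<longrightarrow> g ` M = M)"

definition orthogonal_axes :: "'p polar_space \<Rightarrow> 'p set \<Rightarrow> 'p set \<Rightarrow> bool" where
  "orthogonal_axes \<Delta> L M \<longleftrightarrow>
     ((\<exists>p. L \<inter> M = {p}) \<and> \<not> (\<exists>E\<in>sing \<Delta> 2. L \<union> M \<subseteq> E)) \<or>
     (L \<inter> M = {} \<and> (\<exists>S\<in>sing \<Delta> 3. L \<union> M \<subseteq> S))"

definition product_of_orthogonal_lres :: "'p polar_space \<Rightarrow> nat \<Rightarrow> ('p \<Rightarrow> 'p) \<Rightarrow> bool" where
  "product_of_orthogonal_lres \<Delta> i \<theta> \<longleftrightarrow>
     (\<exists>gs Ls. length gs = i \<and> length Ls = i \<and>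
        (\<forall>j<i. long_root_elation \<Delta> (Ls ! j) (gs ! j)) \<and>
        (\<forall>j<i. \<forall>k<i. j \<noteq> k \<longrightarrow> orthogonal_axes \<Delta> (Ls ! j) (Ls ! k)) \<and>
        (\<forall>p\<in>points \<Delta>. \<theta> p = foldr (\<circ>) gs id p))"

definition proj_points :: "('k::field ^ 'm::finite) set \<Rightarrow> ('k ^ 'm) set set" where
  "proj_points U = {p. vec.subspace p \<and> vec.dim p = 1 \<and> p \<subseteq> U}"

(* The polar space in PG(K^m) whose singular subspaces are the subspaces that satisfy S. *)
definition polar_space_of :: "(('k::field ^ 'm::finite) set \<Rightarrow> bool) \<Rightarrow> ('k ^ 'm) set polar_space" where
  "polar_space_of S =
     \<lparr>points = {p \<in> proj_points UNIV. S p},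
      sing = (\<lambda>d. {proj_points U | U. vec.subspace U \<and> vec.dim U = d + 1 \<and> S U})\<rparr>"

(* In K^(n+n) the coordinates Inl j and Inr j play the roles of X_{-j} and X_j; the extra
   index None of the parabolic quadric is that of X_0. The rank is CARD('n). *)

definition hyperbolic :: "('k::field ^ ('n::finite + 'n)) set polar_space" where
  "hyperbolic = polar_space_of (\<lambda>U. \<forall>x\<in>U. (\<Sum>j\<in>UNIV. x $ Inl j * x $ Inr j) = 0)"

definition parabolic :: "('k::field ^ (('n::finite + 'n) option)) set polar_space" where
  "parabolic = polar_space_of
     (\<lambda>U. \<forall>x\<in>U. (\<Sum>j\<in>UNIV. x $ Some (Inl j) * x $ Some (Inr j)) = (x $ None)^2)"

definition symplectic_form :: "('k::field ^ 'm::finite \<Rightarrow> 'k ^ 'm \<Rightarrow> 'k) \<Rightarrow> bool" where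
  "symplectic_form f \<longleftrightarrow>
     (\<forall>x. Vector_Spaces.linear (*s) (*) (f x)) \<and>
     (\<forall>y. Vector_Spaces.linear (*s) (*) (\<lambda>x. f x y)) \<and>
     (\<forall>x. f x x = 0) \<and>
     (\<forall>x. (\<forall>y. f x y = 0) \<longrightarrow> x = 0)"

definition symplectic :: "('k::field ^ 'm::finite \<Rightarrow> 'k ^ 'm \<Rightarrow> 'k) \<Rightarrow> ('k ^ 'm) set polar_space" where
  "symplectic f = polar_space_of (\<lambda>U. \<forall>x\<in>U. \<forall>y\<in>U. f x y = 0)"

(* The (I_r, -I_s)-homologies. *)
definition homology ::
  "('k::field ^ 'm::finite) set polar_space \<Rightarrow> nat \<Rightarrow> nat \<Rightarrow> (('k ^ 'm) set \<Rightarrow> ('k ^ 'm) set) \<Rightarrow> bool" where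
  "homology \<Delta> r s \<theta> \<longleftrightarrow> collineation \<Delta> \<theta> \<and>
     (\<exists>A b J. inj b \<and> vec.independent (range b) \<and> vec.span (range b) = UNIV \<and>
        card (- J) = r \<and> card J = s \<and>
        (\<forall>j :: 'm. A *v b j = (if j \<in> J then - b j else b j)) \<and>
        (\<forall>p\<in>points \<Delta>. \<theta> p = (*v) A ` p))"

end

theory Submission
  imports Defs
begin

text \<open>
  A point-domestic collineation of a polar space stabilises every line that joins a point to its
  distinct image. A singular subspace \<open>U\<close> of dimension \<open>2i\<close> that is opposite its image spans with
  this image a nondegenerate space \<open>X\<close>; since no singular subspace of dimension \<open>2i + 2\<close> is mapped
  to an opposite one, the singular points of the orthogonal complement \<open>W\<close> of \<open>X\<close> are fixed. The
  fundamental theorem of projective geometry is not needed: a fixed point \<open>w\<close> normalises the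
  spanning vector \<open>x'\<close> of the image of a point \<open>x\<close> by requiring that \<open>x + w\<close> is mapped to
  \<open>x' + w\<close>, the planes make this normalised map additive, and domesticity of the points \<open>x + c y\<close>
  makes it homogeneous. So the collineation is induced by a linear map \<open>G\<close>. In the symplectic
  case \<open>G\<close> can be chosen to be an involution that is the identity on \<open>W\<close>, which determines the
  dimensions of its eigenspaces. On a quadric \<open>f x (G x - x) = 0\<close>, hence \<open>G - 1\<close> is alternating with totally
  singular image, and a symplectic basis of \<open>U\<close> writes it as a sum of \<open>i\<close> terms \<open>R - 1\<close> with commuting long root elations \<open>R\<close>.
\<close>

section \<open>Linear functionals and forms\<close>

text \<open>On a quadric the normalisation by a fixed \<open>w\<close> reaches only singular vectors
  orthogonal to \<open>w\<close>. So it gives one linear map on \<open>U\<close> and one on its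
  image \<open>U'\<close>, but says nothing directly about a point \<open>u + u' + w\<close> whose
  component \<open>w\<close> in \<open>W\<close> is nonsingular. Such a \<open>w\<close> is split
  into singular vectors \<open>w1 + w2\<close>. The two ways of pairing these with \<open>u\<close>
  and \<open>u'\<close> determine the image up to an unknown factor \<kappa> between the
  normalisations by \<open>w1\<close> and by \<open>w2\<close>. To see that this factor is 1, the
  same vector of \<open>W\<close> is split a second time, through a third direction of
  \<open>W\<close> and with a suitably chosen scalar. This is what the bounds on \<open>i\<close>
  and the condition |K| > 2 are used for: \<open>4 * i + 3 \<le> CARD('m)\<close> makes
  \<open>W\<close> at least 3-dimensional, and a third field element supplies the scalar.

  Symplectic spaces avoid this problem: all vectors are singular and hyperbolic lines are mapped to
  lines too, so one fixed point normalises a whole hyperplane. That is also why a single fixed point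
  suffices when \<open>2 * i = n\<close>, where \<open>W\<close> may be zero.\<close>

definition linfun :: "('k::field ^ 'm::finite \<Rightarrow> 'k) \<Rightarrow> bool" where
  "linfun \<phi> \<longleftrightarrow> (\<forall>x y. \<phi> (x + y) = \<phi> x + \<phi> y) \<and> (\<forall>c x. \<phi> (c *s x) = c * \<phi> x)"

lemma linfun_zero: "linfun \<phi> \<Longrightarrow> \<phi> 0 = 0"
  unfolding linfun_def by (metis mult_zero_left vec.scale_zero_left)

lemma linfun_diff: "linfun \<phi> \<Longrightarrow> \<phi> (x - y) = \<phi> x - \<phi> y"
  unfolding linfun_def by (metis add_diff_cancel diff_add_cancel)

lemma linfun_scale: "linfun \<phi> \<Longrightarrow> \<phi> (c *s x) = c * \<phi> x"
  unfolding linfun_def by blast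

lemma linfun_sum:
  assumes "linfun \<phi>"
  shows "\<phi> (sum v A) = (\<Sum>a\<in>A. \<phi> (v a))"
proof (induction A rule: infinite_finite_induct)
  case (insert x F)
  then show ?case using assms by (simp add: linfun_def)
qed (use linfun_zero[OF assms] in auto)

text \<open>The functional with index \<open>a\<close>, applied to a vanishing combination, leaves
  only the term of \<open>a\<close>. Nonzero values instead of 1 are allowed because image vectors
  are known only up to scalars.\<close>

lemma independent_dual_family:
  fixes v :: "'b \<Rightarrow> 'k::field ^ 'm::finite"
  assumes fin: "finite J" and lin: "\<And>a. a \<in> J \<Longrightarrow> linfun (\<phi> a)"
    and dual: "\<And>a b. a \<in> J \<Longrightarrow> b \<in> J \<Longrightarrow> \<phi> a (v b) \<noteq> 0 \<longleftrightarrow> a = b"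
  shows "inj_on v J" and "vec.independent (v ` J)"
proof -
  show inj: "inj_on v J"
    by (rule inj_onI) (use dual in metis)
  show "vec.independent (v ` J)"
  proof (rule vec.independent_if_scalars_zero)
    show "finite (v ` J)" using fin by simp
  next
    fix c x assume s: "(\<Sum>x\<in>v ` J. c x *s x) = 0" and "x \<in> v ` J"
    then obtain a where a: "a \<in> J" "x = v a" by auto
    have "(\<Sum>b\<in>J. c (v b) *s v b) = 0" using s by (simp add: sum.reindex[OF inj])
    then have "0 = \<phi> a (\<Sum>b\<in>J. c (v b) *s v b)" using linfun_zero[OF lin[OF a(1)]] by simp
    also have "\<dots> = (\<Sum>b\<in>J. c (v b) * \<phi> a (v b))"
      using lin[OF a(1)] by (simp add: linfun_sum linfun_def)
    also have "\<dots> = (\<Sum>b\<in>J. if b = a then c (v b) * \<phi> a (v b) else 0)"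
      by (rule sum.cong) (use dual a in auto)
    also have "\<dots> = c (v a) * \<phi> a (v a)" using a fin by simp
    finally show "c x = 0" using dual[OF a(1) a(1)] a by auto
  qed
qed

text \<open>A vector of \<open>M\<close> outside the kernel of \<phi> spans a complement of that
  kernel in \<open>M\<close>, so \<xi> is determined on \<open>M\<close> by one value. The version
  relative to \<open>M\<close> lets two functionals be treated one after the other.\<close>

lemma functional_multiple:
  assumes "linfun \<phi>" "linfun \<xi>" "vec.subspace M"
    and ker: "\<And>w. w \<in> M \<Longrightarrow> \<phi> w = 0 \<Longrightarrow> \<xi> w = 0"
  shows "\<exists>a. \<forall>w\<in>M. \<xi> w = a * \<phi> w"
proof (cases "\<exists>u\<in>M. \<phi> u \<noteq> 0")
  case True
  then obtain u where u: "u \<in> M" "\<phi> u \<noteq> 0" by auto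
  have "\<xi> w = (\<xi> u / \<phi> u) * \<phi> w" if w: "w \<in> M" for w
  proof -
    let ?z = "w + (- (\<phi> w / \<phi> u)) *s u"
    have "?z \<in> M" using u w assms(3) by (intro vec.subspace_add vec.subspace_scale)
    moreover have "\<phi> ?z = 0" using u assms(1) by (simp add: linfun_diff linfun_scale)
    ultimately have "\<xi> ?z = 0" by (rule ker)
    then have "\<xi> w + (- (\<phi> w / \<phi> u)) * \<xi> u = 0" using assms(2) unfolding linfun_def by metis
    then show ?thesis by (simp add: field_simps)
  qed
  then show ?thesis by blast
next
  case False
  then show ?thesis using ker by (intro exI[of _ 0]) auto
qed

text \<open>On the kernel of \<phi>, \<xi> is a multiple of \<psi>; subtracting this multiple leaves
  a functional that vanishes on the kernel of \<phi>.\<close>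

lemma functional_combination:
  assumes "linfun \<phi>" "linfun \<psi>" "linfun \<xi>"
    and ker: "\<And>w. \<phi> w = 0 \<Longrightarrow> \<psi> w = 0 \<Longrightarrow> \<xi> w = 0"
  shows "\<exists>a b. \<forall>w. \<xi> w = a * \<phi> w + b * \<psi> w"
proof -
  have "vec.subspace {w. \<phi> w = 0}"
    using assms(1) linfun_zero[OF assms(1)] by (auto simp: vec.subspace_def linfun_def)
  from functional_multiple[OF assms(2,3) this] ker
  obtain b where b: "\<And>w. \<phi> w = 0 \<Longrightarrow> \<xi> w = b * \<psi> w" by blast
  have "linfun (\<lambda>w. \<xi> w - b * \<psi> w)"
    using assms(2,3) by (auto simp: linfun_def algebra_simps)
  from functional_multiple[OF assms(1) this vec.subspace_UNIV] b
  obtain a where "\<And>w. \<xi> w - b * \<psi> w = a * \<phi> w" by auto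
  then show ?thesis by (metis add.commute diff_add_cancel)
qed

text \<open>Each functional lowers the dimension by at most one, since its kernel and one further
  vector span everything.\<close>

lemma dim_functionals:
  fixes T :: "('k::field ^ 'm::finite) set"
  assumes T: "vec.subspace T" and fin: "finite J" and lin: "\<And>a. a \<in> J \<Longrightarrow> linfun (\<phi> a)"
  shows "vec.dim T \<le> vec.dim {t \<in> T. \<forall>a\<in>J. \<phi> a t = 0} + card J"
  using fin lin
proof (induction J)
  case empty
  then show ?case by simp
next
  case (insert j J)
  let ?A = "{t \<in> T. \<forall>a\<in>J. \<phi> a t = 0}" and ?B = "{t \<in> T. \<forall>a\<in>insert j J. \<phi> a t = 0}"
  have lj: "linfun (\<phi> j)" using insert by simp
  have "vec.dim ?A \<le> vec.dim ?B + 1"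
  proof (cases "\<exists>u\<in>?A. \<phi> j u \<noteq> 0")
    case True
    then obtain u where u: "u \<in> ?A" "\<phi> j u \<noteq> 0" by auto
    have "?A \<subseteq> vec.span (insert u ?B)"
    proof
      fix w assume w: "w \<in> ?A"
      let ?z = "w - (\<phi> j w / \<phi> j u) *s u"
      have "\<phi> a ?z = 0" if "a \<in> J" for a
      proof -
        have "linfun (\<phi> a)" "\<phi> a w = 0" "\<phi> a u = 0" using insert that w u by auto
        then show ?thesis by (simp add: linfun_diff linfun_scale)
      qed
      moreover have "\<phi> j ?z = 0" using u lj by (simp add: linfun_diff linfun_scale)
      moreover have "?z \<in> T" using w u T by (simp add: vec.subspace_diff vec.subspace_scale)
      ultimately have "?z \<in> ?B" by auto
      then have "?z \<in> vec.span (insert u ?B)" by (simp add: vec.span_base)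
      moreover have "(\<phi> j w / \<phi> j u) *s u \<in> vec.span (insert u ?B)"
        by (intro vec.span_scale vec.span_base) simp
      ultimately have "?z + (\<phi> j w / \<phi> j u) *s u \<in> vec.span (insert u ?B)" by (rule vec.span_add)
      then show "w \<in> vec.span (insert u ?B)" by simp
    qed
    then have "vec.dim ?A \<le> vec.dim (insert u ?B)"
      using vec.dim_subset[of ?A "vec.span (insert u ?B)"] by (simp add: vec.dim_span)
    also have "\<dots> \<le> vec.dim ?B + 1" by (simp add: vec.dim_insert)
    finally show ?thesis .
  next
    case False
    then have "?A = ?B" by auto
    then show ?thesis by simp
  qed
  moreover have "vec.dim T \<le> vec.dim ?A + card J" using insert by auto
  ultimately show ?case using insert by auto
qed

section \<open>Independence of two or three vectors, in terms of coefficients\<close>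

definition ind3 :: "'k::field ^ 'm::finite \<Rightarrow> 'k ^ 'm \<Rightarrow> 'k ^ 'm \<Rightarrow> bool" where
  "ind3 x y z \<longleftrightarrow> (\<forall>a b c. a *s x + b *s y + c *s z = 0 \<longrightarrow> a = 0 \<and> b = 0 \<and> c = 0)"

lemma ind3_perm: "ind3 x y z \<Longrightarrow> ind3 x z y" "ind3 x y z \<Longrightarrow> ind3 y z x"
proof -
  assume i: "ind3 x y z"
  show "ind3 x z y" unfolding ind3_def
  proof (intro allI impI)
    fix a b c assume "a *s x + b *s z + c *s y = 0"
    then have "a *s x + c *s y + b *s z = 0" by (simp add: add_ac)
    then show "a = 0 \<and> b = 0 \<and> c = 0" using i unfolding ind3_def by blast
  qed
next
  assume i: "ind3 x y z"
  show "ind3 y z x" unfolding ind3_def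
  proof (intro allI impI)
    fix a b c assume "a *s y + b *s z + c *s x = 0"
    then have "c *s x + a *s y + b *s z = 0" by (simp add: add_ac)
    then show "a = 0 \<and> b = 0 \<and> c = 0" using i unfolding ind3_def by blast
  qed
qed

lemma ind3_coeffs:
  assumes "ind3 x y z" "a *s x + b *s y + c *s z = a' *s x + b' *s y + c' *s z"
  shows "a = a'" "b = b'" "c = c'"
proof -
  have "(a - a') *s x + (b - b') *s y + (c - c') *s z = 0"
    using assms(2) by (simp add: vec.scale_left_diff_distrib algebra_simps)
  then have "a - a' = 0 \<and> b - b' = 0 \<and> c - c' = 0" using assms(1) unfolding ind3_def by blast
  then show "a = a'" "b = b'" "c = c'" by auto
qed

definition ind2 :: "'k::field ^ 'm::finite \<Rightarrow> 'k ^ 'm \<Rightarrow> bool" where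
  "ind2 x y \<longleftrightarrow> (\<forall>a b. a *s x + b *s y = 0 \<longrightarrow> a = 0 \<and> b = 0)"

lemma scale_solve: "b *s y = v \<Longrightarrow> b \<noteq> 0 \<Longrightarrow> y = (1 / b) *s (v :: 'k::field ^ 'm)"
  by auto

lemma ind2_iff: "ind2 x y \<longleftrightarrow> x \<noteq> 0 \<and> (\<forall>c. y \<noteq> c *s x)"
proof
  assume i: "ind2 x y"
  have "x \<noteq> 0" using i[unfolded ind2_def, rule_format, of 1 0] by auto
  moreover have "y \<noteq> c *s x" for c
  proof
    assume "y = c *s x"
    then show False using i[unfolded ind2_def, rule_format, of "-c" 1] by simp
  qed
  ultimately show "x \<noteq> 0 \<and> (\<forall>c. y \<noteq> c *s x)" by auto
next
  assume r: "x \<noteq> 0 \<and> (\<forall>c. y \<noteq> c *s x)"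
  show "ind2 x y" unfolding ind2_def
  proof (intro allI impI)
    fix a b assume e: "a *s x + b *s y = 0"
    have "b = 0"
    proof (rule ccontr)
      assume b: "b \<noteq> 0"
      have "b *s y = (- a) *s x" using e by (simp add: eq_neg_iff_add_eq_0 add.commute)
      then have "y = (1 / b) *s ((- a) *s x)" using b by (rule scale_solve)
      then have "y = (- a / b) *s x" by simp
      then show False using r by blast
    qed
    then show "a = 0 \<and> b = 0" using e r by simp
  qed
qed

lemma ind2_sym: "ind2 x y \<Longrightarrow> ind2 y x"
  unfolding ind2_def by (metis add.commute)

lemma ind3_ind2: "ind3 x y z \<Longrightarrow> ind2 x y" "ind3 x y z \<Longrightarrow> ind2 x z" "ind3 x y z \<Longrightarrow> ind2 y z"
  unfolding ind3_def ind2_def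
  by (metis add.right_neutral add.left_neutral vec.scale_zero_left)+

lemma ind3I:
  assumes "ind2 x y" "\<And>a b. z \<noteq> a *s x + b *s y"
  shows "ind3 x y z"
  unfolding ind3_def
proof (intro allI impI)
  fix a b c assume e: "a *s x + b *s y + c *s z = 0"
  have "c = 0"
  proof (rule ccontr)
    assume c: "c \<noteq> 0"
    have "c *s z = (- a) *s x + (- b) *s y"
      using e by (simp add: add_eq_0_iff)
    then have "z = (1 / c) *s ((- a) *s x + (- b) *s y)" using c by (rule scale_solve)
    then have "z = (- a / c) *s x + (- b / c) *s y" by (simp add: vec.scale_right_distrib)
    then show False using assms(2) by blast
  qed
  then show "a = 0 \<and> b = 0 \<and> c = 0" using e assms(1) unfolding ind2_def by simp
qed

lemma ind3_ind2_add:
  assumes "ind3 x y z" shows "ind2 (x + y) z" unfolding ind2_def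
proof (intro allI impI)
  fix p q assume "p *s (x + y) + q *s z = 0"
  then have "p *s x + p *s y + q *s z = 0" by (simp add: vec.scale_right_distrib)
  then show "p = 0 \<and> q = 0" using assms unfolding ind3_def by blast
qed

lemma ind3_not_comb: "ind3 x y z \<Longrightarrow> z \<noteq> a *s x + b *s y"
proof
  assume i: "ind3 x y z" and "z = a *s x + b *s y"
  then have "(-a) *s x + (-b) *s y + 1 *s z = 0" by simp
  then show False using i unfolding ind3_def by (metis one_neq_zero)
qed

text \<open>Common setting for the three families; \<open>S\<close> is the set of vectors that span
  points of the polar space or are zero. In the symplectic case \<open>S = UNIV\<close> and
  \<open>\<epsilon> = -1\<close>; on a quadric \<open>S\<close> is the zero set of the quadratic
  form, \<open>f\<close> its polarisation and \<open>\<epsilon> = 1\<close>. \<open>S_nondeg\<close>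
  concerns only vectors in \<open>S\<close>, because in characteristic 2 the polarisation of a
  parabolic quadric has a nonzero radical, spanned by a nonsingular vector.\<close>

locale form_space =
  fixes f :: "'k::field ^ 'm::finite \<Rightarrow> 'k ^ 'm \<Rightarrow> 'k" and S :: "('k ^ 'm) set" and \<epsilon> :: 'k
  assumes f_add: "f (x + y) z = f x z + f y z"
    and f_scale: "f (c *s x) z = c * f x z"
    and f_swap: "f y x = \<epsilon> * f x y"
    and eps: "\<epsilon> * \<epsilon> = 1"
    and S_zero: "0 \<in> S"
    and S_scale: "x \<in> S \<Longrightarrow> c *s x \<in> S"
    and S_add: "x \<in> S \<Longrightarrow> y \<in> S \<Longrightarrow> f x y = 0 \<Longrightarrow> x + y \<in> S"
    and S_self: "x \<in> S \<Longrightarrow> f x x = 0"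
    and S_lift: "b \<in> S \<Longrightarrow> f w b \<noteq> 0 \<Longrightarrow> \<exists>c. w + c *s b \<in> S"
    and S_nondeg: "x \<in> S \<Longrightarrow> (\<And>y. f y x = 0) \<Longrightarrow> x = 0"
begin

lemma ind2_nonperp: "x \<in> S \<Longrightarrow> f x y \<noteq> 0 \<Longrightarrow> ind2 x y"
proof -
  assume x: "x \<in> S" "f x y \<noteq> 0"
  have "x \<noteq> 0" using x f_scale[of 0] by (metis mult_zero_left vec.scale_zero_left)
  moreover have "y \<noteq> c *s x" for c
  proof
    assume "y = c *s x"
    then have "f y x = 0" using f_scale S_self[OF x(1)] by simp
    then show False using x(2) f_swap by (metis mult_zero_right)
  qed
  ultimately show ?thesis unfolding ind2_iff by blast
qed

lemma f_add_right: "f z (x + y) = f z x + f z y"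
  by (metis f_add f_swap distrib_left)

lemma f_scale_right: "f z (c *s x) = c * f z x"
  by (metis f_scale f_swap mult.left_commute)

lemma f_sym0: "f x y = 0 \<longleftrightarrow> f y x = 0"
  by (metis f_swap mult_zero_right)

lemma eps_nz: "\<epsilon> \<noteq> 0" using eps by auto

lemma linfun_f: "linfun (\<lambda>x. f x y)" "linfun (f y)"
  by (auto simp: linfun_def f_add f_scale f_add_right f_scale_right)

lemma f_zero [simp]: "f 0 y = 0" "f y 0 = 0"
  using linfun_zero linfun_f by auto

lemma f_sum: "f (sum v A) y = (\<Sum>a\<in>A. f (v a) y)" "f y (sum v A) = (\<Sum>a\<in>A. f y (v a))"
  by (rule linfun_sum[OF linfun_f(1)], rule linfun_sum[OF linfun_f(2)])

lemma f_uminus: "f (- x) y = - f x y" "f y (- x) = - f y x"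
  using f_scale[of "-1"] f_scale_right[of _ "-1"] by (metis vector_sneg_minus1 mult_minus1)+

lemma f_diff: "f (x - y) z = f x z - f y z" "f z (x - y) = f z x - f z y"
  using f_add[of x "-y" z] f_add_right[of z x "-y"] f_uminus by simp_all

lemmas f_bilin = f_add f_scale f_add_right f_scale_right f_uminus f_diff f_sum

lemma S_uminus: "x \<in> S \<Longrightarrow> - x \<in> S"
  using S_scale[of x "-1"] by simp

lemma S_comb: "x \<in> S \<Longrightarrow> y \<in> S \<Longrightarrow> f x y = 0 \<Longrightarrow> a *s x + b *s y \<in> S"
  by (rule S_add) (auto simp: S_scale f_bilin)

text \<open>If every \<open>w\<close> orthogonal to \<open>x\<close> and \<open>y\<close> were
  orthogonal to \<open>z\<close>, then some \<open>z - a *s x - b *s y\<close> would be orthogonal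
  to everything. It lies in \<open>S\<close> because \<open>x\<close>, \<open>y\<close>,
  \<open>z\<close> are pairwise orthogonal, so it would be 0.\<close>

lemma separate_sing:
  assumes S: "x \<in> S" "y \<in> S" "z \<in> S" and perp: "f x y = 0" "f x z = 0" "f y z = 0"
    and nc: "\<And>a b. z \<noteq> a *s x + b *s y"
  shows "\<exists>w\<in>S. f w x = 0 \<and> f w y = 0 \<and> f w z \<noteq> 0"
proof -
  have "\<exists>w. f w x = 0 \<and> f w y = 0 \<and> f w z \<noteq> 0"
  proof (rule ccontr)
    assume "\<not> ?thesis"
    then have "\<And>w. f w x = 0 \<Longrightarrow> f w y = 0 \<Longrightarrow> f w z = 0" by auto
    from functional_combination[OF linfun_f(1) linfun_f(1) linfun_f(1) this]
    obtain a b where ab: "\<And>w. f w z = a * f w x + b * f w y" by blast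
    define r where "r = z + ((-a) *s x + (-b) *s y)"
    have "(-a) *s x + (-b) *s y \<in> S" using S perp by (intro S_comb)
    moreover have "f z x = 0" "f z y = 0" using perp f_sym0 by blast+
    then have "f z ((-a) *s x + (-b) *s y) = 0" by (simp add: f_bilin)
    ultimately have "r \<in> S" unfolding r_def using S_add[OF S(3)] by blast
    moreover have "f w r = 0" for w unfolding r_def using ab[of w] by (simp add: f_bilin)
    ultimately have "r = 0" using S_nondeg by blast
    then have "z = a *s x + b *s y" unfolding r_def by (simp add: algebra_simps add_eq_0_iff)
    then show False using nc by blast
  qed
  then obtain w where w: "f w x = 0" "f w y = 0" "f w z \<noteq> 0" by blast
  \<comment> \<open>Adding a multiple of \<open>z\<close> changes none of the three values, since
    \<open>z\<close> is orthogonal to \<open>x\<close>, to \<open>y\<close> and to itself.\<close>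
  obtain c where "w + c *s z \<in> S" using S_lift[OF S(3) w(3)] by blast
  moreover have "f (w + c *s z) x = 0" "f (w + c *s z) y = 0" "f (w + c *s z) z \<noteq> 0"
    using w perp S_self[OF S(3)] f_sym0 by (auto simp: f_bilin)
  ultimately show ?thesis by blast
qed

end

section \<open>Point-domestic collineations\<close>

text \<open>Equality of projective points, extended to the zero vector: the factor is nonzero, so 0
  is proportional only to itself.\<close>

definition sim :: "'k::field ^ 'm::finite \<Rightarrow> 'k ^ 'm \<Rightarrow> bool" where
  "sim x y \<longleftrightarrow> (\<exists>t. t \<noteq> 0 \<and> x = t *s y)"

lemma sim_refl [simp]: "sim x x"
  unfolding sim_def by (metis one_neq_zero vec.scale_one)

lemma sim_sym: "sim x y \<Longrightarrow> sim y x"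
  unfolding sim_def by (metis scale_solve divide_eq_0_iff one_neq_zero)

lemma sim_trans: "sim x y \<Longrightarrow> sim y z \<Longrightarrow> sim x z"
  unfolding sim_def by (metis mult_eq_0_iff vec.scale_scale)

lemma sim_scale: "t \<noteq> 0 \<Longrightarrow> sim (t *s x) x" "t \<noteq> 0 \<Longrightarrow> sim x (t *s x)"
  using sim_sym sim_def by blast+

lemma simI: "x = t *s y \<Longrightarrow> t \<noteq> 0 \<Longrightarrow> sim x y"
  unfolding sim_def by blast

lemma sim_zero: "sim x y \<Longrightarrow> x = 0 \<longleftrightarrow> y = 0"
  unfolding sim_def by auto

lemma ind2_sim: "ind2 x y \<Longrightarrow> sim x' x \<Longrightarrow> sim y' y \<Longrightarrow> ind2 x' y'"
  unfolding ind2_def sim_def by (metis mult_eq_0_iff vec.scale_scale)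

lemma ind2_coeffs:
  assumes "ind2 x y" "a *s x + b *s y = a' *s x + b' *s y"
  shows "a = a'" "b = b'"
proof -
  have "(a - a') *s x + (b - b') *s y = 0"
    using assms(2) by (simp add: vec.scale_left_diff_distrib algebra_simps)
  then have "a - a' = 0 \<and> b - b' = 0" using assms(1) unfolding ind2_def by blast
  then show "a = a'" "b = b'" by auto
qed

lemma ind3_sim: "ind3 x y z \<Longrightarrow> sim x' x \<Longrightarrow> sim y' y \<Longrightarrow> sim z' z \<Longrightarrow> ind3 x' y' z'"
proof -
  assume i: "ind3 x y z" and "sim x' x" "sim y' y" "sim z' z"
  then obtain p q r where e: "x' = p *s x" "y' = q *s y" "z' = r *s z" "p \<noteq> 0" "q \<noteq> 0" "r \<noteq> 0"
    unfolding sim_def by blast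
  show ?thesis unfolding ind3_def
  proof (intro allI impI)
    fix a b c assume "a *s x' + b *s y' + c *s z' = 0"
    then have "(a * p) *s x + (b * q) *s y + (c * r) *s z = 0" using e by simp
    then have "a * p = 0 \<and> b * q = 0 \<and> c * r = 0" using i unfolding ind3_def by blast
    then show "a = 0 \<and> b = 0 \<and> c = 0" using e by simp
  qed
qed

lemma (in form_space) f_sim: "sim x x' \<Longrightarrow> sim y y' \<Longrightarrow> f x y = 0 \<longleftrightarrow> f x' y' = 0"
  unfolding sim_def by (auto simp: f_bilin)

lemma (in form_space) S_sim: "sim x x' \<Longrightarrow> x' \<in> S \<Longrightarrow> x \<in> S"
  unfolding sim_def by (auto simp: S_scale)

text \<open>A point-domestic collineation, given by an arbitrary choice of spanning vectors: \<open>g x\<close> spans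
  the image of the point spanned by \<open>x\<close>. The relation \<open>adj\<close> says which lines of the ambient
  projective space are known to be mapped to lines; these are the singular lines and, in the
  symplectic case, also the hyperbolic ones.\<close>

locale domestic = form_space f S \<epsilon>
  for f :: "'k::field ^ 'm::finite \<Rightarrow> 'k ^ 'm \<Rightarrow> 'k" and S \<epsilon> +
  fixes g :: "'k ^ 'm \<Rightarrow> 'k ^ 'm" and adj :: "'k ^ 'm \<Rightarrow> 'k ^ 'm \<Rightarrow> bool"
  assumes g_zero: "g 0 = 0"
    and g_S: "x \<in> S \<Longrightarrow> g x \<in> S"
    and g_nz: "x \<in> S \<Longrightarrow> x \<noteq> 0 \<Longrightarrow> g x \<noteq> 0"
    and g_inj: "x \<in> S \<Longrightarrow> y \<in> S \<Longrightarrow> g y = c *s g x \<Longrightarrow> \<exists>d. y = d *s x"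
    and g_line: "adj x y \<Longrightarrow> \<exists>c d. g (a *s x + b *s y) = c *s g x + d *s g y"
    and g_onto: "adj x y \<Longrightarrow> \<exists>a b t. c *s g x + d *s g y = t *s g (a *s x + b *s y)"
    and g_perp: "x \<in> S \<Longrightarrow> y \<in> S \<Longrightarrow> f (g x) (g y) = 0 \<longleftrightarrow> f x y = 0"
    and dom: "x \<in> S \<Longrightarrow> f x (g x) = 0"
    and adj_S: "adj x y \<Longrightarrow> x \<in> S" "adj x y \<Longrightarrow> x + y \<in> S"
    and adj_perp: "x \<in> S \<Longrightarrow> y \<in> S \<Longrightarrow> f x y = 0 \<Longrightarrow> adj x y"
    and adj_sym: "adj x y \<Longrightarrow> adj y x"
    and adj_scale: "adj x y \<Longrightarrow> adj x (c *s y)"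
    and adj_add: "adj x y \<Longrightarrow> adj x z \<Longrightarrow> adj y z \<Longrightarrow> adj x (y + z)"
begin

lemma adj_S2: "adj x y \<Longrightarrow> y \<in> S"
  using adj_sym adj_S by blast

lemma adj_comb_S: "adj x y \<Longrightarrow> a *s x + b *s y \<in> S"
  by (meson adj_S(2) adj_scale adj_sym)

section \<open>Images of points, lines and planes\<close>

lemma g_sim_scale: assumes "x \<in> S" "c \<noteq> 0" shows "sim (g (c *s x)) (g x)"
proof (cases "x = 0")
  case False
  \<comment> \<open>A single point is treated as the degenerate line through \<open>x\<close> and
    \<open>x\<close>.\<close>
  have "adj x x" using assms S_self adj_perp by blast
  from g_line[OF this, of c 0] obtain p q where "g (c *s x) = p *s g x + q *s g x" by auto
  then have e: "g (c *s x) = (p + q) *s g x" by (simp add: vec.scale_left_distrib)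
  moreover have "g (c *s x) \<noteq> 0" using g_nz S_scale assms False by simp
  ultimately show ?thesis unfolding sim_def by (metis vec.scale_zero_left)
qed simp

lemma g_sim: "x \<in> S \<Longrightarrow> sim y x \<Longrightarrow> sim (g y) (g x)"
  using g_sim_scale unfolding sim_def[of y x] by auto

lemma g_ind2: assumes "x \<in> S" "y \<in> S" "ind2 x y" shows "ind2 (g x) (g y)"
  using assms g_inj g_nz unfolding ind2_iff by meson

lemma g_line_rev:
  assumes "adj x y" "z \<in> S" "g z = c *s g x + d *s g y"
  shows "\<exists>a b. z = a *s x + b *s y"
proof -
  obtain a b t where e: "g z = t *s g (a *s x + b *s y)"
    using g_onto[OF assms(1)] assms(3) by metis
  then obtain s where "z = s *s (a *s x + b *s y)"
    using g_inj[OF adj_comb_S[OF assms(1)] assms(2)] by blast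
  then show ?thesis by (metis vec.scale_right_distrib vec.scale_scale)
qed

lemma g_ind3:
  assumes "adj x y" "z \<in> S" "ind3 x y z" shows "ind3 (g x) (g y) (g z)"
proof (rule ind3I)
  show "ind2 (g x) (g y)" using assms ind3_ind2 adj_S adj_S2 g_ind2 by blast
  show "g z \<noteq> a *s g x + b *s g y" for a b
    using g_line_rev[OF assms(1,2)] ind3_not_comb[OF assms(3)] by blast
qed

text \<open>With a zero coefficient, \<open>x + y\<close> would have the same image point as
  \<open>x\<close> or as \<open>y\<close>.\<close>

lemma g_line_sum:
  assumes "adj x y" "ind2 x y"
  shows "\<exists>a b. g (x + y) = a *s g x + b *s g y \<and> a \<noteq> 0 \<and> b \<noteq> 0"
proof -
  obtain a b where e: "g (x + y) = a *s g x + b *s g y"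
    using g_line[OF assms(1), of 1 1] by auto
  have xy: "x \<in> S" "y \<in> S" "x + y \<in> S" using assms adj_S adj_S2 by auto
  have "a \<noteq> 0"
  proof
    assume "a = 0"
    then obtain d where "x + y = d *s y" using e g_inj[OF xy(2,3)] by auto
    moreover have "1 *s x + (1 - d) *s y = (x + y) - d *s y"
      by (simp add: vec.scale_left_diff_distrib algebra_simps)
    ultimately have "1 *s x + (1 - d) *s y = 0" by simp
    then show False using assms(2) unfolding ind2_def by (metis one_neq_zero)
  qed
  moreover have "b \<noteq> 0"
  proof
    assume "b = 0"
    then obtain d where "x + y = d *s x" using e g_inj[OF xy(1,3)] by auto
    moreover have "(1 - d) *s x + 1 *s y = (x + y) - d *s x"
      by (simp add: vec.scale_left_diff_distrib algebra_simps)
    ultimately have "(1 - d) *s x + 1 *s y = 0" by simp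
    then show False using assms(2) unfolding ind2_def by (metis one_neq_zero)
  qed
  ultimately show ?thesis using e by blast
qed

text \<open>With \<open>g (x + y) = a *s g x + b *s g y\<close>, domesticity of \<open>x + y\<close>
  reads \<open>a * f y (g x) + b * f x (g y) = 0\<close>, where \<open>a\<close> and
  \<open>b\<close> are nonzero. This replaces the skew-symmetry of \<open>f x (g y)\<close> as long
  as \<open>g\<close> is not known to be linear.\<close>

lemma dom_swap:
  assumes "adj x y" "f x (g y) = 0" shows "f y (g x) = 0"
proof (cases "ind2 x y")
  case True
  then obtain a b where e: "g (x + y) = a *s g x + b *s g y" "a \<noteq> 0" "b \<noteq> 0"
    using g_line_sum assms by blast
  have "0 = f (x + y) (g (x + y))" using dom adj_S assms by simp
  also have "\<dots> = a * f y (g x)"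
    unfolding e(1) using assms dom adj_S(1)[OF assms(1)] adj_S2[OF assms(1)] by (simp add: f_bilin)
  finally show ?thesis using e by simp
next
  case False
  then consider "x = 0" | c where "y = c *s x" unfolding ind2_iff by blast
  then show ?thesis
    using g_zero dom[OF adj_S(1)[OF assms(1)]] by cases (auto simp: f_bilin)
qed

lemma dom_swap_iff: "adj x y \<Longrightarrow> f x (g y) = 0 \<longleftrightarrow> f y (g x) = 0"
  using dom_swap adj_sym by blast

lemma g_plane_aux:
  assumes "adj x y" "adj x z" "adj y z" "ind3 x y z"
  shows "\<exists>a b c. g (x + y + z) = a *s g x + b *s g y + c *s g z \<and> b \<noteq> 0 \<and> c \<noteq> 0
           \<and> sim (g (y + z)) (b *s g y + c *s g z)"
proof -
  have i: "ind2 y z" using ind3_ind2 assms(4) by blast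
  obtain b c where bc: "g (y + z) = b *s g y + c *s g z" "b \<noteq> 0" "c \<noteq> 0"
    using g_line_sum[OF assms(3) i] by blast
  have adj: "adj x (y + z)" using assms adj_add by blast
  have "ind2 x (y + z)" using ind2_sym[OF ind3_ind2_add[OF ind3_perm(2)[OF assms(4)]]] .
  then obtain a r where ar: "g (x + (y + z)) = a *s g x + r *s g (y + z)" "r \<noteq> 0"
    using g_line_sum[OF adj] by blast
  have "r *s g (y + z) = (r * b) *s g y + (r * c) *s g z"
    unfolding bc by (simp add: vec.scale_right_distrib)
  moreover from this have "sim (g (y + z)) ((r * b) *s g y + (r * c) *s g z)"
    using ar(2) sim_scale(2) by metis
  moreover have "g (x + y + z) = a *s g x + (r * b) *s g y + (r * c) *s g z"
    using ar(1) calculation(1) by (simp add: add.assoc)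
  ultimately show ?thesis using ar(2) bc by (metis mult_eq_0_iff)
qed

text \<open>The three cyclic versions of \<open>g_plane_aux\<close> describe the same vector, and
  independence of the images identifies their coefficients. One triple then serves the plane and all
  three sides; additivity of the normalised lifts comes from this coherence.\<close>

lemma g_plane:
  assumes "adj x y" "adj x z" "adj y z" "ind3 x y z"
  obtains a b c where "g (x + y + z) = a *s g x + b *s g y + c *s g z"
    "a \<noteq> 0" "b \<noteq> 0" "c \<noteq> 0"
    "sim (g (x + y)) (a *s g x + b *s g y)"
    "sim (g (x + z)) (a *s g x + c *s g z)"
    "sim (g (y + z)) (b *s g y + c *s g z)"
proof -
  have I: "ind3 (g x) (g y) (g z)" using g_ind3 assms adj_S2 by blast
  note adj' = assms(1-3)[THEN adj_sym]
  obtain a b c where 1: "g (x + y + z) = a *s g x + b *s g y + c *s g z" "b \<noteq> 0" "c \<noteq> 0"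
    "sim (g (y + z)) (b *s g y + c *s g z)" using g_plane_aux[OF assms] by blast
  have p2: "ind3 y z x" "ind3 z x y" using assms(4) ind3_perm by blast+
  obtain b2 c2 a2 where 2: "g (y + z + x) = b2 *s g y + c2 *s g z + a2 *s g x" "c2 \<noteq> 0" "a2 \<noteq> 0"
    "sim (g (z + x)) (c2 *s g z + a2 *s g x)"
    using g_plane_aux[OF assms(3) adj'(1,2) p2(1)] by blast
  obtain c3 a3 b3 where 3: "g (z + x + y) = c3 *s g z + a3 *s g x + b3 *s g y" "a3 \<noteq> 0" "b3 \<noteq> 0"
    "sim (g (x + y)) (a3 *s g x + b3 *s g y)"
    using g_plane_aux[OF adj'(2,3) assms(1) p2(2)] by blast
  have "a *s g x + b *s g y + c *s g z = a2 *s g x + b2 *s g y + c2 *s g z"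
    using 1(1) 2(1) by (simp add: add_ac)
  then have e2: "a = a2" "c = c2" using ind3_coeffs[OF I] by blast+
  have "a *s g x + b *s g y + c *s g z = a3 *s g x + b3 *s g y + c3 *s g z"
    using 1(1) 3(1) by (simp add: add_ac)
  then have e3: "a = a3" "b = b3" using ind3_coeffs[OF I] by blast+
  show thesis
    by (rule that[OF 1(1) _ 1(2,3) _ _ 1(4)]) (use 2 3 e2 e3 in \<open>auto simp: add.commute\<close>)
qed

text \<open>Lifts relative to a fixed point: if \<open>w\<close> spans a fixed point, the image of the point
  \<open>x + w\<close> singles out one spanning vector of the image of \<open>x\<close>.\<close>

definition cone :: "'k ^ 'm \<Rightarrow> 'k ^ 'm \<Rightarrow> 'k ^ 'm" where
  "cone w x = (if x = 0 then 0 else SOME y. sim y (g x) \<and> sim (g (x + w)) (y + w))"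

text \<open>The vectors \<open>y + w\<close> and \<open>y' + w\<close> are proportional, and the
  coefficient of \<open>w\<close> forces the factor to be 1.\<close>

lemma cone_unique:
  assumes "ind2 (g x) w" "sim y (g x)" "sim z (y + w)" "sim y' (g x)" "sim z (y' + w)"
  shows "y = y'"
proof -
  have "sim (y + w) (y' + w)" using assms sim_sym sim_trans by blast
  then obtain s where s: "y + w = s *s (y' + w)" unfolding sim_def by blast
  obtain t t' where t: "y = t *s g x" "y' = t' *s g x" using assms unfolding sim_def by blast
  have "t *s g x + 1 *s w = (s * t') *s g x + s *s w"
    using s unfolding t by (simp add: vec.scale_right_distrib)
  from ind2_coeffs[OF assms(1) this] show ?thesis using t by simp
qed

lemma ind2_g_fixed:
  assumes "x \<in> S" "w \<in> S" "ind2 x w" "sim (g w) w" shows "ind2 (g x) w"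
  using ind2_sim[OF g_ind2[OF assms(1,2,3)] sim_refl sim_sym[OF assms(4)]] .

lemma cone_props:
  assumes "adj x w" "ind2 x w" "sim (g w) w"
  shows "sim (cone w x) (g x)" "sim (g (x + w)) (cone w x + w)"
proof -
  obtain a b where e: "g (x + w) = a *s g x + b *s g w" "a \<noteq> 0" "b \<noteq> 0"
    using g_line_sum assms by blast
  obtain t where t: "g w = t *s w" "t \<noteq> 0" using assms(3) unfolding sim_def by blast
  have "g (x + w) = (b * t) *s ((a / (b * t)) *s g x + w)"
    unfolding e t using e t by (simp add: vec.scale_right_distrib)
  then have "sim (g (x + w)) ((a / (b * t)) *s g x + w)" by (rule simI) (use e t in simp)
  moreover have "sim ((a / (b * t)) *s g x) (g x)" using e t by (simp add: sim_scale)
  moreover have "x \<noteq> 0" using assms(2) ind2_iff by blast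
  ultimately have "sim (cone w x) (g x) \<and> sim (g (x + w)) (cone w x + w)"
    unfolding cone_def using someI[of "\<lambda>y. sim y (g x) \<and> sim (g (x + w)) (y + w)"] by auto
  then show "sim (cone w x) (g x)" "sim (g (x + w)) (cone w x + w)" by auto
qed

lemma cone_eqI:
  assumes "adj x w" "ind2 x w" "sim (g w) w" "sim y (g x)" "sim (g (x + w)) (y + w)"
  shows "cone w x = y"
proof (rule cone_unique)
  show "ind2 (g x) w" using assms adj_S adj_S2 ind2_g_fixed by blast
qed (use assms cone_props[OF assms(1-3)] in auto)

lemma cone_value:
  assumes "adj x w" "ind2 x w" "sim (g w) w" and k: "c *s g w = k *s w" "k \<noteq> 0" and a: "a \<noteq> 0"
    and s: "sim (g (x + w)) (a *s g x + c *s g w)"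
  shows "cone w x = (a / k) *s g x"
proof (rule cone_eqI[OF assms(1-3)])
  have "a *s g x + c *s g w = k *s ((a / k) *s g x + w)"
    using k by (simp add: vec.scale_right_distrib)
  then show "sim (g (x + w)) ((a / k) *s g x + w)" using s k sim_scale(1) sim_trans by metis
qed (use a k in \<open>simp add: sim_scale\<close>)

lemma cone_zero [simp]: "cone w 0 = 0" by (simp add: cone_def)

text \<open>In the plane of \<open>x\<close>, \<open>y\<close>, \<open>w\<close> all sides use the
  same coefficient of \<open>g w\<close>. So the three lifts are obtained by dividing by the same
  \<open>k\<close>.\<close>

lemma cone_add:
  assumes "adj x y" "adj x w" "adj y w" "ind3 x y w" "sim (g w) w"
  shows "cone w (x + y) = cone w x + cone w y"
    "sim (g (x + y + w)) (cone w x + cone w y + w)"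
proof -
  obtain a b c where e: "g (x + y + w) = a *s g x + b *s g y + c *s g w"
    "a \<noteq> 0" "b \<noteq> 0" "c \<noteq> 0"
    "sim (g (x + y)) (a *s g x + b *s g y)"
    "sim (g (x + w)) (a *s g x + c *s g w)"
    "sim (g (y + w)) (b *s g y + c *s g w)" by (rule g_plane[OF assms(1-4)])
  obtain t where t: "g w = t *s w" "t \<noteq> 0" using assms(5) unfolding sim_def by blast
  define k where "k = c * t"
  have k: "c *s g w = k *s w" "k \<noteq> 0" using t e k_def by auto
  note i = ind3_ind2[OF assms(4)]
  have hx: "cone w x = (a / k) *s g x" by (rule cone_value[OF assms(2) i(2) assms(5) k e(2,6)])
  have hy: "cone w y = (b / k) *s g y" by (rule cone_value[OF assms(3) i(3) assms(5) k e(3,7)])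
  have s: "a *s g x + b *s g y = k *s (cone w x + cone w y)"
    unfolding hx hy using k by (simp add: vec.scale_right_distrib)
  have "g (x + y + w) = k *s (cone w x + cone w y + w)"
    using e(1) s k by (simp add: vec.scale_right_distrib)
  then show 2: "sim (g (x + y + w)) (cone w x + cone w y + w)" by (rule simI) (rule k(2))
  show "cone w (x + y) = cone w x + cone w y"
  proof (rule cone_eqI)
    show "adj (x + y) w" using assms adj_add adj_sym by blast
    show "ind2 (x + y) w" using ind3_ind2_add[OF assms(4)] .
    show "sim (cone w x + cone w y) (g (x + y))"
      using e(5) k(2) unfolding s using sim_scale(2) sim_sym sim_trans by blast
  qed (use assms 2 in auto)
qed

lemma ind3_scale: "ind3 x y w \<Longrightarrow> c \<noteq> 0 \<Longrightarrow> ind3 x (c *s y) w"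
  using ind3_sim sim_refl sim_scale(1) by blast

text \<open>This excludes a companion field automorphism. If \<open>c *s y\<close> has the lift
  \<open>d *s cone w y\<close>, domesticity of \<open>x + y\<close> and of \<open>x + c *s y\<close>
  gives two equations between \<open>f x (cone w y)\<close> and \<open>f y (cone w x)\<close>, and
  together they say \<open>(d - c) * f x (cone w y) = 0\<close>.\<close>

lemma cone_homogeneous:
  assumes adj: "adj x y" "adj x w" "adj y w" and ind: "ind3 x y w" and w: "sim (g w) w"
    and nz: "f x (g y) \<noteq> 0"
  shows "cone w (c *s y) = c *s cone w y"
proof (cases "c = 0")
  case False
  have adj': "adj x (c *s y)" "adj (c *s y) w" using adj adj_scale adj_sym by blast+
  have ind': "ind3 x (c *s y) w" using ind False by (rule ind3_scale)
  have i2: "ind2 x w" "ind2 y w" "ind2 (c *s y) w" using ind ind' ind3_ind2 by blast+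
  have S: "x \<in> S" "y \<in> S" "c *s y \<in> S" using adj adj_S S_scale by blast+
  have h: "sim (cone w x) (g x)" "sim (cone w y) (g y)" "sim (cone w (c *s y)) (g (c *s y))"
    using cone_props(1) adj adj' i2 w by blast+
  have hy: "sim (cone w (c *s y)) (cone w y)"
    using h g_sim_scale[OF S(2) False] sim_trans sim_sym by blast
  then obtain d where d: "cone w (c *s y) = d *s cone w y" unfolding sim_def by blast
  have dom_add: "f (x + z) (cone w x + cone w z) = 0"
    if "adj x z" "adj z w" "ind3 x z w" for z
  proof -
    have "adj (x + z) w" using that adj adj_add adj_sym by blast
    moreover have "ind2 (x + z) w" using ind3_ind2_add[OF that(3)] .
    ultimately have "sim (cone w (x + z)) (g (x + z))" using cone_props w by blast
    then have "f (x + z) (cone w (x + z)) = 0"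
      using f_sim[OF sim_refl[of "x + z"]] dom adj_S(2) that by blast
    then show ?thesis using cone_add(1)[OF that(1) adj(2) that(2,3) w] by simp
  qed
  have z: "f x (cone w x) = 0" "f y (cone w y) = 0" "f x (cone w y) \<noteq> 0"
    using f_sim[OF sim_refl] h dom S nz by blast+
  have "f x (cone w y) + f y (cone w x) = 0"
    using dom_add[OF adj(1) adj(3) ind] z by (simp add: f_bilin add.commute)
  then have e: "f y (cone w x) = - f x (cone w y)" by (simp add: eq_neg_iff_add_eq_0 add.commute)
  have "d * f x (cone w y) + c * f y (cone w x) = 0"
    using dom_add[OF adj' ind'] z unfolding d by (simp add: f_bilin add.commute)
  then have "(d - c) * f x (cone w y) = 0" unfolding e by (simp add: algebra_simps)
  then show ?thesis using z d by simp
qed simp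

text \<open>Planes give additivity on independent vectors, homogeneity gives it on proportional
  ones. The assumption \<open>ex\<close> provides, for each \<open>y\<close>, the partner
  \<open>x\<close> that \<open>cone_homogeneous\<close> asks for.\<close>

lemma cone_linear_on:
  assumes T: "vec.subspace T" and adj: "\<And>x y. x \<in> T \<Longrightarrow> y \<in> T \<Longrightarrow> adj x y"
    and adjw: "\<And>x. x \<in> T \<Longrightarrow> adj x w" and w: "w \<notin> T" "sim (g w) w"
    and ex: "\<And>y. y \<in> T \<Longrightarrow> y \<noteq> 0 \<Longrightarrow>
      \<exists>x. adj x y \<and> adj x w \<and> ind3 x y w \<and> f x (g y) \<noteq> 0"
  shows "x \<in> T \<Longrightarrow> cone w (c *s x) = c *s cone w x"
    and "x \<in> T \<Longrightarrow> y \<in> T \<Longrightarrow> cone w (x + y) = cone w x + cone w y"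
proof -
  show hom: "cone w (c *s x) = c *s cone w x" if "x \<in> T" for c x
  proof (cases "x = 0")
    case False
    then show ?thesis using ex[OF that] cone_homogeneous adjw[OF that] w(2) by blast
  qed simp
  assume xy: "x \<in> T" "y \<in> T"
  show "cone w (x + y) = cone w x + cone w y"
  proof (cases "ind2 x y")
    case True
    have "w \<noteq> a *s x + b *s y" for a b
      using xy w(1) T vec.subspace_add vec.subspace_scale by metis
    then have "ind3 x y w" using True ind3I by blast
    then show ?thesis using cone_add(1) adj adjw xy w by blast
  next
    case False
    then consider "x = 0" | c where "y = c *s x" unfolding ind2_iff by blast
    then show ?thesis
    proof cases
      case 2
      have "cone w ((1 + c) *s x) = (1 + c) *s cone w x" using hom xy by blast
      then show ?thesis using hom[OF xy(1)] 2 by (simp add: vec.scale_left_distrib)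
    qed simp
  qed
qed

text \<open>Because \<open>w + w'\<close> is fixed as well, \<open>w\<close> and \<open>w'\<close>
  get equal coefficients in the image of the plane of \<open>x\<close>, \<open>w\<close>,
  \<open>w'\<close>. Both normalisations therefore divide by the same scalar.\<close>

lemma cone_fixed_sum:
  assumes "adj x w" "adj x w'" "adj w w'" "ind3 x w w'"
    and "sim (g w) w" "sim (g w') w'" "sim (g (w + w')) (w + w')"
  shows "cone w x = cone w' x"
proof -
  obtain a b c where e: "g (x + w + w') = a *s g x + b *s g w + c *s g w'"
    "a \<noteq> 0" "b \<noteq> 0" "c \<noteq> 0"
    "sim (g (x + w)) (a *s g x + b *s g w)"
    "sim (g (x + w')) (a *s g x + c *s g w')"
    "sim (g (w + w')) (b *s g w + c *s g w')" by (rule g_plane[OF assms(1-4)])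
  obtain s t where t: "g w = t *s w" "t \<noteq> 0" "g w' = s *s w'" "s \<noteq> 0"
    using assms unfolding sim_def by blast
  have "sim (w + w') ((b * t) *s w + (c * s) *s w')"
    using e(7) assms(7) t sim_sym sim_trans vec.scale_scale by metis
  then obtain r where r: "w + w' = r *s ((b * t) *s w + (c * s) *s w')" unfolding sim_def by blast
  have i: "ind2 w w'" "ind2 x w" "ind2 x w'" using assms ind3_ind2 by blast+
  have "1 *s w + 1 *s w' = (r * (b * t)) *s w + (r * (c * s)) *s w'"
    using r by (simp add: vec.scale_right_distrib)
  from ind2_coeffs[OF i(1) this] have "b * t = c * s" by (metis mult_left_cancel mult_zero_left one_neq_zero)
  then obtain k where k: "b * t = k" "c * s = k" "k \<noteq> 0" using e t by auto
  have "cone w x = (a / k) *s g x"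
    by (rule cone_value[OF assms(1) i(2) assms(5) _ k(3) e(2,5)]) (use k t in simp)
  moreover have "cone w' x = (a / k) *s g x"
    by (rule cone_value[OF assms(2) i(3) assms(6) _ k(3) e(2,6)]) (use k t in simp)
  ultimately show ?thesis by simp
qed

text \<open>For \<open>y\<close> orthogonal to \<open>g x\<close>, \<open>dom_swap\<close> turns
  \<open>f y (g (g x)) = 0\<close> into \<open>f (g x) (g y) = 0\<close>, hence into
  \<open>f x y = 0\<close>. So no singular vector can separate \<open>g (g x)\<close> from
  \<open>x\<close> and \<open>g x\<close>.\<close>

lemma g_stable_line:
  assumes "x \<in> S" shows "\<exists>a b. g (g x) = a *s x + b *s g x"
proof (cases "ind2 x (g x)")
  case False
  then consider "x = 0" | c where "g x = c *s x" unfolding ind2_iff by blast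
  then show ?thesis
  proof cases
    case 1
    then show ?thesis using g_zero by (intro exI[of _ 0]) simp
  next
    case 2
    then have "c \<noteq> 0 \<or> x = 0" using g_nz[OF assms] by auto
    then have "sim (g (g x)) (g x)" using g_sim_scale[OF assms, of c] g_zero 2 by auto
    then show ?thesis unfolding sim_def by (metis add.left_neutral vec.scale_zero_left)
  qed
next
  case True
  let ?u = "g x" and ?v = "g (g x)"
  have S: "x \<in> S" "?u \<in> S" "?v \<in> S" using assms g_S by auto
  have key: "f y x = 0 \<longleftrightarrow> f y ?v = 0" if y: "y \<in> S" "f y ?u = 0" for y
  proof -
    have a: "adj y ?u" using adj_perp S y by blast
    have "f y ?v = 0 \<longleftrightarrow> f ?u (g y) = 0" using dom_swap_iff[OF a] .
    also have "\<dots> \<longleftrightarrow> f x y = 0" using g_perp assms y by blast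
    also have "\<dots> \<longleftrightarrow> f y x = 0" by (rule f_sym0)
    finally show ?thesis by blast
  qed
  have xu: "f x ?u = 0" using dom S by blast
  have xv: "f x ?v = 0" using key[OF S(1) xu] S_self S by blast
  show ?thesis
  proof (rule ccontr)
    assume "\<not> ?thesis"
    then obtain w where "w \<in> S" "f w x = 0" "f w ?u = 0" "f w ?v \<noteq> 0"
      using separate_sing[OF S xu xv dom[OF S(2)]] by blast
    then show False using key by blast
  qed
qed

end

section \<open>Symplectic bases of opposite subspaces\<close>

lemma span_induct_step [consumes 1, case_names base step]:
  fixes x :: "'k::field ^ 'm::finite"
  assumes "x \<in> vec.span A" and base: "P 0"
    and step: "\<And>c a z. a \<in> A \<Longrightarrow> z \<in> vec.span A \<Longrightarrow> P z \<Longrightarrow> P (c *s a + z)"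
  shows "P x"
proof -
  have "x \<in> vec.span A \<and> P x"
    using assms(1) by (induction rule: vec.span_induct_alt)
      (use base step in \<open>auto simp: vec.span_zero vec.span_add vec.span_scale vec.span_base\<close>)
  then show ?thesis ..
qed

context form_space
begin

lemma span_sing:
  assumes "A \<subseteq> S" "\<And>x y. x \<in> A \<Longrightarrow> y \<in> A \<Longrightarrow> f x y = 0"
    and "x \<in> vec.span A" "y \<in> vec.span A"
  shows "x \<in> S" "f x y = 0"
proof -
  have 1: "f x y = 0" if "x \<in> vec.span A" "y \<in> A" for x y
    using that(1) by (induction rule: vec.span_induct_alt) (use that assms in \<open>auto simp: f_bilin\<close>)
  have 2: "f x y = 0" if "x \<in> vec.span A" "y \<in> vec.span A" for x y
    using that(2) by (induction rule: vec.span_induct_alt) (use 1 that in \<open>auto simp: f_bilin\<close>)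
  show "f x y = 0" using 2 assms by blast
  from assms(3) show "x \<in> S"
  proof (induction rule: span_induct_step)
    case (step c a z)
    have "f a z = 0" using 2[OF vec.span_base[OF step(1)] step(2)] .
    then have "f (c *s a) z = 0" by (simp add: f_bilin)
    moreover have "c *s a \<in> S" using step(1) assms(1) S_scale by blast
    ultimately show ?case using step(3) S_add by blast
  qed (rule S_zero)
qed

lemma dual_expansion:
  assumes fin: "finite I" and pair: "\<And>a b. a \<in> I \<Longrightarrow> b \<in> I \<Longrightarrow> f (v a) (v' b) = (if a = b then 1 else 0)"
    and x: "x \<in> vec.span (v ` I)"
  shows "x = (\<Sum>a\<in>I. f x (v' a) *s v a)"
  using x
proof (induction rule: vec.span_induct_alt)
  case (step c b z)
  then obtain a where a: "a \<in> I" "b = v a" by blast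
  have "(\<Sum>a'\<in>I. f (v a) (v' a') *s v a') = (\<Sum>a'\<in>I. if a' = a then v a' else 0)"
    by (rule sum.cong) (use pair a in auto)
  also have "\<dots> = v a" using a fin by simp
  finally have 1: "(\<Sum>a'\<in>I. f (v a) (v' a') *s v a') = v a" .
  have "(\<Sum>a'\<in>I. f (c *s v a + z) (v' a') *s v a')
      = (\<Sum>a'\<in>I. c *s (f (v a) (v' a') *s v a') + f z (v' a') *s v a')"
    by (rule sum.cong) (simp_all add: f_bilin vec.scale_left_distrib)
  also have "\<dots> = c *s v a + (\<Sum>a'\<in>I. f z (v' a') *s v a')"
    unfolding sum.distrib vec.scale_sum_right[symmetric] 1 ..
  finally show ?case using step a by simp
qed simp

end

definition idx :: "nat \<Rightarrow> (nat \<times> bool) set" where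
  "idx m = {..<m} \<times> UNIV"

definition partner :: "nat \<times> bool \<Rightarrow> nat \<times> bool" where
  "partner a = (fst a, \<not> snd a)"

lemma finite_idx [simp]: "finite (idx m)" by (simp add: idx_def)

lemma card_idx [simp]: "card (idx m) = 2 * m" by (simp add: idx_def card_cartesian_product)

lemma partner_partner [simp]: "partner (partner a) = a" by (simp add: partner_def)

lemma partner_idx [simp]: "partner a \<in> idx m \<longleftrightarrow> a \<in> idx m"
  by (auto simp: partner_def idx_def mem_Times_iff)

lemma partner_inj [simp]: "partner a = partner b \<longleftrightarrow> a = b"
  by (metis partner_partner)

lemma idx_Suc: "idx (Suc m) = insert (m, True) (insert (m, False) (idx m))"
  by (auto simp: idx_def)

context domestic
begin

lemma g_span:
  assumes "A \<subseteq> S" "\<And>x y. x \<in> A \<Longrightarrow> y \<in> A \<Longrightarrow> f x y = 0" "x \<in> vec.span A"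
  shows "g x \<in> vec.span (g ` A)"
  using assms(3)
proof (induction rule: span_induct_step)
  case base
  then show ?case by (simp add: g_zero vec.span_zero)
next
  case (step c a z)
  have "f a z = 0" using span_sing(2)[OF assms(1,2) vec.span_base[OF step(1)] step(2)] .
  moreover have "a \<in> S" "z \<in> S" using step span_sing(1)[OF assms(1,2)] assms(1) by blast+
  ultimately have "adj a z" using adj_perp by blast
  from g_line[OF this, of c 1] obtain p q where "g (c *s a + z) = p *s g a + q *s g z" by auto
  then show ?case using step by (simp add: vec.span_add vec.span_scale vec.span_base)
qed

lemma g_span_onto:
  assumes "A \<subseteq> S" "\<And>x y. x \<in> A \<Longrightarrow> y \<in> A \<Longrightarrow> f x y = 0" "z \<in> vec.span (g ` A)"
  shows "\<exists>x\<in>vec.span A. \<exists>t. z = t *s g x"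
  using assms(3)
proof (induction rule: span_induct_step)
  case base
  then show ?case using vec.span_zero g_zero vec.scale_zero_right by metis
next
  case (step c b z)
  then obtain a x t where a: "a \<in> A" "b = g a" "x \<in> vec.span A" "z = t *s g x" by blast
  have "f a x = 0" using span_sing(2)[OF assms(1,2) vec.span_base[OF a(1)] a(3)] .
  moreover have "a \<in> S" "x \<in> S" using a span_sing(1)[OF assms(1,2)] assms(1) by blast+
  ultimately have "adj a x" using adj_perp by blast
  from g_onto[OF this] obtain p q s where "c *s g a + t *s g x = s *s g (p *s a + q *s x)" by blast
  moreover have "p *s a + q *s x \<in> vec.span A"
    using a by (simp add: vec.span_add vec.span_scale vec.span_base)
  ultimately show ?case using a by metis
qed

text \<open>Bases of singular subspaces that are mapped to opposite ones, symplectic with respect to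
  the alternating form \<open>f x (g y)\<close>: \<open>(j, True)\<close> and \<open>(j, False)\<close> index the \<open>j\<close>-th hyperbolic pair.\<close>

definition hsys :: "nat \<Rightarrow> (nat \<times> bool \<Rightarrow> 'k ^ 'm) \<Rightarrow> bool" where
  "hsys m e \<longleftrightarrow> (\<forall>a\<in>idx m. e a \<in> S) \<and> (\<forall>a\<in>idx m. \<forall>b\<in>idx m. f (e a) (e b) = 0) \<and>
     (\<forall>a\<in>idx m. \<forall>b\<in>idx m. f (e a) (g (e b)) \<noteq> 0 \<longleftrightarrow> b = partner a)"

text \<open>A basis of the image subspace, scaled to be dual to \<open>e\<close> under
  \<open>f\<close>.\<close>

definition dual :: "(nat \<times> bool \<Rightarrow> 'k ^ 'm) \<Rightarrow> nat \<times> bool \<Rightarrow> 'k ^ 'm" where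
  "dual e a = (1 / f (e a) (g (e (partner a)))) *s g (e (partner a))"

definition Wp :: "nat \<Rightarrow> (nat \<times> bool \<Rightarrow> 'k ^ 'm) \<Rightarrow> ('k ^ 'm) set" where
  "Wp m e = {v. \<forall>a\<in>idx m. f v (e a) = 0 \<and> f v (dual e a) = 0}"

text \<open>Projection along \<open>Wp m e\<close> onto the span of the subspace and its image. The
  factor \<epsilon> compensates \<open>f (dual e a) (e a) = \<epsilon>\<close>.\<close>

definition projX :: "nat \<Rightarrow> (nat \<times> bool \<Rightarrow> 'k ^ 'm) \<Rightarrow> 'k ^ 'm \<Rightarrow> 'k ^ 'm" where
  "projX m e v = (\<Sum>a\<in>idx m. f v (dual e a) *s e a) + (\<Sum>a\<in>idx m. (\<epsilon> * f v (e a)) *s dual e a)"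

lemma hsysD:
  assumes "hsys m e" "a \<in> idx m"
  shows "e a \<in> S" "b \<in> idx m \<Longrightarrow> f (e a) (e b) = 0"
    "b \<in> idx m \<Longrightarrow> f (e a) (g (e b)) \<noteq> 0 \<longleftrightarrow> b = partner a"
  using assms unfolding hsys_def by blast+

lemma dual_sim:
  assumes "hsys m e" "a \<in> idx m" shows "sim (dual e a) (g (e (partner a)))"
  unfolding dual_def by (rule sim_scale) (use hsysD(3)[OF assms, of "partner a"] assms in simp)

lemma dual_S: "hsys m e \<Longrightarrow> a \<in> idx m \<Longrightarrow> dual e a \<in> S"
  using dual_sim S_sim g_S hsysD(1) partner_idx by metis

lemma dual_pair:
  assumes "hsys m e" "a \<in> idx m" "b \<in> idx m"
  shows "f (e a) (dual e b) = (if a = b then 1 else 0)"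
proof (cases "a = b")
  case True
  then show ?thesis
    using hsysD(3)[OF assms(1,2), of "partner a"] assms unfolding dual_def by (simp add: f_bilin)
next
  case False
  then have "f (e a) (g (e (partner b))) = 0"
    using hsysD(3)[OF assms(1,2), of "partner b"] assms by simp
  then show ?thesis using False unfolding dual_def by (simp add: f_bilin)
qed

lemma dual_pair': 
  "hsys m e \<Longrightarrow> a \<in> idx m \<Longrightarrow> b \<in> idx m \<Longrightarrow> f (dual e b) (e a) = (if a = b then \<epsilon> else 0)"
  using dual_pair f_swap[of "dual e b" "e a"] by simp

lemma dual_perp:
  assumes "hsys m e" "a \<in> idx m" "b \<in> idx m" shows "f (dual e a) (dual e b) = 0"
proof -
  have "f (g (e (partner a))) (g (e (partner b))) = 0"
    using g_perp hsysD[OF assms(1)] assms by simp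
  then show ?thesis using f_sim dual_sim assms by blast
qed

text \<open>The images of the dual vectors are proportional to \<open>g (g (e b))\<close>, and
  \<open>g\<close> preserves orthogonality, so their pairing reduces to that of \<open>e\<close>.
  Results on a subspace thereby transfer to its image.\<close>

lemma dual_hsys:
  assumes h: "hsys m e" shows "hsys m (dual e)"
  unfolding hsys_def
proof (intro conjI ballI)
  fix a b assume a: "a \<in> idx m" and b: "b \<in> idx m"
  have s: "sim (dual e a) (g (e (partner a)))" "sim (dual e b) (g (e (partner b)))"
    using dual_sim h a b by blast+
  then have "sim (g (dual e b)) (g (g (e (partner b))))"
    using g_sim g_S hsysD(1)[OF h] b by simp
  then have "f (dual e a) (g (dual e b)) = 0 \<longleftrightarrow> f (g (e (partner a))) (g (g (e (partner b)))) = 0"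
    using s f_sim by blast
  also have "\<dots> \<longleftrightarrow> f (e (partner a)) (g (e (partner b))) = 0"
    using g_perp g_S hsysD(1)[OF h] a b by simp
  also have "\<dots> \<longleftrightarrow> partner b \<noteq> a" using hsysD(3)[OF h, of "partner a" "partner b"] a b by auto
  finally show "f (dual e a) (g (dual e b)) \<noteq> 0 \<longleftrightarrow> b = partner a" by auto
qed (use dual_S dual_perp h in auto)

lemma projX_pair:
  assumes h: "hsys m e" and b: "b \<in> idx m"
  shows "f (projX m e v) (e b) = f v (e b)" "f (projX m e v) (dual e b) = f v (dual e b)"
proof -
  have "f (projX m e v) (e b) = (\<Sum>a\<in>idx m. f v (dual e a) * f (e a) (e b))
      + (\<Sum>a\<in>idx m. \<epsilon> * f v (e a) * f (dual e a) (e b))"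
    unfolding projX_def by (simp add: f_bilin)
  also have "(\<Sum>a\<in>idx m. f v (dual e a) * f (e a) (e b)) = 0"
    using hsysD(2)[OF h] b by simp
  also have "(\<Sum>a\<in>idx m. \<epsilon> * f v (e a) * f (dual e a) (e b))
      = (\<Sum>a\<in>idx m. if a = b then \<epsilon> * f v (e a) * \<epsilon> else 0)"
    by (rule sum.cong) (use dual_pair'[OF h] b in auto)
  also have "\<dots> = f v (e b)" using b eps by (simp add: mult.commute mult.left_commute)
  finally show "f (projX m e v) (e b) = f v (e b)" by simp
  have "f (projX m e v) (dual e b) = (\<Sum>a\<in>idx m. f v (dual e a) * f (e a) (dual e b))
      + (\<Sum>a\<in>idx m. \<epsilon> * f v (e a) * f (dual e a) (dual e b))"
    unfolding projX_def by (simp add: f_bilin)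
  also have "(\<Sum>a\<in>idx m. \<epsilon> * f v (e a) * f (dual e a) (dual e b)) = 0"
    using dual_perp[OF h] b by simp
  also have "(\<Sum>a\<in>idx m. f v (dual e a) * f (e a) (dual e b))
      = (\<Sum>a\<in>idx m. if a = b then f v (dual e a) else 0)"
    by (rule sum.cong) (use dual_pair[OF h] b in auto)
  also have "\<dots> = f v (dual e b)" using b by simp
  finally show "f (projX m e v) (dual e b) = f v (dual e b)" by simp
qed

lemma compl_Wp: "hsys m e \<Longrightarrow> v - projX m e v \<in> Wp m e"
  unfolding Wp_def by (simp add: f_bilin projX_pair)

lemma projX_perp: "w \<in> Wp m e \<Longrightarrow> f (projX m e v) w = 0"
proof -
  assume "w \<in> Wp m e"
  then have "f (e a) w = 0" "f (dual e a) w = 0" if "a \<in> idx m" for a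
    using that f_sym0 unfolding Wp_def by blast+
  then show ?thesis unfolding projX_def by (simp add: f_bilin)
qed

lemma Wp_subspace: "vec.subspace (Wp m e)"
  unfolding Wp_def vec.subspace_def by (simp add: f_bilin)

lemma hsys_independent:
  assumes h: "hsys m e"
  shows "inj_on e (idx m)" "vec.independent (e ` idx m)" "4 * m \<le> CARD('m)"
proof -
  have p: "\<And>a b. a \<in> idx m \<Longrightarrow> b \<in> idx m \<Longrightarrow> f (e b) (dual e a) \<noteq> 0 \<longleftrightarrow> a = b"
    using dual_pair[OF h] by auto
  show "inj_on e (idx m)" "vec.independent (e ` idx m)"
    using independent_dual_family[OF finite_idx linfun_f(1) p] by auto
  \<comment> \<open>For the bound, the \<open>2 * m\<close> vectors \<open>e a\<close> and the
    \<open>2 * m\<close> vectors \<open>dual e a\<close> form one family; exchanging the two kinds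
    gives a family dual to it up to the factor \<epsilon>.\<close>
  let ?J = "idx m \<times> (UNIV :: bool set)"
  let ?v = "\<lambda>(a, s). if s then e a else dual e a" and ?v' = "\<lambda>(a, s). if s then dual e a else e a"
  have J: "finite ?J" by simp
  have q: "f (?v b) (?v' a) \<noteq> 0 \<longleftrightarrow> a = b" if "a \<in> ?J" "b \<in> ?J" for a b
    using that dual_pair[OF h] dual_pair'[OF h] dual_perp[OF h] hsysD(2)[OF h] eps_nz
    by (auto split: prod.splits if_splits)
  have ind: "inj_on ?v ?J" "vec.independent (?v ` ?J)"
    using independent_dual_family[where \<phi> = "\<lambda>a x. f x (?v' a)" and v = ?v, OF J linfun_f(1) q]
    by fastforce+
  have "card (?v ` ?J) \<le> vec.dim (UNIV :: ('k ^ 'm) set)"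
    by (rule vec.independent_card_le_dim[OF subset_UNIV ind(2)])
  then show "4 * m \<le> CARD('m)"
    unfolding card_image[OF ind(1)] vec_dim_card card_cartesian_product by simp
qed

lemma hsys_span:
  assumes h: "hsys m e"
  defines "U \<equiv> vec.span (e ` idx m)"
  shows "x \<in> U \<Longrightarrow> x \<in> S" "x \<in> U \<Longrightarrow> y \<in> U \<Longrightarrow> f x y = 0" "vec.dim U = 2 * m"
    "x \<in> U \<Longrightarrow> x \<noteq> 0 \<Longrightarrow> \<exists>a\<in>idx m. f x (g (e a)) \<noteq> 0 \<and> f (e a) (g x) \<noteq> 0"
    "x \<in> U \<Longrightarrow> x = (\<Sum>a\<in>idx m. f x (dual e a) *s e a)"
proof -
  have A: "e ` idx m \<subseteq> S" "\<And>x y. x \<in> e ` idx m \<Longrightarrow> y \<in> e ` idx m \<Longrightarrow> f x y = 0"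
    using hsysD[OF h] by auto
  show s: "x \<in> S" if "x \<in> U" for x using span_sing(1)[OF A] that U_def by blast
  show "f x y = 0" if "x \<in> U" "y \<in> U" for x y using span_sing(2)[OF A] that U_def by blast
  note i = hsys_independent[OF h]
  show "vec.dim U = 2 * m"
    unfolding U_def using vec.dim_span_eq_card_independent[OF i(2)] card_image[OF i(1)] by simp
  show ex: "x = (\<Sum>a\<in>idx m. f x (dual e a) *s e a)" if "x \<in> U" for x
    using dual_expansion[OF finite_idx dual_pair[OF h]] that unfolding U_def by blast
  show "\<exists>a\<in>idx m. f x (g (e a)) \<noteq> 0 \<and> f (e a) (g x) \<noteq> 0" if x: "x \<in> U" "x \<noteq> 0" for x
  proof -
    obtain a where a: "a \<in> idx m" "f x (dual e a) \<noteq> 0"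
      using ex[OF x(1)] x(2) by (metis (no_types, lifting) sum.neutral vec.scale_zero_left)
    then have 1: "f x (g (e (partner a))) \<noteq> 0"
      using f_sim[OF sim_refl dual_sim[OF h]] by blast
    have "e (partner a) \<in> U" unfolding U_def by (rule vec.span_base) (use a in simp)
    then have "adj x (e (partner a))"
      using x span_sing[OF A] adj_perp unfolding U_def by metis
    then have "f (e (partner a)) (g x) \<noteq> 0" using 1 dom_swap_iff by blast
    then show ?thesis using 1 a by (intro bexI[of _ "partner a"]) auto
  qed
qed

lemma Wp_g: 
  assumes h: "hsys m e"
  shows "w \<in> Wp m e \<longleftrightarrow> (\<forall>a\<in>idx m. f w (e a) = 0 \<and> f w (g (e a)) = 0)"
proof -
  have "(\<forall>a\<in>idx m. f w (dual e a) = 0) \<longleftrightarrow> (\<forall>a\<in>idx m. f w (g (e a)) = 0)"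
    using f_sim[OF sim_refl dual_sim[OF h]] partner_idx partner_partner by metis
  then show ?thesis unfolding Wp_def by blast
qed

lemma Wp_dim: "CARD('m) \<le> vec.dim (Wp m e) + 4 * m"
proof -
  let ?J = "idx m \<times> (UNIV :: bool set)"
  let ?\<phi> = "\<lambda>a x. f x (if snd a then e (fst a) else dual e (fst a))"
  have "vec.dim (UNIV :: ('k ^ 'm) set) \<le> vec.dim {t \<in> UNIV. \<forall>a\<in>?J. ?\<phi> a t = 0} + card ?J"
    by (rule dim_functionals[OF vec.subspace_UNIV _ linfun_f(1)]) simp
  moreover have "{t \<in> UNIV. \<forall>a\<in>?J. ?\<phi> a t = 0} = Wp m e"
  proof (intro set_eqI)
    fix t
    have "(\<forall>a\<in>?J. ?\<phi> a t = 0) \<longleftrightarrow> (\<forall>a\<in>idx m. \<forall>s. ?\<phi> (a, s) t = 0)" by blast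
    also have "\<dots> \<longleftrightarrow> t \<in> Wp m e" unfolding Wp_def all_bool_eq by simp
    finally show "t \<in> {t \<in> UNIV. \<forall>a\<in>?J. ?\<phi> a t = 0} \<longleftrightarrow> t \<in> Wp m e" by simp
  qed
  ultimately show ?thesis by (simp add: card_cart_basis card_cartesian_product)
qed

text \<open>\<open>T\<close> is already orthogonal to \<open>?U \<inter> T\<close>, so orthogonality
  to \<open>?U\<close> costs only \<open>2 * m - dim (?U \<inter> T)\<close> functionals on
  \<open>T\<close>. Hence some \<open>t\<close> in \<open>T\<close> outside \<open>?U\<close> is
  orthogonal to \<open>?U\<close>. Its projection \<open>projX m e t\<close> lies in
  \<open>?U\<close>, and subtracting it keeps \<open>t\<close> singular and nonzero.\<close>

lemma Wp_singular_exists: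
  assumes h: "hsys m e" and T: "vec.subspace T" "T \<subseteq> S" "\<And>x y. x \<in> T \<Longrightarrow> y \<in> T \<Longrightarrow> f x y = 0"
    and dim: "2 * m < vec.dim T"
  shows "\<exists>w. w \<in> Wp m e \<and> w \<in> S \<and> w \<noteq> 0"
proof -
  let ?U = "vec.span (e ` idx m)"
  obtain B where B: "B \<subseteq> ?U \<inter> T" "vec.independent B" "?U \<inter> T \<subseteq> vec.span B" "card B = vec.dim (?U \<inter> T)"
    by (rule vec.basis_exists)
  obtain C where C: "B \<subseteq> C" "C \<subseteq> ?U" "vec.independent C" "?U \<subseteq> vec.span C"
    using vec.maximal_independent_subset_extend[of B ?U] B by blast
  have fin: "finite C" using vec.finiteI_independent[OF C(3)] .
  have "vec.span C = ?U" using C(4) vec.span_minimal[OF C(2) vec.subspace_span] by blast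
  then have cC: "card C = 2 * m"
    using vec.dim_span_eq_card_independent[OF C(3)] hsys_span(3)[OF h] by simp
  let ?T = "{t \<in> T. \<forall>c\<in>C - B. f t c = 0}"
  have "vec.dim T \<le> vec.dim ?T + card (C - B)"
    by (rule dim_functionals[OF T(1) _ linfun_f(1)]) (use fin in simp)
  moreover have "card (C - B) = 2 * m - vec.dim (?U \<inter> T)"
    using card_Diff_subset[OF finite_subset[OF C(1) fin] C(1)] cC B(4) by simp
  moreover have "vec.dim (?U \<inter> T) \<le> vec.dim ?U" by (rule vec.dim_subset) simp
  then have "vec.dim (?U \<inter> T) \<le> 2 * m" using hsys_span(3)[OF h] by simp
  ultimately have "vec.dim (?U \<inter> T) < vec.dim ?T" using dim by linarith
  then have "\<not> ?T \<subseteq> ?U \<inter> T" using vec.dim_subset[of ?T "?U \<inter> T"] by linarith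
  then obtain t where t: "t \<in> T" "\<And>c. c \<in> C - B \<Longrightarrow> f t c = 0" "t \<notin> ?U" by blast
  have tC: "f t c = 0" if "c \<in> C" for c using that t(1,2) B(1) T(3) by blast
  have "f t x = 0" if "x \<in> vec.span C" for x
    using that by (induction rule: vec.span_induct_alt) (auto simp: f_bilin tC)
  then have tU: "f t x = 0" if "x \<in> ?U" for x using that C(4) by blast
  then have te: "f t (e a) = 0" if "a \<in> idx m" for a using that vec.span_base by blast
  then have "projX m e t = (\<Sum>a\<in>idx m. f t (dual e a) *s e a)" by (simp add: projX_def)
  moreover have "\<dots> \<in> ?U" by (intro vec.span_sum vec.span_scale vec.span_base) auto
  ultimately have p: "projX m e t \<in> ?U" by simp
  have "- projX m e t \<in> S" using hsys_span(1)[OF h p] S_uminus by blast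
  moreover have "f t (- projX m e t) = 0" using tU[OF p] by (simp add: f_bilin)
  ultimately have "t + (- projX m e t) \<in> S" using S_add T(2) t(1) by blast
  moreover have "t - projX m e t \<noteq> 0" using p t(3) by auto
  ultimately show ?thesis using compl_Wp[OF h, of t] by auto
qed

lemma hsys_extend:
  assumes h: "hsys m e" and qr: "q \<in> S" "r \<in> S" "f q r = 0" "f q (g r) \<noteq> 0"
    and W: "q \<in> Wp m e" "r \<in> Wp m e"
  shows "hsys (Suc m) (e((m, True) := q, (m, False) := r))"
proof -
  let ?e = "e((m, True) := q, (m, False) := r)"
  have w: "f q (e a) = 0" "f q (g (e a)) = 0" "f r (e a) = 0" "f r (g (e a)) = 0"
    "f (e a) q = 0" "f (e a) r = 0" if "a \<in> idx m" for a
    using W that f_sym0 unfolding Wp_g[OF h] by blast+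
  have w2: "f (e a) (g q) = 0" "f (e a) (g r) = 0" if "a \<in> idx m" for a
    using dom_swap w[OF that] adj_perp hsysD(1)[OF h that] qr by blast+
  have rq: "f r (g q) \<noteq> 0" "f r q = 0" using dom_swap_iff[OF adj_perp] qr f_sym0 by blast+
  have np: "a \<noteq> (m, s)" "(m, s) \<noteq> partner a" if "a \<in> idx m" for a s
    using that by (auto simp: idx_def partner_def)
  have pm: "partner (m, s) = (m, \<not> s)" for s by (simp add: partner_def)
  have "\<forall>a\<in>idx (Suc m). ?e a \<in> S"
    unfolding idx_Suc using qr hsysD(1)[OF h] by (simp add: np)
  moreover have "\<forall>a\<in>idx (Suc m). \<forall>b\<in>idx (Suc m). f (?e a) (?e b) = 0"
    unfolding idx_Suc using qr rq w hsysD(2)[OF h] S_self[OF qr(1)] S_self[OF qr(2)]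
    by (simp add: np)
  moreover have "\<forall>a\<in>idx (Suc m). \<forall>b\<in>idx (Suc m).
      f (?e a) (g (?e b)) \<noteq> 0 \<longleftrightarrow> b = partner a"
    unfolding idx_Suc using qr rq w w2 hsysD(3)[OF h] dom[OF qr(1)] dom[OF qr(2)]
    by (simp add: np pm)
  ultimately show ?thesis unfolding hsys_def by blast
qed

text \<open>If \<open>w\<close> were moved, a singular \<open>r\<close> in \<open>Wp m e\<close>
  orthogonal to \<open>w\<close> but not to \<open>g w\<close> would exist; by
  \<open>dom_swap\<close> the pair \<open>w\<close>, \<open>r\<close> would extend the system,
  against its maximality.\<close>

lemma Wp_fixed:
  assumes h: "hsys m e" and max: "\<And>e'. \<not> hsys (Suc m) e'" and w: "w \<in> Wp m e" "w \<in> S"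
  shows "sim (g w) w"
proof (cases "w = 0")
  case True
  then show ?thesis by (simp add: g_zero)
next
  case False
  have gw: "g w \<in> S" "f w (g w) = 0" "f (g w) w = 0" using w g_S dom f_sym0 by blast+
  have gW: "g w \<in> Wp m e" unfolding Wp_g[OF h]
  proof
    fix a assume a: "a \<in> idx m"
    have "f w (e a) = 0" "f w (g (e a)) = 0" using w a unfolding Wp_g[OF h] by blast+
    moreover have ea: "e a \<in> S" using hsysD h a by blast
    ultimately have "f (e a) (g w) = 0" "f (g w) (g (e a)) = 0"
      using dom_swap adj_perp w g_perp by blast+
    then show "f (g w) (e a) = 0 \<and> f (g w) (g (e a)) = 0" using f_sym0 by blast
  qed
  show ?thesis
  proof (rule ccontr)
    assume ns: "\<not> sim (g w) w"
    have nc: "g w \<noteq> a *s w + b *s w" for a b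
    proof
      assume "g w = a *s w + b *s w"
      then have "g w = (a + b) *s w" by (simp add: vec.scale_left_distrib)
      moreover have "g w \<noteq> 0" using g_nz w False by blast
      ultimately show False using ns unfolding sim_def by (metis vec.scale_zero_left)
    qed
    \<comment> \<open>Here \<open>w\<close> plays both roles of the first two vectors of
      \<open>separate_sing\<close>.\<close>
    obtain v where v: "v \<in> S" "f v w = 0" "f v (g w) \<noteq> 0"
      using separate_sing[OF w(2) w(2) gw(1) S_self[OF w(2)] gw(2) gw(2) nc] by blast
    \<comment> \<open>Removing the component outside \<open>Wp m e\<close> keeps the pairings with
      \<open>w\<close> and \<open>g w\<close>, which lie in \<open>Wp m e\<close>. A multiple of
      \<open>g w\<close> then restores singularity.\<close>
    define r0 where "r0 = v - projX m e v"
    have r0: "r0 \<in> Wp m e" "f r0 w = 0" "f r0 (g w) \<noteq> 0"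
      unfolding r0_def using compl_Wp[OF h] projX_perp w gW v by (auto simp: f_bilin)
    obtain c where c: "r0 + c *s g w \<in> S" using S_lift[OF gw(1) r0(3)] by blast
    let ?r = "r0 + c *s g w"
    have r: "?r \<in> Wp m e" "f ?r w = 0" "f ?r (g w) \<noteq> 0"
      using r0 gW gw S_self[OF gw(1)] Wp_subspace
      by (auto simp: f_bilin vec.subspace_add vec.subspace_scale)
    have "f w ?r = 0" using r f_sym0 by blast
    moreover have "f w (g ?r) \<noteq> 0"
      using r(3) dom_swap_iff[OF adj_perp[OF w(2) c \<open>f w ?r = 0\<close>]] by blast
    ultimately show False using hsys_extend[OF h w(2) c] w r max by blast
  qed
qed

text \<open>Symplectic Gram-Schmidt process for the pairing \<open>f x (g y)\<close> on
  \<open>U\<close>, adding one hyperbolic pair at a time. The map \<pi> is the projection of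
  \<open>U\<close> onto its part in \<open>Wp m e\<close>.\<close>

lemma hsys_exists:
  assumes U: "vec.subspace U" "U \<subseteq> S" "\<And>x y. x \<in> U \<Longrightarrow> y \<in> U \<Longrightarrow> f x y = 0"
    and opp: "\<And>x. x \<in> U \<Longrightarrow> x \<noteq> 0 \<Longrightarrow> \<exists>y\<in>U. f x (g y) \<noteq> 0"
  shows "2 * m \<le> vec.dim U \<Longrightarrow> \<exists>e. hsys m e \<and> e ` idx m \<subseteq> U"
proof (induction m)
  case 0
  then show ?case by (simp add: hsys_def idx_def)
next
  case (Suc m)
  then obtain e where h: "hsys m e" and eU: "e ` idx m \<subseteq> U" by auto
  have adjU: "adj x y" if "x \<in> U" "y \<in> U" for x y using U that adj_perp by blast
  define \<pi> where "\<pi> v = v - (\<Sum>a\<in>idx m. f v (dual e a) *s e a)" for v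
  have sp: "(\<Sum>a\<in>idx m. f v (dual e a) *s e a) \<in> vec.span (e ` idx m)" for v
    by (intro vec.span_sum vec.span_scale vec.span_base) auto
  have spU: "vec.span (e ` idx m) \<subseteq> U" using vec.span_minimal[OF eU U(1)] .
  have \<pi>U: "\<pi> v \<in> U" if "v \<in> U" for v
    unfolding \<pi>_def using vec.subspace_diff[OF U(1) that] sp spU by blast
  have \<pi>W: "\<pi> v \<in> Wp m e" if "v \<in> U" for v
  proof -
    have "f (\<pi> v) (e b) = 0" if "b \<in> idx m" for b
      using U(3) \<pi>U[OF \<open>v \<in> U\<close>] eU that by blast
    moreover have "f (\<pi> v) (dual e b) = 0" if b: "b \<in> idx m" for b
    proof -
      have "(\<Sum>a\<in>idx m. f v (dual e a) * f (e a) (dual e b))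
          = (\<Sum>a\<in>idx m. if a = b then f v (dual e a) else 0)"
        by (rule sum.cong) (use dual_pair[OF h] b in auto)
      then show ?thesis unfolding \<pi>_def using b by (simp add: f_bilin)
    qed
    ultimately show ?thesis unfolding Wp_def by blast
  qed
  have "\<not> U \<subseteq> vec.span (e ` idx m)"
    using vec.dim_subset[of U "vec.span (e ` idx m)"] hsys_span(3)[OF h] Suc.prems by auto
  then obtain x where x: "x \<in> U" "x \<notin> vec.span (e ` idx m)" by blast
  define z where "z = \<pi> x"
  have z: "z \<in> U" "z \<in> Wp m e" using \<pi>U \<pi>W x z_def by auto
  have "z \<noteq> 0" using x sp unfolding z_def \<pi>_def by (metis eq_iff_diff_eq_0)
  then obtain y where y: "y \<in> U" "f z (g y) \<noteq> 0" using opp z by blast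
  \<comment> \<open>Only the first argument of \<open>f x (g y)\<close> is known to be linear. So
    \<open>y\<close> is replaced by \<open>\<pi> y\<close> there, and \<open>dom_swap_iff\<close>
    transfers the result to the other order.\<close>
  have "f (\<pi> y) (g z) = f y (g z) - (\<Sum>a\<in>idx m. f y (dual e a) * f (e a) (g z))"
    unfolding \<pi>_def by (simp add: f_bilin)
  moreover have "f (e a) (g z) = 0" if "a \<in> idx m" for a
  proof -
    have "f z (g (e a)) = 0" using z that unfolding Wp_g[OF h] by blast
    then show ?thesis using dom_swap adjU z eU that by blast
  qed
  ultimately have "f (\<pi> y) (g z) = f y (g z)" by simp
  then have "f z (g (\<pi> y)) \<noteq> 0" using dom_swap_iff adjU z y \<pi>U by metis
  moreover have "f z (\<pi> y) = 0" using U(3) z \<pi>U y by blast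
  ultimately have "hsys (Suc m) (e((m, True) := z, (m, False) := \<pi> y))"
    using hsys_extend[OF h] z y U(2) \<pi>U \<pi>W by blast
  moreover have "(e((m, True) := z, (m, False) := \<pi> y)) ` idx (Suc m) \<subseteq> U"
    using eU z \<pi>U y unfolding idx_Suc by (auto simp: image_subset_iff)
  ultimately show ?case by blast
qed

end

section \<open>The symplectic case\<close>

abbreviation vlinear :: "('k::field ^ 'm::finite \<Rightarrow> 'k ^ 'm) \<Rightarrow> bool" where
  "vlinear \<equiv> Vector_Spaces.linear (*s) (*s)"

lemma vlinearI:
  "(\<And>x y. G (x + y) = G x + G y) \<Longrightarrow> (\<And>c x. G (c *s x) = c *s G x) \<Longrightarrow> vlinear G"
  by unfold_locales auto

lemma vlinearD:
  assumes "vlinear G"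
  shows "G (x + y) = G x + G y" "G (c *s x) = c *s G x" "G 0 = 0" "G (- x) = - G x" "G (x - y) = G x - G y"
proof -
  interpret G: Vector_Spaces.linear "(*s)" "(*s)" G by (rule assms)
  show "G (x + y) = G x + G y" "G (c *s x) = c *s G x" "G 0 = 0" "G (- x) = - G x" "G (x - y) = G x - G y"
    by (simp_all add: G.add G.scale G.neg G.diff)
qed

lemma involution_basis:
  fixes G :: "'k::field ^ 'm::finite \<Rightarrow> 'k ^ 'm"
  assumes lin: "vlinear G" and two: "(2 :: 'k) \<noteq> 0" and inv: "\<And>x. G (G x) = x"
  shows "vec.dim {x. G x = x} + vec.dim {x. G x = - x} = CARD('m)"
    and "\<exists>b J. inj b \<and> vec.independent (range b) \<and> vec.span (range b) = UNIV \<and>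
        card (- J) = vec.dim {x. G x = x} \<and> card J = vec.dim {x. G x = - x} \<and>
        (\<forall>j :: 'm. G (b j) = (if j \<in> J then - b j else b j))"
proof -
  let ?P = "{x. G x = x}" and ?M = "{x. G x = - x}"
  note G = vlinearD[OF lin]
  have sub: "vec.subspace ?P" "vec.subspace ?M"
    by (auto simp: vec.subspace_def G)
  have dbl: "x = 0" if "x = - x" for x :: "'k ^ 'm"
  proof -
    have "2 *s x = x + x" by (simp add: vec_eq_iff)
    also have "\<dots> = 0" using that by (metis add.right_inverse)
    finally show ?thesis using two by simp
  qed
  have int: "?P \<inter> ?M = {0}" using dbl G by auto
  have half: "x = (1 / 2) *s (x + G x) + (1 / 2) *s (x - G x)" for x
    using two by (simp add: vec_eq_iff field_simps)
  have parts: "(1 / 2) *s (x + G x) \<in> ?P" "(1 / 2) *s (x - G x) \<in> ?M" for x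
    using two by (auto simp: G inv vec_eq_iff field_simps)
  have "{x + y |x y. x \<in> ?P \<and> y \<in> ?M} = UNIV"
    using half parts by blast
  then have "vec.dim (UNIV :: ('k ^ 'm) set) + vec.dim (?P \<inter> ?M) = vec.dim ?P + vec.dim ?M"
    using vec.dim_sums_Int[OF sub] by simp
  then show dims: "vec.dim ?P + vec.dim ?M = CARD('m)"
    unfolding int vec_dim_card by simp
  obtain B where B: "B \<subseteq> ?P" "vec.independent B" "?P \<subseteq> vec.span B" "card B = vec.dim ?P"
    using vec.basis_exists by blast
  obtain C where C: "C \<subseteq> ?M" "vec.independent C" "?M \<subseteq> vec.span C" "card C = vec.dim ?M"
    using vec.basis_exists by blast
  have fin: "finite B" "finite C" using vec.finiteI_independent[OF B(2)] vec.finiteI_independent[OF C(2)] by blast+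
  have z: "0 \<notin> B" using B(2) vec.dependent_zero by metis
  have disj: "B \<inter> C = {}"
  proof (rule ccontr)
    assume "B \<inter> C \<noteq> {}"
    then obtain x where "x \<in> B" "x \<in> C" by auto
    then have "x \<in> ?P \<inter> ?M" "x \<noteq> 0" using B(1) C(1) z by auto
    then show False unfolding int by simp
  qed
  have span: "vec.span (B \<union> C) = UNIV"
  proof -
    have "x \<in> vec.span (B \<union> C)" for x
    proof -
      have "(1 / 2) *s (x + G x) \<in> vec.span (B \<union> C)" "(1 / 2) *s (x - G x) \<in> vec.span (B \<union> C)"
        using parts B(3) C(3) vec.span_mono[of B "B \<union> C"] vec.span_mono[of C "B \<union> C"] by blast+
      then show ?thesis using half[of x] vec.span_add by metis
    qed
    then show ?thesis by blast
  qed
  have card: "card (B \<union> C) = CARD('m)"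
    using card_Un_disjoint[OF fin disj] B C dims by simp
  have ind: "vec.independent (B \<union> C)"
    by (rule vec.card_le_dim_spanning[of _ UNIV]) (use span fin card in \<open>auto simp: card_cart_basis\<close>)
  obtain b where b: "bij_betw b (UNIV :: 'm set) (B \<union> C)"
    using finite_same_card_bij[of "UNIV :: 'm set" "B \<union> C"] fin card by auto
  define J where "J = {j. b j \<in> C}"
  have "b ` J = range b \<inter> C" "b ` (- J) = range b - C" unfolding J_def by auto
  then have "b ` J = C" "b ` (- J) = B" using b disj unfolding bij_betw_def by blast+
  then have "bij_betw b J C" "bij_betw b (- J) B"
    using b unfolding bij_betw_def by (auto intro: inj_on_subset)
  then have "card J = vec.dim ?M" "card (- J) = vec.dim ?P"
    using bij_betw_same_card B C by metis+
  moreover have "G (b j) = (if j \<in> J then - b j else b j)" for j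
  proof (cases "j \<in> J")
    case False
    then have "b j \<in> B" using b unfolding J_def bij_betw_def by auto
    then show ?thesis using False B by auto
  qed (use C J_def in auto)
  moreover have "inj b" "range b = B \<union> C" using b by (auto simp: bij_betw_def)
  ultimately show "\<exists>b J. inj b \<and> vec.independent (range b) \<and> vec.span (range b) = UNIV \<and>
        card (- J) = vec.dim ?P \<and> card J = vec.dim ?M \<and>
        (\<forall>j :: 'm. G (b j) = (if j \<in> J then - b j else b j))"
    using ind span by (intro exI[of _ b] exI[of _ J]) simp
qed

section \<open>The linear lift of a symplectic collineation\<close>

locale symplectic_domestic = domestic f UNIV \<epsilon> g "\<lambda>_ _. True"
  for f :: "'k::field ^ 'm::finite \<Rightarrow> 'k ^ 'm \<Rightarrow> 'k" and \<epsilon> g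
begin

text \<open>The hyperplane \<open>?H\<close> is a complement of the fixed vector \<open>v0\<close>,
  since \<open>f v0 z = 1\<close>. All vectors are singular and all lines are mapped to lines, so
  \<open>cone v0\<close> is linear on the whole of \<open>?H\<close>; the lift extends it by fixing
  \<open>v0\<close>.\<close>

lemma linear_lift:
  assumes v0: "v0 \<noteq> 0" "sim (g v0) v0" and dim: "CARD('m) \<ge> 3"
  obtains G where "vlinear G" "G v0 = v0" "\<And>x. sim (g x) (G x)"
proof -
  obtain y where y: "f y v0 \<noteq> 0" using S_nondeg[OF UNIV_I] v0 by blast
  then have y': "f v0 y \<noteq> 0" using f_sym0 by blast
  define z where "z = (1 / f v0 y) *s y"
  have z: "f v0 z = 1" using y' by (simp add: z_def f_bilin)
  let ?H = "{x. f x z = 0}"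
  have H: "vec.subspace ?H" by (auto simp: vec.subspace_def f_bilin)
  have v0H: "v0 \<notin> ?H" using z by simp
  have ind: "ind2 y v0" if "y \<in> ?H" "y \<noteq> 0" for y
    unfolding ind2_iff using that z by (auto simp: f_bilin)
  have ex: "\<exists>x. True \<and> True \<and> ind3 x y v0 \<and> f x (g y) \<noteq> 0" if y: "y \<in> ?H" "y \<noteq> 0" for y
  proof -
    have "g y \<noteq> 0" using g_nz y by simp
    then obtain x0 where x0: "f x0 (g y) \<noteq> 0" using S_nondeg[OF UNIV_I] by blast
    \<comment> \<open>\<open>cone_homogeneous\<close> needs \<open>x\<close> independent of
      \<open>y\<close> and \<open>v0\<close>. The space has dimension at least 3, so some
      \<open>u\<close> lies outside their span; if \<open>x0\<close> fails, then \<open>u\<close> or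
      \<open>x0 + u\<close> works.\<close>
    have "\<exists>u. \<forall>a b. u \<noteq> a *s y + b *s v0"
    proof (rule ccontr)
      assume "\<not> ?thesis"
      then have all: "\<exists>a b. u = a *s y + b *s v0" for u by blast
      have "u \<in> vec.span {y, v0}" for u
      proof -
        obtain a b where "u = a *s y + b *s v0" using all by blast
        then show ?thesis by (simp add: vec.span_add vec.span_scale vec.span_base)
      qed
      then have "(UNIV :: ('k ^ 'm) set) \<subseteq> vec.span {y, v0}" by blast
      then have "vec.dim (UNIV :: ('k ^ 'm) set) \<le> card {y, v0}"
        by (rule vec.dim_le_card) simp
      also have "\<dots> \<le> 2" by (simp add: card_insert_if)
      finally show False using dim unfolding vec_dim_card by simp
    qed
    then obtain u where u: "\<And>a b. u \<noteq> a *s y + b *s v0" by blast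
    have "\<exists>x. (\<forall>a b. x \<noteq> a *s y + b *s v0) \<and> f x (g y) \<noteq> 0"
    proof (cases "f u (g y) \<noteq> 0 \<or> (\<forall>a b. x0 \<noteq> a *s y + b *s v0)")
      case True
      then show ?thesis using u x0 by blast
    next
      case False
      then obtain a b where ab: "x0 = a *s y + b *s v0" by blast
      have "x0 + u \<noteq> c *s y + d *s v0" for c d
      proof
        assume "x0 + u = c *s y + d *s v0"
        then have "u = c *s y + d *s v0 - x0" by (simp add: algebra_simps)
        then have "u = (c - a) *s y + (d - b) *s v0"
          unfolding ab by (simp add: vec.scale_left_diff_distrib)
        then show False using u by blast
      qed
      moreover have "f (x0 + u) (g y) \<noteq> 0" using False x0 by (simp add: f_bilin)
      ultimately show ?thesis by blast
    qed
    then obtain x where x: "\<And>a b. x \<noteq> a *s y + b *s v0" "f x (g y) \<noteq> 0" by blast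
    have "ind3 y v0 x" using ind3I[OF ind[OF y]] x by blast
    then have "ind3 x y v0" using ind3_perm by blast
    then show ?thesis using x by blast
  qed
  note lin = cone_linear_on[OF H _ _ v0H v0(2) ex, simplified]
  define p where "p v = v - f v z *s v0" for v
  have pH: "f (p v) z = 0" for v using z by (simp add: p_def f_bilin)
  have p_lin: "p (x + y) = p x + p y" "p (c *s x) = c *s p x" for x y c
    by (simp_all add: p_def f_bilin vec.scale_left_distrib vec.scale_right_diff_distrib)
  define G where "G v = cone v0 (p v) + f v z *s v0" for v
  show thesis
  proof
    show "vlinear G"
      by (rule vlinearI) (simp_all add: G_def p_lin lin pH f_bilin vec.scale_left_distrib vec.scale_right_distrib)
    show "G v0 = v0" using z by (simp add: G_def p_def)
    show "sim (g v) (G v)" for v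
    proof (cases "p v = 0")
      case True
      then have v: "v = f v z *s v0" by (simp add: p_def)
      show ?thesis
      proof (cases "f v z = 0")
        case False
        then have "sim (g v) (g v0)" using g_sim[OF UNIV_I] v sim_scale(1) by metis
        moreover have "sim v0 (f v z *s v0)" using False by (rule sim_scale)
        ultimately have "sim (g v) (f v z *s v0)" using v0(2) sim_trans by blast
        then show ?thesis using True by (simp add: G_def)
      qed (use v g_zero True in \<open>simp add: G_def\<close>)
    next
      case pv: False
      show ?thesis
      proof (cases "f v z = 0")
        case True
        then have "v = p v" by (simp add: p_def)
        moreover have "ind2 (p v) v0" using ind pv pH by simp
        ultimately show ?thesis using cone_props(1)[OF TrueI _ v0(2), of v] True sim_sym
          by (simp add: G_def)
      next
        case False
        let ?c = "f v z"
        let ?x = "(1 / ?c) *s p v"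
        have x: "f ?x z = 0" "?x \<noteq> 0" using pv pH False by (simp_all add: f_bilin)
        have "v = p v + ?c *s v0" by (simp add: p_def)
        also have "\<dots> = ?c *s (?x + v0)" using False by (simp add: vec.scale_right_distrib)
        finally have "sim v (?x + v0)" using False by (rule simI)
        then have "sim (g v) (g (?x + v0))" using g_sim by blast
        moreover have "sim (g (?x + v0)) (cone v0 ?x + v0)"
          using cone_props(2) ind x v0(2) by blast
        moreover have "G v = ?c *s (cone v0 ?x + v0)"
          using False lin(1)[OF pH] by (simp add: G_def vec.scale_right_distrib)
        then have "sim (cone v0 ?x + v0) (G v)" using False simI sim_sym by blast
        ultimately show ?thesis using sim_trans by blast
      qed
    qed
  qed
qed

lemma alternating: "f y x = - f x y"
proof -
  have "f (x + y) (x + y) = 0" "f x x = 0" "f y y = 0" using S_self by auto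
  then show ?thesis by (simp add: f_bilin eq_neg_iff_add_eq_0 add.commute)
qed

text \<open>Since \<open>f x (G x) = 0\<close> and \<open>f\<close> is alternating, \<open>G\<close>
  is self-adjoint. So \<open>f x (G (G y)) = f (G x) (G y)\<close> vanishes together with
  \<open>f x y\<close>, and \<open>G (G y)\<close> is a multiple of \<open>y\<close>. Comparing
  \<open>x\<close> with \<open>x + v0\<close> shows that the factor is 1.\<close>

lemma linear_lift_involution:
  assumes G: "vlinear G" "v0 \<noteq> 0" "G v0 = v0" "\<And>x. sim (g x) (G x)"
  shows "G (G x) = x"
proof -
  note lin = vlinearD[OF G(1)]
  have alt: "f x (G x) = 0" for x using dom f_sim[OF sim_refl G(4)] by blast
  have skew: "f x (G y) = f (G x) y" for x y
  proof -
    have "f (x + y) (G (x + y)) = 0" by (rule alt)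
    then have "f x (G y) = - f y (G x)" using alt[of x] alt[of y]
      by (simp add: f_bilin lin eq_neg_iff_add_eq_0 add.commute)
    then show ?thesis using alternating[of y "G x"] by simp
  qed
  have ex: "\<exists>a. G (G y) = a *s y" for y
  proof -
    have "f x (G (G y)) = 0" if "f x y = 0" for x
      using that skew[of x "G y"] f_sim[OF G(4) G(4)] g_perp[of x y] by auto
    from functional_multiple[OF linfun_f(1) linfun_f(1) vec.subspace_UNIV this]
    obtain a where "\<And>x. f x (G (G y)) = a * f x y" by auto
    then have "f x (G (G y) - a *s y) = 0" for x by (simp add: f_bilin)
    then have "G (G y) - a *s y = 0" using S_nondeg[OF UNIV_I] by blast
    then show ?thesis by (intro exI[of _ a]) simp
  qed
  show ?thesis
  proof (cases "ind2 x v0")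
    case True
    obtain a b where ab: "G (G x) = a *s x" "G (G (x + v0)) = b *s (x + v0)" using ex by blast
    have "a *s x + 1 *s v0 = b *s x + b *s v0"
      using ab by (simp add: lin G(3) vec.scale_right_distrib)
    from ind2_coeffs[OF True this] show ?thesis using ab by simp
  next
    case False
    then have "x = 0 \<or> (\<exists>c. v0 = c *s x \<and> c \<noteq> 0)" unfolding ind2_iff using G(2) by auto
    then consider "x = 0" | c where "x = c *s v0" using scale_solve by metis
    then show ?thesis by cases (simp_all add: lin G)
  qed
qed

text \<open>The maps \<open>x - G x\<close> and \<open>x + G x\<close> embed \<open>?U\<close> into
  the eigenspaces for -1 and 1, because the values \<open>f (e a) (G x)\<close> detect a nonzero
  \<open>x\<close> in \<open>?U\<close>. The second image meets \<open>Wp i e\<close> only in 0.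
  This bounds the dimensions below by \<open>2 * i\<close> and \<open>CARD('m) - 2 * i\<close>, and
  their sum is \<open>CARD('m)\<close>.\<close>

lemma eigenspaces:
  assumes h: "hsys i e" and G: "vlinear G" "\<And>x. G (G x) = x" "\<And>x. sim (g x) (G x)"
    and two: "(2 :: 'k) \<noteq> 0" and W: "Wp i e \<subseteq> {x. G x = x}"
  shows "vec.dim {x. G x = x} = CARD('m) - 2 * i \<and> vec.dim {x. G x = - x} = 2 * i"
proof -
  note lin = vlinearD[OF G(1)]
  let ?P = "{x. G x = x}" and ?M = "{x. G x = - x}" and ?U = "vec.span (e ` idx i)"
  have sub: "vec.subspace ?P" "vec.subspace ?M"
    by (auto simp: vec.subspace_def lin)
  have inj: "x = 0" if x: "x \<in> ?U" "\<And>a. a \<in> idx i \<Longrightarrow> f (e a) (G x) = 0" for x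
  proof (rule ccontr)
    assume "x \<noteq> 0"
    then obtain a where "a \<in> idx i" "f (e a) (g x) \<noteq> 0" using hsys_span(4)[OF h x(1)] by blast
    then show False using x(2) f_sim[OF sim_refl G(3)] by blast
  qed
  have eU: "e a \<in> ?U" if "a \<in> idx i" for a using that by (simp add: vec.span_base)
  have perpU: "f (e a) x = 0" if "a \<in> idx i" "x \<in> ?U" for a x using hsys_span(2)[OF h] eU that by blast
  have dimU: "vec.dim ((\<lambda>x. x + c *s G x) ` ?U) = 2 * i" if c: "c \<noteq> 0" for c
  proof -
    have L: "vlinear (\<lambda>x. x + c *s G x)"
      by (rule vlinearI) (simp_all add: lin vec.scale_right_distrib mult.commute)
    have "inj_on (\<lambda>x. x + c *s G x) ?U"
    proof (rule inj_onI)
      fix x y assume xy: "x \<in> ?U" "y \<in> ?U" "x + c *s G x = y + c *s G y"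
      have d: "x - y \<in> ?U" using xy vec.span_diff by blast
      have "(x - y) + c *s G (x - y) = (x + c *s G x) - (y + c *s G y)"
        by (simp add: lin vec.scale_right_diff_distrib)
      also have "\<dots> = 0" using xy by simp
      finally have "c *s G (x - y) = - (x - y)" by (metis add.commute eq_neg_iff_add_eq_0)
      then have "c * f (e a) (G (x - y)) = - f (e a) (x - y)" for a
        by (metis f_scale_right f_uminus(2))
      then have "f (e a) (G (x - y)) = 0" if "a \<in> idx i" for a using perpU[OF that d] c
        by (metis minus_zero mult_eq_0_iff)
      then show "x = y" using inj[OF d] by simp
    qed
    then have "inj_on (\<lambda>x. x + c *s G x) (vec.span ?U)" by (simp add: vec.span_span)
    then show ?thesis using vec.dim_image_eq[OF L] hsys_span(3)[OF h] by simp
  qed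
  have M: "vec.dim ?M \<ge> 2 * i"
  proof -
    have "(\<lambda>x. x + (- 1) *s G x) ` ?U \<subseteq> ?M" by (auto simp: lin G)
    from vec.dim_subset[OF this] show ?thesis using dimU[of "-1"] by simp
  qed
  let ?F = "(\<lambda>x. x + 1 *s G x) ` ?U"
  have F: "?F \<subseteq> ?P" by (auto simp: lin G)
  have subF: "vec.subspace ?F"
  proof -
    have L: "vlinear (\<lambda>x. x + 1 *s G x)"
      by (rule vlinearI) (simp_all add: lin vec.scale_right_distrib)
    interpret L: Vector_Spaces.linear "(*s)" "(*s)" "\<lambda>x. x + 1 *s G x" by (rule L)
    show ?thesis by (rule L.subspace_image[OF vec.subspace_span])
  qed
  have int: "Wp i e \<inter> ?F = {0}"
  proof -
    have "w = 0" if w: "w \<in> Wp i e" "w \<in> ?F" for w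
    proof -
      obtain x where x: "x \<in> ?U" "w = x + G x" using w by auto
      have "f (e a) (G x) = 0" if a: "a \<in> idx i" for a
      proof -
        have "f w (e a) = 0" using w a unfolding Wp_def by blast
        then have "f (e a) (x + G x) = 0" using f_sym0 x by blast
        then show ?thesis using perpU[OF a x(1)] by (simp add: f_bilin)
      qed
      then have "x = 0" using inj x by blast
      then show ?thesis using x by (simp add: lin)
    qed
    moreover have "0 \<in> Wp i e" "0 \<in> ?F" using vec.subspace_0 Wp_subspace subF by blast+
    ultimately show ?thesis by blast
  qed
  have dW: "CARD('m) \<le> vec.dim (Wp i e) + 4 * i" by (rule Wp_dim)
  have "{x + y |x y. x \<in> Wp i e \<and> y \<in> ?F} \<subseteq> ?P"
    using W F vec.subspace_add[OF sub(1)] by blast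
  then have "vec.dim {x + y |x y. x \<in> Wp i e \<and> y \<in> ?F} \<le> vec.dim ?P" by (rule vec.dim_subset)
  moreover have "vec.dim {x + y |x y. x \<in> Wp i e \<and> y \<in> ?F} + vec.dim (Wp i e \<inter> ?F)
      = vec.dim (Wp i e) + vec.dim ?F" by (rule vec.dim_sums_Int[OF Wp_subspace subF])
  moreover have "vec.dim (Wp i e \<inter> ?F) = 0" unfolding int by simp
  ultimately have "vec.dim ?P \<ge> vec.dim (Wp i e) + 2 * i" using dimU[OF one_neq_zero] by linarith
  then show ?thesis using M dW involution_basis(1)[OF G(1) two G(2)] by linarith
qed

text \<open>Each vector of \<open>Wp i e\<close> is an eigenvector of the involution. Two nonzero
  ones with different signs would have a sum that is no eigenvector, so one sign occurs throughout,
  and passing to \<open>- G\<close> if necessary makes it positive.\<close>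

lemma symplectic_homology:
  assumes h: "hsys i e" and max: "\<And>e'. \<not> hsys (Suc i) e'" and two: "(2 :: 'k) \<noteq> 0"
    and v0: "v0 \<noteq> 0" "sim (g v0) v0" and dim: "CARD('m) \<ge> 3"
  shows "\<exists>G b J. vlinear G \<and> (\<forall>x. sim (g x) (G x)) \<and>
        inj b \<and> vec.independent (range b) \<and> vec.span (range b) = UNIV \<and>
        card (- J) = CARD('m) - 2 * i \<and> card J = 2 * i \<and>
        (\<forall>j :: 'm. G (b j) = (if j \<in> J then - b j else b j))"
proof -
  obtain G where G: "vlinear G" "G v0 = v0" "\<And>x. sim (g x) (G x)"
    using linear_lift[OF v0 dim] by blast
  note lin = vlinearD[OF G(1)]
  have inv: "G (G x) = x" for x using linear_lift_involution[OF G(1) v0(1) G(2,3)] .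
  have dbl: "x = 0" if "x + x = 0" for x :: "'k ^ 'm"
  proof -
    have "2 *s x = x + x" by (simp add: vec_eq_iff)
    then show ?thesis using that two by simp
  qed
  have eig: "G w = w \<or> G w = - w" if w: "w \<in> Wp i e" for w
  proof -
    have "sim (G w) w" using Wp_fixed[OF h max w UNIV_I] G(3) sim_sym sim_trans by blast
    then obtain t where t: "G w = t *s w" unfolding sim_def by blast
    have "(t * t) *s w = w" using inv[of w] by (simp add: t lin)
    then have "((t - 1) * (t + 1)) *s w = 0"
      by (simp add: algebra_simps vec.scale_left_diff_distrib)
    then have "t = 1 \<or> t = - 1 \<or> w = 0" by (auto simp: eq_neg_iff_add_eq_0)
    then show ?thesis using t by auto
  qed
  have dich: "Wp i e \<subseteq> {x. G x = x} \<or> Wp i e \<subseteq> {x. - G x = x}"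
  proof (rule ccontr)
    assume "\<not> ?thesis"
    then obtain w w' where w: "w \<in> Wp i e" "G w \<noteq> w" "w' \<in> Wp i e" "- G w' \<noteq> w'" by blast
    then have e: "G w = - w" "G w' = w'" using eig by force+
    have "w + w' \<in> Wp i e" using w Wp_subspace vec.subspace_add by blast
    from eig[OF this] have "w' - w = w + w' \<or> w' - w = - (w + w')" by (simp add: lin e)
    then have "w + w = 0 \<or> w' + w' = 0" by (auto simp: algebra_simps add_eq_0_iff)
    then have "w = 0 \<or> w' = 0" using dbl by blast
    then show False using w lin by auto
  qed
  have fin: ?thesis if H: "vlinear H" "\<And>x. H (H x) = x" "\<And>x. sim (g x) (H x)" "Wp i e \<subseteq> {x. H x = x}" for H
  proof -
    have "vec.dim {x. H x = x} = CARD('m) - 2 * i" "vec.dim {x. H x = - x} = 2 * i"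
      using eigenspaces[OF h H(1,2,3) two H(4)] by auto
    with involution_basis(2)[OF H(1) two H(2)]
    obtain b J where "inj b \<and> vec.independent (range b) \<and> vec.span (range b) = UNIV \<and>
        card (- J) = CARD('m) - 2 * i \<and> card J = 2 * i \<and>
        (\<forall>j :: 'm. H (b j) = (if j \<in> J then - b j else b j))" by auto
    then show ?thesis using H(1,3) by (intro exI[of _ H] exI[of _ b] exI[of _ J]) auto
  qed
  from dich show ?thesis
  proof
    assume "Wp i e \<subseteq> {x. - G x = x}"
    moreover have "vlinear (\<lambda>x. - G x)" by (rule vlinearI) (simp_all add: lin)
    moreover have "sim (g x) (- G x)" for x
    proof -
      have "sim (G x) (- G x)" by (rule simI[of _ "-1"]) simp_all
      then show ?thesis using G(3) sim_trans by blast
    qed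
    ultimately show ?thesis using fin[of "\<lambda>x. - G x"] inv by (simp add: lin)
  next
    assume "Wp i e \<subseteq> {x. G x = x}"
    then show ?thesis by (rule fin[OF G(1) inv G(3)])
  qed
qed

end

section \<open>Linear lifts on quadrics\<close>

lemma sim_subspace: "vec.subspace T \<Longrightarrow> sim x y \<Longrightarrow> y \<in> T \<Longrightarrow> x \<in> T"
  unfolding sim_def by (auto simp: vec.subspace_scale)

text \<open>By \<open>Wp_dim\<close>, the assumption \<open>dim\<close> makes the complement
  \<open>Wp i e\<close> at least 3-dimensional, and \<open>W_sing\<close> says that it contains a
  singular point. The assumption \<open>three\<close> encodes |K| > 2 for finite and infinite fields
  alike.\<close>

locale quadric_domestic = domestic f S 1 g adj
  for f :: "'k::field ^ 'm::finite \<Rightarrow> 'k ^ 'm \<Rightarrow> 'k" and S g adj +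
  fixes Q :: "'k ^ 'm \<Rightarrow> 'k" and i :: nat and e :: "nat \<times> bool \<Rightarrow> 'k ^ 'm"
  assumes S_iff: "x \<in> S \<longleftrightarrow> Q x = 0"
    and Q_add: "Q (x + y) = Q x + Q y + f x y"
    and Q_scale: "Q (c *s x) = c * c * Q x"
    and adj_iff: "adj x y \<longleftrightarrow> x \<in> S \<and> y \<in> S \<and> f x y = 0"
    and h: "hsys i e"
    and max: "\<And>e'. \<not> hsys (Suc i) e'"
    and W_sing: "\<exists>w. w \<in> Wp i e \<and> w \<in> S \<and> w \<noteq> 0"
    and three: "\<And>d :: 'k. \<exists>t. t \<noteq> 0 \<and> t \<noteq> d"
    and dim: "4 * i + 3 \<le> CARD('m)"
begin

lemma f_comm: "f x y = f y x" using f_swap[of x y] by simp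

lemma Q_diff: "Q (x - y) = Q x + Q y - f x y"
  using Q_add[of x "-y"] Q_scale[of "-1" y] by (simp add: f_bilin)

lemma f_self: "f x x = 2 * Q x"
proof -
  have "Q (x + x) = Q (2 *s x)" by (simp add: vec_eq_iff arg_cong[of _ _ Q])
  then show ?thesis using Q_add[of x x] Q_scale[of 2 x] by (simp add: algebra_simps)
qed

section \<open>The decomposition of the space into \<open>U\<close>, \<open>U'\<close> and
  \<open>W\<close>\<close>

abbreviation "W \<equiv> Wp i e"
abbreviation "U \<equiv> vec.span (e ` idx i)"
abbreviation "U' \<equiv> vec.span (dual e ` idx i)"

definition "pU v = (\<Sum>a\<in>idx i. f v (dual e a) *s e a)"
definition "pU' v = (\<Sum>a\<in>idx i. f v (e a) *s dual e a)"
definition "pW v = v - (pU v + pU' v)"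
definition "X = {v. pW v = 0}"

lemma projX_eq: "projX i e v = pU v + pU' v"
  unfolding projX_def pU_def pU'_def by simp

lemma pW_W: "pW v \<in> W" unfolding pW_def projX_eq[symmetric] by (rule compl_Wp[OF h])

lemma pU_U: "pU v \<in> U" unfolding pU_def by (intro vec.span_sum vec.span_scale vec.span_base) auto
lemma pU'_U': "pU' v \<in> U'" unfolding pU'_def by (intro vec.span_sum vec.span_scale vec.span_base) auto

lemma p_lin:
  "pU (x + y) = pU x + pU y" "pU (c *s x) = c *s pU x"
  "pU' (x + y) = pU' x + pU' y" "pU' (c *s x) = c *s pU' x"
  "pW (x + y) = pW x + pW y" "pW (c *s x) = c *s pW x"
proof -
  show 1: "pU (x + y) = pU x + pU y" "pU (c *s x) = c *s pU x"
    "pU' (x + y) = pU' x + pU' y" "pU' (c *s x) = c *s pU' x" for x y c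
    by (simp_all add: pU_def pU'_def f_bilin vec.scale_left_distrib sum.distrib vec.scale_sum_right)
  show "pW (x + y) = pW x + pW y" "pW (c *s x) = c *s pW x"
    by (simp_all add: pW_def 1 vec.scale_right_diff_distrib vec.scale_right_distrib)
qed

lemma e_S: "a \<in> idx i \<Longrightarrow> e a \<in> S" "a \<in> idx i \<Longrightarrow> dual e a \<in> S"
  using hsysD(1) h dual_S by blast+

lemma U_S: "x \<in> U \<Longrightarrow> x \<in> S" "x \<in> U \<Longrightarrow> y \<in> U \<Longrightarrow> f x y = 0"
  "x \<in> U' \<Longrightarrow> x \<in> S" "x \<in> U' \<Longrightarrow> y \<in> U' \<Longrightarrow> f x y = 0"
  by (fact hsys_span(1)[OF h] hsys_span(2)[OF h]
      hsys_span(1)[OF dual_hsys[OF h]] hsys_span(2)[OF dual_hsys[OF h]])+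

lemma perp_span:
  assumes "\<And>a. a \<in> idx i \<Longrightarrow> f w (v a) = 0" "x \<in> vec.span (v ` idx i)"
  shows "f w x = 0"
  using assms(2) by (induction rule: vec.span_induct_alt) (use assms(1) in \<open>auto simp: f_bilin\<close>)

lemma W_perp: "w \<in> W \<Longrightarrow> x \<in> U \<Longrightarrow> f w x = 0" "w \<in> W \<Longrightarrow> x \<in> U' \<Longrightarrow> f w x = 0"
  using perp_span[of w e x] perp_span[of w "dual e" x] unfolding Wp_def by blast+

lemma pU_parts: "u \<in> U \<Longrightarrow> pU u = u" "u \<in> U' \<Longrightarrow> pU u = 0" "u \<in> W \<Longrightarrow> pU u = 0"
proof -
  show "u \<in> U \<Longrightarrow> pU u = u" using hsys_span(5)[OF h] unfolding pU_def by metis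
  show "u \<in> W \<Longrightarrow> pU u = 0" unfolding pU_def Wp_def by simp
  assume "u \<in> U'"
  then have "f u (dual e a) = 0" if "a \<in> idx i" for a
    using U_S(4) vec.span_base that by blast
  then show "pU u = 0" unfolding pU_def by simp
qed

lemma pU'_parts: "u \<in> U' \<Longrightarrow> pU' u = u" "u \<in> U \<Longrightarrow> pU' u = 0" "u \<in> W \<Longrightarrow> pU' u = 0"
proof -
  have p: "f (dual e a) (e b) = (if a = b then 1 else 0)" if "a \<in> idx i" "b \<in> idx i" for a b
    using dual_pair'[OF h that(2,1)] by auto
  show "u \<in> U' \<Longrightarrow> pU' u = u" unfolding pU'_def using dual_expansion[OF finite_idx p] by simp
  show "u \<in> W \<Longrightarrow> pU' u = 0" unfolding pU'_def Wp_def by simp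
  assume "u \<in> U"
  then have "f u (e a) = 0" if "a \<in> idx i" for a
    using U_S(2) vec.span_base that by blast
  then show "pU' u = 0" unfolding pU'_def by simp
qed

lemma pW_parts: "w \<in> W \<Longrightarrow> pW w = w" "u \<in> U \<Longrightarrow> pW u = 0" "u \<in> U' \<Longrightarrow> pW u = 0"
  unfolding pW_def using pU_parts pU'_parts by auto

lemma parts_sum: "v = pU v + pU' v + pW v" by (simp add: pW_def)

lemma X_subspace: "vec.subspace X"
  unfolding X_def vec.subspace_def using p_lin pW_parts(1) vec.subspace_0[OF Wp_subspace] by auto

lemma U_X: "U \<subseteq> X" "U' \<subseteq> X" unfolding X_def using pW_parts by auto

lemma X_comb: "x \<in> X \<Longrightarrow> y \<in> X \<Longrightarrow> a *s x + b *s y \<in> X"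
  by (simp add: X_subspace vec.subspace_add vec.subspace_scale)

lemma W_comb: "x \<in> W \<Longrightarrow> y \<in> W \<Longrightarrow> a *s x + b *s y \<in> W"
  by (simp add: Wp_subspace vec.subspace_add vec.subspace_scale)

lemma X_add: "x \<in> X \<Longrightarrow> y \<in> X \<Longrightarrow> x + y \<in> X" and X_scale: "x \<in> X \<Longrightarrow> c *s x \<in> X"
  by (simp_all add: X_subspace vec.subspace_add vec.subspace_scale)

lemma W_add: "x \<in> W \<Longrightarrow> y \<in> W \<Longrightarrow> x + y \<in> W" and W_scale: "x \<in> W \<Longrightarrow> c *s x \<in> W"
  by (simp_all add: Wp_subspace vec.subspace_add vec.subspace_scale)

lemma W_diff: "x \<in> W \<Longrightarrow> y \<in> W \<Longrightarrow> x - y \<in> W"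
  by (simp add: Wp_subspace vec.subspace_diff)

lemma zero_XW: "0 \<in> X" "0 \<in> W"
  by (simp_all add: X_subspace Wp_subspace vec.subspace_0)

lemma split_eq:
  assumes "x \<in> X" "x' \<in> X" "w \<in> W" "w' \<in> W" "x + w = x' + w'"
  shows "x = x'" "w = w'"
proof -
  have "pW x + pW w = pW x' + pW w'" using assms(5) p_lin(5) by metis
  then show "w = w'"
    using assms(1,2) unfolding pW_parts(1)[OF assms(3)] pW_parts(1)[OF assms(4)] X_def by simp
  then show "x = x'" using assms by simp
qed

lemma W_X_perp: "w \<in> W \<Longrightarrow> x \<in> X \<Longrightarrow> f w x = 0"
proof -
  assume "w \<in> W" "x \<in> X"
  then have x: "x = pU x + pU' x" and 0: "f w (pU x) = 0" "f w (pU' x) = 0"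
    using parts_sum[of x] W_perp(1)[OF _ pU_U] W_perp(2)[OF _ pU'_U'] unfolding X_def by auto
  have "f w x = f w (pU x + pU' x)" by (rule arg_cong[OF x])
  also have "\<dots> = 0" using 0 by (simp add: f_bilin)
  finally show ?thesis .
qed

lemma Q_split: "x \<in> X \<Longrightarrow> w \<in> W \<Longrightarrow> Q (x + w) = Q x + Q w"
  using W_X_perp f_comm by (simp add: Q_add)

lemma Q_UU: "u \<in> U \<Longrightarrow> u' \<in> U' \<Longrightarrow> Q (u + u') = f u u'"
  using U_S S_iff by (simp add: Q_add)

lemma W_fixed: "w \<in> W \<Longrightarrow> w \<in> S \<Longrightarrow> sim (g w) w"
  using Wp_fixed[OF h max] .

lemma U'_eq: "U' = vec.span (g ` e ` idx i)"
proof (rule antisym)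
  show "U' \<subseteq> vec.span (g ` e ` idx i)"
  proof (rule vec.span_minimal[OF _ vec.subspace_span], clarify)
    fix a assume a: "(a :: nat \<times> bool) \<in> idx i"
    have "g (e (partner a)) \<in> vec.span (g ` e ` idx i)" by (rule vec.span_base) (use a in simp)
    then show "dual e a \<in> vec.span (g ` e ` idx i)"
      by (rule sim_subspace[OF vec.subspace_span dual_sim[OF h a]])
  qed
  show "vec.span (g ` e ` idx i) \<subseteq> U'"
  proof (rule vec.span_minimal[OF _ vec.subspace_span], clarify)
    fix a assume a: "(a :: nat \<times> bool) \<in> idx i"
    have "sim (g (e a)) (dual e (partner a))" using dual_sim[OF h, of "partner a"] a sim_sym by simp
    moreover have "dual e (partner a) \<in> U'" by (rule vec.span_base) (use a in simp)
    ultimately show "g (e a) \<in> U'" by (rule sim_subspace[OF vec.subspace_span])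
  qed
qed

lemma g_U: "u \<in> U \<Longrightarrow> g u \<in> U'"
  unfolding U'_eq by (intro g_span) (use e_S hsysD(2)[OF h] in auto)

lemma U'_g: "u \<in> U' \<Longrightarrow> \<exists>v\<in>U. \<exists>t. u = t *s g v"
  unfolding U'_eq by (intro g_span_onto) (use e_S hsysD(2)[OF h] in auto)

text \<open>A nonzero vector of \<open>U'\<close> is proportional to some \<open>g v\<close> with
  \<open>v\<close> in \<open>U\<close>, and \<open>g_stable_line\<close> puts \<open>g (g v)\<close>
  into the span of \<open>v\<close> and \<open>g v\<close>.\<close>

lemma g_U': "u \<in> U' \<Longrightarrow> g u \<in> X"
proof -
  assume u: "u \<in> U'"
  show ?thesis
  proof (cases "u = 0")
    case True
    then show ?thesis using g_zero X_subspace vec.subspace_0 by auto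
  next
    case False
    obtain v t where v: "v \<in> U" "u = t *s g v" using U'_g u by blast
    then have "t \<noteq> 0" using False by auto
    then have "sim u (g v)" using v(2) by (intro simI)
    then have s: "sim (g u) (g (g v))" using g_sim g_S U_S(1)[OF v(1)] by blast
    obtain a b where "g (g v) = a *s v + b *s g v" using g_stable_line U_S(1)[OF v(1)] by blast
    moreover have "v \<in> X" "g v \<in> X" using U_X v(1) g_U[OF v(1)] by auto
    ultimately have "g (g v) \<in> X" using X_comb by simp
    then show ?thesis by (rule sim_subspace[OF X_subspace s])
  qed
qed

text \<open>\<open>U\<close> and \<open>U'\<close> are the singular subspaces of \<open>X\<close> on
  which \<open>cone\<close> is first shown to be linear; \<open>dual_hsys\<close> makes them
  interchangeable.\<close>

definition half :: "('k ^ 'm) set \<Rightarrow> bool" where "half T \<longleftrightarrow> T = U \<or> T = U'"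

lemma half_facts:
  assumes "half T"
  shows "vec.subspace T" "x \<in> T \<Longrightarrow> x \<in> S" "x \<in> T \<Longrightarrow> y \<in> T \<Longrightarrow> f x y = 0" "T \<subseteq> X"
    "x \<in> T \<Longrightarrow> x \<noteq> 0 \<Longrightarrow> \<exists>y\<in>T. f y (g x) \<noteq> 0"
proof -
  show "vec.subspace T" "x \<in> T \<Longrightarrow> x \<in> S" "x \<in> T \<Longrightarrow> y \<in> T \<Longrightarrow> f x y = 0" "T \<subseteq> X"
    using assms U_S U_X unfolding half_def by auto
  assume "x \<in> T" "x \<noteq> 0"
  then show "\<exists>y\<in>T. f y (g x) \<noteq> 0"
    using assms hsys_span(4)[OF h, of x] hsys_span(4)[OF dual_hsys[OF h], of x]
    unfolding half_def by (metis image_eqI vec.span_base)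
qed

lemma adj_W: "x \<in> X \<Longrightarrow> x \<in> S \<Longrightarrow> w \<in> W \<Longrightarrow> w \<in> S \<Longrightarrow> adj x w"
  using W_X_perp f_comm adj_iff by metis

lemma ind2_XW: "x \<in> X \<Longrightarrow> x \<noteq> 0 \<Longrightarrow> w \<in> W \<Longrightarrow> w \<noteq> 0 \<Longrightarrow> ind2 x w"
proof -
  assume "x \<in> X" "x \<noteq> 0" "w \<in> W" "w \<noteq> 0"
  moreover have "w \<noteq> c *s x" for c
  proof
    assume "w = c *s x"
    then have "pW w = 0" using p_lin(6) \<open>x \<in> X\<close> by (simp add: X_def)
    then show False using pW_parts(1)[OF \<open>w \<in> W\<close>] \<open>w \<noteq> 0\<close> by simp
  qed
  ultimately show ?thesis unfolding ind2_iff by blast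
qed

lemma ind3_XXW:
  assumes "x \<in> X" "y \<in> X" "ind2 x y" "w \<in> W" "w \<noteq> 0" shows "ind3 x y w"
proof (rule ind3I[OF assms(3)])
  fix a b
  have "a *s x + b *s y \<in> X" using X_comb assms by blast
  then have "pW (a *s x + b *s y) = 0" unfolding X_def by simp
  then show "w \<noteq> a *s x + b *s y" using pW_parts(1)[OF assms(4)] assms(5) by metis
qed

section \<open>Normalised lifts on \<open>U\<close> and \<open>U'\<close>, and their independence of
  the fixed point\<close>

lemma cone_half_linear:
  assumes T: "half T" and w: "w \<in> W" "w \<in> S" "w \<noteq> 0" and x: "x \<in> T"
  shows "cone w (c *s x) = c *s cone w x" "y \<in> T \<Longrightarrow> cone w (x + y) = cone w x + cone w y"
proof -
  note T' = half_facts[OF T]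
  have wT: "w \<notin> T" using T'(4) w pW_parts(1) unfolding X_def by force
  have ex: "\<exists>x. adj x y \<and> adj x w \<and> ind3 x y w \<and> f x (g y) \<noteq> 0" if y: "y \<in> T" "y \<noteq> 0" for y
  proof -
    obtain z where z: "z \<in> T" "f z (g y) \<noteq> 0" using T'(5)[OF y] by blast
    have "ind2 y z" unfolding ind2_iff
    proof safe
      fix c assume "z = c *s y"
      then show False using z(2) dom T'(2)[OF y(1)] by (simp add: f_bilin)
    qed (use y in auto)
    then have "ind3 z y w" using ind3_XXW ind2_sym T'(4) y z w by blast
    moreover have "adj z y" using adj_iff T' y z by blast
    moreover have "adj z w" using adj_W T' z w by blast
    ultimately show ?thesis using z by blast
  qed
  have a: "adj x y" if "x \<in> T" "y \<in> T" for x y using that adj_iff T' by blast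
  have b: "adj x w" if "x \<in> T" for x using that adj_W T' w by blast
  note lin = cone_linear_on[OF T'(1) a b wT W_fixed[OF w(1,2)] ex]
  show "cone w (c *s x) = c *s cone w x" using lin(1) x by blast
  show "y \<in> T \<Longrightarrow> cone w (x + y) = cone w x + cone w y" using lin(2) x by blast
qed

lemma cone_half:
  assumes "half T" "w \<in> W" "w \<in> S" "w \<noteq> 0" "x \<in> T"
  shows "sim (cone w x) (g x)" "x \<noteq> 0 \<Longrightarrow> sim (g (x + w)) (cone w x + w)" "cone w x \<in> X"
proof -
  note T' = half_facts[OF assms(1)]
  have a: "adj x w" using adj_W T' assms by blast
  have i: "ind2 x w" if "x \<noteq> 0" using ind2_XW that T' assms by blast
  show 1: "sim (cone w x) (g x)"
    using cone_props(1)[OF a i W_fixed[OF assms(2,3)]] g_zero by (cases "x = 0") auto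
  show "x \<noteq> 0 \<Longrightarrow> sim (g (x + w)) (cone w x + w)"
    using cone_props(2)[OF a i W_fixed[OF assms(2,3)]] by auto
  have "g x \<in> X" using assms(1,5) g_U[of x] g_U'[of x] U_X unfolding half_def by auto
  then show "cone w x \<in> X" by (rule sim_subspace[OF X_subspace 1])
qed

text \<open>Up to a scalar, \<open>x + c *s w\<close> is \<open>(1 / c) *s x + w\<close>, and
  \<open>cone w\<close> is homogeneous on \<open>T\<close>.\<close>

lemma cone_scale_center:
  assumes "half T" "w \<in> W" "w \<in> S" "w \<noteq> 0" "x \<in> T" "c \<noteq> 0"
  shows "cone (c *s w) x = cone w x"
proof (cases "x = 0")
  case False
  note T' = half_facts[OF assms(1)]
  have cw: "c *s w \<in> W" "c *s w \<in> S" "c *s w \<noteq> 0"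
    using assms W_scale S_scale by auto
  let ?y = "(1 / c) *s x"
  have y: "?y \<in> T" "?y \<noteq> 0" using assms T'(1) False by (auto simp: vec.subspace_scale)
  have e: "cone w x + c *s w = c *s (cone w ?y + w)"
    using assms cone_half_linear(1)[OF assms(1-5)] by (simp add: vec.scale_right_distrib)
  have "x + c *s w = c *s (?y + w)" using assms by (simp add: vec.scale_right_distrib)
  then have "sim (x + c *s w) (?y + w)" using assms(6) by (rule simI)
  moreover have "?y + w \<in> S" using adj_W adj_S(2) T' y assms by blast
  ultimately have "sim (g (x + c *s w)) (g (?y + w))" using g_sim by blast
  then have "sim (g (x + c *s w)) (cone w ?y + w)" using cone_half(2)[OF assms(1-4) y] sim_trans by blast
  then have "sim (g (x + c *s w)) (cone w x + c *s w)"
    unfolding e using sim_scale(2)[OF assms(6)] sim_trans by blast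
  then show ?thesis
    by (intro cone_eqI) (use adj_W T' assms cw ind2_XW False W_fixed cone_half(1) in auto)
qed simp

text \<open>The image of the point \<open>u + u' + w1 + w2\<close> is computed from both of the decompositions
  \<open>(u + w1) + (u' + w2)\<close> and \<open>(u' + w1) + (u + w2)\<close>.\<close>

lemma opposite_centers:
  assumes w: "w1 \<in> W" "w1 \<in> S" "w2 \<in> W" "w2 \<in> S" "f w1 w2 \<noteq> 0"
    and u: "u \<in> U" "u' \<in> U'" "f u u' = - f w1 w2"
  obtains \<kappa> where "\<kappa> \<noteq> 0"
    "sim (g (u + u' + (w1 + w2))) ((cone w1 u + cone w1 u') + (w1 + \<kappa> *s w2))"
    "cone w1 u = \<kappa> *s cone w2 u" "cone w1 u' = \<kappa> *s cone w2 u'"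
proof -
  have nz: "w1 \<noteq> 0" "w2 \<noteq> 0" "u \<noteq> 0" "u' \<noteq> 0" using w u by auto
  have hf: "half U" "half U'" unfolding half_def by auto
  have uS: "u \<in> S" "u' \<in> S" "u \<in> X" "u' \<in> X" using U_S U_X u by auto
  have i12: "ind2 w1 w2" using ind2_nonperp w by blast
  have iu: "ind2 u u'" using ind2_nonperp uS u(3) w(5) by simp
  \<comment> \<open>The vectors \<open>x + w1\<close> and \<open>y + w2\<close> span a singular
    line: the equation \<open>f x y = - f w1 w2\<close> makes them orthogonal. Their images are
    known from the cones.\<close>
  have key: "\<exists>A B. A \<noteq> 0 \<and> B \<noteq> 0 \<and>
      g (x + y + (w1 + w2)) = (A *s cone w1 x + B *s cone w2 y) + (A *s w1 + B *s w2)"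
    if xy: "half T" "half T'" "x \<in> T" "y \<in> T'" "f x y = - f w1 w2" "x \<noteq> 0" "y \<noteq> 0" for x y T T'
  proof -
    have X: "x \<in> X" "y \<in> X" "x \<in> S" "y \<in> S" using half_facts xy by blast+
    let ?a = "x + w1" and ?b = "y + w2"
    have S: "?a \<in> S" "?b \<in> S" using adj_S(2) adj_W X w by blast+
    have "f x w2 = 0" "f w1 y = 0" using W_X_perp X w f_comm by metis+
    then have "f ?a ?b = 0" using xy by (simp add: f_bilin)
    then have adj: "adj ?a ?b" using S adj_iff by blast
    have "ind2 ?a ?b" unfolding ind2_def
    proof (intro allI impI)
      fix a b assume z: "a *s ?a + b *s ?b = 0"
      have "(a *s x + b *s y) + (a *s w1 + b *s w2) = a *s ?a + b *s ?b"
        by (simp add: vec.scale_right_distrib)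
      also have "\<dots> = 0 + 0" using z by simp
      finally have "a *s w1 + b *s w2 = 0"
        by (rule split_eq(2)[rotated 4]) (use X w X_comb W_comb zero_XW in auto)
      then show "a = 0 \<and> b = 0" using i12 unfolding ind2_def by blast
    qed
    then obtain p q where pq: "g (?a + ?b) = p *s g ?a + q *s g ?b" "p \<noteq> 0" "q \<noteq> 0"
      using g_line_sum[OF adj] by blast
    have "sim (g ?a) (cone w1 x + w1)" "sim (g ?b) (cone w2 y + w2)"
      using cone_half(2) xy w nz by blast+
    then obtain s t where st: "g ?a = s *s (cone w1 x + w1)" "s \<noteq> 0" "g ?b = t *s (cone w2 y + w2)" "t \<noteq> 0"
      unfolding sim_def by blast
    have "x + y + (w1 + w2) = ?a + ?b" by (simp add: algebra_simps)
    then have "g (x + y + (w1 + w2))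
        = ((p * s) *s cone w1 x + (q * t) *s cone w2 y) + ((p * s) *s w1 + (q * t) *s w2)"
      using pq(1) st by (simp add: vec.scale_right_distrib algebra_simps)
    then show ?thesis using pq st by (metis mult_eq_0_iff)
  qed
  obtain A B where 1: "A \<noteq> 0" "B \<noteq> 0"
      "g (u + u' + (w1 + w2)) = (A *s cone w1 u + B *s cone w2 u') + (A *s w1 + B *s w2)"
    using key[OF hf u nz(3,4)] by blast
  have u3: "f u' u = - f w1 w2" using u(3) f_comm by simp
  obtain A' B' where 2:
      "g (u' + u + (w1 + w2)) = (A' *s cone w1 u' + B' *s cone w2 u) + (A' *s w1 + B' *s w2)"
    using key[OF hf(2,1) u(2,1) u3 nz(4,3)] by blast
  have cX: "cone w1 u \<in> X" "cone w1 u' \<in> X" "cone w2 u \<in> X" "cone w2 u' \<in> X"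
    using cone_half(3) hf w nz u by blast+
  have eq: "(A *s cone w1 u + B *s cone w2 u') + (A *s w1 + B *s w2)
      = (A' *s cone w1 u' + B' *s cone w2 u) + (A' *s w1 + B' *s w2)"
    using 1(3) 2 by (simp add: add.commute)
  have sp: "A *s cone w1 u + B *s cone w2 u' = A' *s cone w1 u' + B' *s cone w2 u"
    "A *s w1 + B *s w2 = A' *s w1 + B' *s w2"
    using split_eq[OF _ _ _ _ eq] X_comb cX W_comb w by blast+
  \<comment> \<open>The components in \<open>W\<close> identify the coefficients of both
    decompositions; the components in \<open>X\<close> then give the ratio \<open>B / A\<close>
    between the two normalisations.\<close>
  have AB: "A' = A" "B' = B" using ind2_coeffs[OF i12 sp(2)] by auto
  have c: "sim (cone w1 u) (g u)" "sim (cone w1 u') (g u')" "sim (cone w2 u) (g u)" "sim (cone w2 u') (g u')"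
    using cone_half(1) hf w nz u by blast+
  then have "sim (cone w2 u) (cone w1 u)" "sim (cone w2 u') (cone w1 u')" using sim_sym sim_trans by blast+
  then obtain \<mu> \<mu>' where m: "cone w2 u = \<mu> *s cone w1 u" "cone w2 u' = \<mu>' *s cone w1 u'"
    unfolding sim_def by blast
  have ic: "ind2 (cone w1 u) (cone w1 u')" using ind2_sim g_ind2[OF uS(1,2) iu] c by blast
  have "A *s cone w1 u + (B * \<mu>') *s cone w1 u' = (B * \<mu>) *s cone w1 u + A *s cone w1 u'"
    using sp(1) unfolding AB m by (simp add: add.commute)
  from ind2_coeffs[OF ic this] have AB': "A = B * \<mu>" "B * \<mu>' = A" by auto
  show thesis
  proof (rule that[of "B / A"])
    show "B / A \<noteq> 0" using 1 by simp
    show "cone w1 u = (B / A) *s cone w2 u" "cone w1 u' = (B / A) *s cone w2 u'"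
      using m AB' 1 by auto
    have "g (u + u' + (w1 + w2)) = A *s ((cone w1 u + cone w1 u') + (w1 + (B / A) *s w2))"
      unfolding 1(3) m using AB' 1 by (simp add: vec.scale_right_distrib)
    then show "sim (g (u + u' + (w1 + w2))) ((cone w1 u + cone w1 u') + (w1 + (B / A) *s w2))"
      using 1(1) by (rule simI)
  qed
qed

text \<open>Two linear conditions on \<open>W\<close>, of dimension at least 3, leave a nonzero
  \<open>c\<close>. If \<open>c\<close> is singular, it has a partner \<open>z\<close> in the same
  subspace with \<open>f z c \<noteq> 0\<close>, and \<open>z\<close> or \<open>z + c\<close> is
  nonsingular.\<close>

lemma nonsingular_perp:
  assumes w: "w1 \<in> W" "w1 \<in> S" "w2 \<in> W" "w2 \<in> S" "f w1 w2 \<noteq> 0"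
  obtains c where "c \<in> W" "f c w1 = 0" "f c w2 = 0" "Q c \<noteq> 0"
proof -
  let ?T = "{t \<in> W. f t w1 = 0 \<and> f t w2 = 0}"
  have "CARD('m) \<le> vec.dim W + 4 * i" by (rule Wp_dim)
  moreover have "vec.dim W \<le> vec.dim {t \<in> W. \<forall>s\<in>UNIV. f t (if s then w1 else w2) = 0} + card (UNIV :: bool set)"
    by (rule dim_functionals[OF Wp_subspace _ linfun_f(1)]) simp
  moreover have "{t \<in> W. \<forall>s\<in>UNIV. f t (if s then w1 else w2) = 0} = ?T"
    by (auto simp: all_bool_eq)
  ultimately have "vec.dim ?T \<ge> 1" using dim by simp
  moreover have "vec.dim ?T \<le> vec.dim {0 :: 'k ^ 'm}" if "?T \<subseteq> {0}"
    using that by (rule vec.dim_subset)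
  moreover have "vec.dim {0 :: 'k ^ 'm} = 0" by simp
  ultimately have "\<not> ?T \<subseteq> {0}" by linarith
  then obtain c where c: "c \<in> W" "f c w1 = 0" "f c w2 = 0" "c \<noteq> 0" by blast
  show thesis
  proof (cases "Q c = 0")
    case True
    then have cS: "c \<in> S" using S_iff by blast
    then obtain y where y: "f y c \<noteq> 0" using S_nondeg c(4) by blast
    let ?F = "f w1 w2"
    define z where "z = pW y + ((- (f (pW y) w2 / ?F)) *s w1 + (- (f (pW y) w1 / ?F)) *s w2)"
    have zW: "z \<in> W" unfolding z_def using pW_W W_comb w Wp_subspace vec.subspace_add by blast
    have c': "f w1 c = 0" "f w2 c = 0" "f w1 w1 = 0" "f w2 w2 = 0" "f w2 w1 = ?F" "f (pU y) c = 0" "f (pU' y) c = 0"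
      using c f_comm S_self w W_perp pU_U pU'_U' by metis+
    have z: "f z c = f y c" "f z w1 = 0" "f z w2 = 0"
      unfolding z_def pW_def using c' w(5) by (simp_all add: f_bilin)
    show thesis
    proof (cases "Q z = 0")
      case True
      then have "Q (z + c) \<noteq> 0" using Q_add z y \<open>Q c = 0\<close> by simp
      moreover have "z + c \<in> W" using zW c Wp_subspace vec.subspace_add by blast
      ultimately show thesis using that z c by (simp add: f_bilin)
    qed (use that zW z in blast)
  qed (use that c in blast)
qed

lemma dual_vector_U: "u \<in> U \<Longrightarrow> u \<noteq> 0 \<Longrightarrow> \<exists>u'\<in>U'. f u u' = c"
proof -
  assume u: "u \<in> U" "u \<noteq> 0"
  then obtain a where a: "a \<in> idx i" "f u (dual e a) \<noteq> 0"
    using pU_parts(1) unfolding pU_def by (metis (no_types, lifting) sum.neutral vec.scale_zero_left)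
  then have "f u ((c / f u (dual e a)) *s dual e a) = c" by (simp add: f_bilin)
  moreover have "(c / f u (dual e a)) *s dual e a \<in> U'"
    using a by (intro vec.span_scale vec.span_base) auto
  ultimately show ?thesis by blast
qed

lemma dual_vector_U': "u' \<in> U' \<Longrightarrow> u' \<noteq> 0 \<Longrightarrow> \<exists>u\<in>U. f u u' = c"
proof -
  assume u: "u' \<in> U'" "u' \<noteq> 0"
  then obtain a where a: "a \<in> idx i" "f u' (e a) \<noteq> 0"
    using pU'_parts(1) unfolding pU'_def by (metis (no_types, lifting) sum.neutral vec.scale_zero_left)
  then have "f ((c / f u' (e a)) *s e a) u' = c" using f_comm by (simp add: f_bilin)
  moreover have "(c / f u' (e a)) *s e a \<in> U"
    using a by (intro vec.span_scale vec.span_base) auto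
  ultimately show ?thesis by blast
qed

text \<open>The vector \<open>w = w1 + t *s w2\<close> is also \<open>w1' + w2'\<close>, where the
  singular vectors \<open>w1'\<close>, \<open>w2'\<close> involve the third direction
  \<open>c\<close>. Applied to both splittings, \<open>opposite_centers\<close> gives the same image
  point. Comparing the components in \<open>W\<close> shows that both factors \<kappa> are
  1.\<close>

lemma cone_opposite_eq:
  assumes w: "w1 \<in> W" "w1 \<in> S" "w2 \<in> W" "w2 \<in> S" "f w1 w2 \<noteq> 0" and x: "half T" "x \<in> T"
  shows "cone w1 x = cone w2 x"
proof (cases "x = 0")
  case False
  let ?F = "f w1 w2"
  obtain c where c: "c \<in> W" "f c w1 = 0" "f c w2 = 0" "Q c \<noteq> 0" using nonsingular_perp[OF w] by blast
  \<comment> \<open>Chosen so that \<open>y = w1 + d *s w2 + c\<close> is singular: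
    \<open>Q y = d * ?F + Q c\<close>.\<close>
  define d where "d = - Q c / ?F"
  have d: "d \<noteq> 0" "d * ?F = - Q c" using c w by (auto simp: d_def)
  \<comment> \<open>The third field element: \<open>t + d\<close> has to be invertible in the
    definition of \<open>s\<close>.\<close>
  obtain t where t: "t \<noteq> 0" "t \<noteq> - d" using three by blast
  then have td: "t + d \<noteq> 0" by (simp add: eq_neg_iff_add_eq_0)
  have sw: "f w2 w1 = ?F" "f w1 w1 = 0" "f w2 w2 = 0" "f w1 c = 0" "f w2 c = 0" "Q w1 = 0" "Q w2 = 0"
    using f_comm w S_self c S_iff by metis+
  define w where "w = w1 + t *s w2"
  define y where "y = w1 + d *s w2 + c"
  \<comment> \<open>With this scale \<open>f w1' w = s * (t + d) * ?F = Q w\<close>, which makes the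
    remainder \<open>w - w1'\<close> singular.\<close>
  define s where "s = t / (t + d)"
  define w1' where "w1' = s *s y"
  define w2' where "w2' = w + (-1) *s w1'"
  have s0: "s \<noteq> 0" "s * (t + d) = t" using t td by (auto simp: s_def)
  have Qy: "Q y = 0" using d(2) sw c by (simp add: y_def Q_add Q_scale f_bilin)
  have Qw: "Q w = t * ?F" using sw by (simp add: w_def Q_add Q_scale f_bilin)
  have "f y w = (t + d) * ?F" using sw c by (simp add: y_def w_def f_bilin algebra_simps)
  then have fw: "f w1' w = t * ?F" using s0(2) by (simp add: w1'_def f_bilin mult.assoc[symmetric])
  have "f w w1' = t * ?F" using fw f_comm by simp
  then have Qw2': "Q w2' = 0" using Qy Qw by (simp add: w2'_def w1'_def Q_diff Q_scale f_bilin)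
  have yW: "y \<in> W" "w \<in> W" unfolding y_def w_def using w c Wp_subspace
    by (auto intro!: vec.subspace_add vec.subspace_scale)
  have w': "w1' \<in> W" "w1' \<in> S" "w2' \<in> W" "w2' \<in> S"
    using yW Qy Qw2' S_iff unfolding w2'_def w1'_def
    by (auto intro!: W_diff W_scale simp: Q_scale)
  have sum': "w1' + w2' = w" by (simp add: w2'_def)
  have "f w1' w1' = 0" using S_self w' by blast
  then have fw': "f w1' w2' = t * ?F" using fw by (simp add: w2'_def f_bilin)
  have tw2: "t *s w2 \<in> W" "t *s w2 \<in> S" "f w1 (t *s w2) = t * ?F"
    using w S_scale W_scale by (auto simp: f_bilin)
  have tF: "t * ?F \<noteq> 0" using t w by simp
  have ind: "ind3 w1 w2 c" unfolding ind3_def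
  proof (intro allI impI)
    fix p q r assume z: "p *s w1 + q *s w2 + r *s c = 0"
    have "f (p *s w1 + q *s w2 + r *s c) w2 = 0" "f (p *s w1 + q *s w2 + r *s c) w1 = 0"
      unfolding z by simp_all
    then have pq: "p = 0" "q = 0" using sw c w by (simp_all add: f_bilin)
    then have "r *s c = 0" using z by simp
    moreover have "c \<noteq> 0" using c(4) Q_scale[of 0 c] by auto
    ultimately show "p = 0 \<and> q = 0 \<and> r = 0" using pq by simp
  qed
  have main: "cone w1 u = cone w2 u \<and> cone w1 u' = cone w2 u'"
    if u: "u \<in> U" "u' \<in> U'" "f u u' = - (t * ?F)" for u u'
  proof -
    have hf: "half U" "half U'" unfolding half_def by auto
    have nz: "w1 \<noteq> 0" "w1' \<noteq> 0" "w2 \<noteq> 0" using w fw tF by auto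
    obtain k where k: "k \<noteq> 0"
      "sim (g (u + u' + (w1 + t *s w2))) ((cone w1 u + cone w1 u') + (w1 + k *s (t *s w2)))"
      "cone w1 u = k *s cone (t *s w2) u" "cone w1 u' = k *s cone (t *s w2) u'"
      using opposite_centers[OF w(1,2) tw2(1,2)] tw2(3) tF u by metis
    obtain k' where k': "k' \<noteq> 0"
      "sim (g (u + u' + (w1' + w2'))) ((cone w1' u + cone w1' u') + (w1' + k' *s w2'))"
      using opposite_centers[OF w'] fw' tF u by metis
    have "sim ((cone w1 u + cone w1 u') + (w1 + k *s (t *s w2))) ((cone w1' u + cone w1' u') + (w1' + k' *s w2'))"
      using k(2) k'(2) unfolding sum' w_def using sim_sym sim_trans by blast
    then obtain r where r: "r \<noteq> 0" "(cone w1 u + cone w1 u') + (w1 + k *s (t *s w2))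
        = r *s ((cone w1' u + cone w1' u') + (w1' + k' *s w2'))"
      unfolding sim_def by blast
    have X: "cone w1 u + cone w1 u' \<in> X" "r *s (cone w1' u + cone w1' u') \<in> X"
      using cone_half(3) hf u w w' nz X_subspace by (auto intro!: vec.subspace_add vec.subspace_scale)
    have WW: "w1 + k *s (t *s w2) \<in> W" "r *s (w1' + k' *s w2') \<in> W"
      using w w' Wp_subspace by (auto intro!: vec.subspace_add vec.subspace_scale)
    have "w1 + k *s (t *s w2) = r *s (w1' + k' *s w2')"
      by (rule split_eq(2)[OF X WW]) (use r(2) in \<open>simp add: vec.scale_right_distrib\<close>)
    also have "\<dots> = (r * ((1 - k') * s + k')) *s w1 + (r * ((1 - k') * s * d + k' * t)) *s w2
        + (r * ((1 - k') * s)) *s c"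
      unfolding w2'_def w1'_def y_def w_def by (simp add: vec_eq_iff algebra_simps)
    finally have "1 *s w1 + (k * t) *s w2 + 0 *s c = (r * ((1 - k') * s + k')) *s w1
        + (r * ((1 - k') * s * d + k' * t)) *s w2 + (r * ((1 - k') * s)) *s c" by simp
    note co = ind3_coeffs[OF ind this]
    \<comment> \<open>The vector \<open>c\<close> does not occur in the first splitting, so its
      coefficient \<open>r * ((1 - k') * s)\<close> in the second one vanishes.\<close>
    have "k' = 1" using co(3) r s0 by simp
    then have "k = 1" using co(1,2) t by simp
    then show ?thesis using k cone_scale_center[OF hf(1) w(3,4) nz(3) u(1) t(1)]
        cone_scale_center[OF hf(2) w(3,4) nz(3) u(2) t(1)] by simp
  qed
  from x show ?thesis unfolding half_def
    using main dual_vector_U[of x "- (t * ?F)"] dual_vector_U'[of x "- (t * ?F)"] False by blast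
qed simp

text \<open>Two centres are nonorthogonal, proportional, or span a singular line. In the last case
  \<open>w + w'\<close> is a singular vector of \<open>W\<close> and hence also fixed, so
  \<open>cone_fixed_sum\<close> applies.\<close>

lemma cone_center_eq:
  assumes w: "w \<in> W" "w \<in> S" "w \<noteq> 0" "w' \<in> W" "w' \<in> S" "w' \<noteq> 0" and x: "half T" "x \<in> T"
  shows "cone w x = cone w' x"
proof -
  note T' = half_facts[OF x(1)]
  consider "f w w' \<noteq> 0" | "x = 0" | "f w w' = 0" "ind2 w w'" "x \<noteq> 0" | c where "w' = c *s w" "c \<noteq> 0"
    unfolding ind2_iff using w by fastforce
  then show ?thesis
  proof cases
    case 1
    then show ?thesis using cone_opposite_eq w x by blast
  next
    case 3
    have "ind3 w w' x"
    proof (rule ind3I[OF 3(2)])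
      fix a b
      have "a *s w + b *s w' \<in> W" using w W_comb by blast
      moreover have "pW x = 0" using T' x X_def by blast
      ultimately show "x \<noteq> a *s w + b *s w'" using pW_parts(1) 3(3) by metis
    qed
    then have ind: "ind3 x w w'" using ind3_perm by blast
    have ww: "w + w' \<in> W" "w + w' \<in> S" using w Wp_subspace vec.subspace_add S_add 3 by blast+
    have "adj x w" "adj x w'" using adj_W T' x w by blast+
    moreover have "adj w w'" using w 3 adj_iff by blast
    ultimately show ?thesis using cone_fixed_sum[OF _ _ _ ind] W_fixed w ww by blast
  next
    case 4
    then show ?thesis using cone_scale_center[OF x(1) w(1,2,3) x(2)] by simp
  qed simp
qed

section \<open>The linear lift of a collineation of a quadric\<close>

definition "w0 = (SOME w. w \<in> W \<and> w \<in> S \<and> w \<noteq> 0)"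

lemma w0: "w0 \<in> W" "w0 \<in> S" "w0 \<noteq> 0"
  using someI_ex[OF W_sing] unfolding w0_def by auto

definition "lift v = cone w0 (pU v) + cone w0 (pU' v) + pW v"

lemma hf: "half U" "half U'" unfolding half_def by auto

lemma lift_linear: "vlinear lift"
  by (rule vlinearI) (simp_all add: lift_def p_lin cone_half_linear[OF hf(1) w0 pU_U] pU_U
      cone_half_linear[OF hf(2) w0 pU'_U'] pU'_U' vec.scale_right_distrib)

lemma lift_X: "cone w0 (pU v) + cone w0 (pU' v) \<in> X"
  using cone_half(3) hf w0 pU_U pU'_U' X_subspace vec.subspace_add by metis

lemma cone_X:
  assumes "u \<in> U" "u' \<in> U'" "f u u' = 0" "u + u' \<noteq> 0" and w: "w \<in> W" "w \<in> S" "w \<noteq> 0"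
  shows "sim (g (u + u')) (cone w0 u + cone w0 u')" "sim (g (u + u' + w)) (cone w0 u + cone w0 u' + w)"
proof -
  have X: "u \<in> X" "u' \<in> X" "u \<in> S" "u' \<in> S" using assms U_X U_S by auto
  have adj: "adj (u + u') w" "adj u u'" "adj u w" "adj u' w"
    using adj_W adj_iff X assms S_add X_subspace vec.subspace_add by metis+
  have ind: "ind2 (u + u') w" using ind2_XW X assms X_subspace vec.subspace_add by blast
  have c: "cone w (u + u') = cone w u + cone w u'"
  proof (cases "u = 0 \<or> u' = 0")
    case False
    have "ind2 u u'" unfolding ind2_iff
    proof safe
      fix c assume "u' = c *s u"
      then have "u' \<in> U" using assms vec.span_scale by blast
      then show False using pU_parts(1,2) assms(2) False by metis
    qed (use False in auto)
    then show ?thesis using cone_add(1)[OF adj(2,3,4)] ind3_XXW X w W_fixed by blast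
  qed auto
  have e: "cone w u = cone w0 u" "cone w u' = cone w0 u'"
    using cone_center_eq w w0 hf assms by blast+
  show "sim (g (u + u')) (cone w0 u + cone w0 u')"
    using cone_props(1)[OF adj(1) ind W_fixed[OF w(1,2)]] sim_sym unfolding c e by blast
  show "sim (g (u + u' + w)) (cone w0 u + cone w0 u' + w)"
    using cone_props(2)[OF adj(1) ind W_fixed[OF w(1,2)]] unfolding c e .
qed

text \<open>The component in \<open>W\<close> is split into singular vectors with the help of
  \<open>s\<close>. Singularity of \<open>a\<close> then gives the equation
  \<open>f ?u ?u' = - f w1 w2\<close> that \<open>opposite_centers\<close> requires.\<close>

lemma lift_decomposable:
  assumes a: "a \<in> S" and Qw: "Q (pW a) \<noteq> 0" and s: "s \<in> W" "s \<in> S" "f (pW a) s \<noteq> 0"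
  shows "sim (g a) (lift a)"
proof -
  let ?w = "pW a" and ?u = "pU a" and ?u' = "pU' a"
  \<comment> \<open>The multiple of \<open>s\<close> with \<open>f ?w w1 = Q ?w\<close>, so that
    \<open>Q (?w - w1) = 0\<close>.\<close>
  define w1 where "w1 = (Q ?w / f ?w s) *s s"
  define w2 where "w2 = ?w + (-1) *s w1"
  have w1: "w1 \<in> W" "w1 \<in> S" using s S_scale W_scale by (auto simp: w1_def)
  have fw: "f ?w w1 = Q ?w" using s by (simp add: w1_def f_bilin)
  have "Q w1 = 0" using w1 S_iff by blast
  then have "Q w2 = 0" using fw by (simp add: w2_def Q_diff)
  then have w2: "w2 \<in> W" "w2 \<in> S"
    using w1 pW_W S_iff unfolding w2_def by (auto intro!: W_diff)
  have "f w1 w1 = 0" "f w1 ?w = Q ?w" using w1 S_self fw f_comm by auto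
  then have f12: "f w1 w2 = Q ?w" by (simp add: w2_def f_bilin)
  have sum: "w1 + w2 = ?w" by (simp add: w2_def)
  have "?u + ?u' \<in> X" using pU_U pU'_U' U_X X_subspace vec.subspace_add by blast
  then have "Q (?u + ?u' + ?w) = Q (?u + ?u') + Q ?w" using Q_split pW_W by blast
  then have "f ?u ?u' + Q ?w = 0" using a S_iff Q_UU[OF pU_U pU'_U'] parts_sum by metis
  then have fu: "f ?u ?u' = - f w1 w2" using f12 by (simp add: eq_neg_iff_add_eq_0)
  have n: "f w1 w2 \<noteq> 0" using f12 Qw by simp
  obtain k where k: "k \<noteq> 0"
    "sim (g (?u + ?u' + (w1 + w2))) ((cone w1 ?u + cone w1 ?u') + (w1 + k *s w2))"
    "cone w1 ?u = k *s cone w2 ?u"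
    using opposite_centers[OF w1 w2 n pU_U pU'_U' fu] by metis
  have nz: "w1 \<noteq> 0" "w2 \<noteq> 0" "?u \<noteq> 0" using n fu by auto
  have ce: "cone w1 ?u = cone w0 ?u" "cone w1 ?u' = cone w0 ?u'" "cone w2 ?u = cone w0 ?u"
    using cone_center_eq w1 w2 nz w0 hf pU_U pU'_U' by blast+
  have "g ?u \<noteq> 0" using g_nz U_S(1) pU_U nz by blast
  then have "cone w0 ?u \<noteq> 0" using cone_half(1)[OF hf(1) w0 pU_U] sim_zero by blast
  \<comment> \<open>Both centres give the same nonzero lift of \<open>?u\<close>.\<close>
  then have "k = 1" using k(3) unfolding ce by (metis vec.scale_cancel_right vec.scale_one)
  then show ?thesis using k(2) parts_sum[of a] unfolding ce sum lift_def by (simp add: sum)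
qed

lemma W_opposite: obtains w1 w2 where "w1 \<in> W" "w1 \<in> S" "w2 \<in> W" "w2 \<in> S" "f w1 w2 \<noteq> 0"
proof -
  obtain y where y: "f y w0 \<noteq> 0" using S_nondeg w0 by blast
  have "f (pU y) w0 = 0" "f (pU' y) w0 = 0" using W_perp w0 pU_U pU'_U' f_comm by metis+
  then have "f (pW y) w0 \<noteq> 0" using y unfolding pW_def by (simp add: f_bilin)
  moreover from this obtain c where "pW y + c *s w0 \<in> S" using S_lift w0 by blast
  moreover have "pW y + c *s w0 \<in> W" using pW_W w0 Wp_subspace vec.subspace_add vec.subspace_scale by blast
  moreover have "f w0 w0 = 0" using S_self w0 by blast
  ultimately have "f w0 (pW y + c *s w0) \<noteq> 0" using f_comm by (simp add: f_bilin)
  then show thesis using that w0 \<open>pW y + c *s w0 \<in> S\<close> \<open>pW y + c *s w0 \<in> W\<close> by blast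
qed

text \<open>The cases follow the component of \<open>a\<close> in \<open>W\<close>. If it is
  singular, \<open>u\<close> and \<open>u'\<close> are orthogonal and \<open>cone_X\<close> or
  \<open>W_fixed\<close> applies. If it is nonsingular, \<open>lift_decomposable\<close> needs a
  singular vector of \<open>W\<close> that is not orthogonal to it.\<close>

lemma lift_induces: "a \<in> S \<Longrightarrow> sim (g a) (lift a)"
proof -
  assume a: "a \<in> S"
  let ?w = "pW a" and ?u = "pU a" and ?u' = "pU' a"
  have x: "?u + ?u' \<in> X" using pU_U pU'_U' U_X X_subspace vec.subspace_add by blast
  then have "Q (?u + ?u' + ?w) = Q (?u + ?u') + Q ?w" using Q_split pW_W by blast
  then have Qa: "f ?u ?u' + Q ?w = 0" using a S_iff Q_UU[OF pU_U pU'_U'] parts_sum by metis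
  consider "a = 0" | "a \<noteq> 0" "?w = 0" | "?w \<noteq> 0" "Q ?w = 0" "?u + ?u' = 0" | "?w \<noteq> 0" "Q ?w = 0" "?u + ?u' \<noteq> 0"
    | s where "Q ?w \<noteq> 0" "s \<in> W" "s \<in> S" "f ?w s \<noteq> 0"
    | "Q ?w \<noteq> 0" "\<And>s. s \<in> W \<Longrightarrow> s \<in> S \<Longrightarrow> f ?w s = 0" by blast
  then show ?thesis
  proof cases
    case 1
    then show ?thesis using g_zero vlinearD(3)[OF lift_linear] by simp
  next
    case 2
    then have ae: "a = ?u + ?u'" using parts_sum[of a] by simp
    have "Q ?w = 0" using 2 S_iff S_zero by simp
    then have f0: "f ?u ?u' = 0" using Qa by simp
    have "?u + ?u' \<noteq> 0" using 2 ae by simp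
    from cone_X(1)[OF pU_U pU'_U' f0 this w0] show ?thesis using 2 ae unfolding lift_def by simp
  next
    case 3
    have "a = ?w" using parts_sum[of a] 3 by simp
    moreover from this have "sim (g ?w) ?w" using W_fixed[OF pW_W] a by metis
    moreover have "?u = 0" "?u' = 0" using \<open>a = ?w\<close> pU_parts(3) pU'_parts(3) pW_W by metis+
    ultimately show ?thesis unfolding lift_def by simp
  next
    case 4
    have "?w \<in> S" using 4 S_iff by blast
    moreover have "f ?u ?u' = 0" using Qa 4 by simp
    ultimately have "sim (g (?u + ?u' + ?w)) (lift a)"
      unfolding lift_def using cone_X(2)[OF pU_U pU'_U' _ 4(3) pW_W] 4(1) by blast
    then show ?thesis using parts_sum[of a] by metis
  next
    case 5
    then show ?thesis using lift_decomposable a by blast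
  next
    \<comment> \<open>This happens, for example, when the component spans the nucleus of a parabolic
      quadric in characteristic 2. For singular \<open>v\<close> in \<open>W\<close>, the point of
      \<open>a + v\<close> is decomposable and the point of \<open>v\<close> is fixed, so
      \<open>g a\<close> lies in the span of \<open>lift a\<close> and \<open>v\<close>. Doing this
      for two independent \<open>v\<close> leaves only the multiples of
      \<open>lift a\<close>.\<close>
    case 6
    obtain w1 w2 where w: "w1 \<in> W" "w1 \<in> S" "w2 \<in> W" "w2 \<in> S" "f w1 w2 \<noteq> 0" by (rule W_opposite)
    have step: "\<exists>A B. g a = A *s lift a + B *s v"
      if v: "v \<in> W" "v \<in> S" "v' \<in> W" "v' \<in> S" "f v v' \<noteq> 0" for v v'
    proof -
      have pw: "pW (a + v) = ?w + v" using v pW_parts(1) by (simp add: p_lin)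
      have "f (?u + ?u') v = 0" using W_X_perp x v f_comm by metis
      moreover have fwv: "f ?w v = 0" using 6 v by blast
      ultimately have "f (?u + ?u' + ?w) v = 0" by (simp add: f_bilin)
      then have fav: "f a v = 0" unfolding parts_sum[symmetric] .
      have S: "a + v \<in> S" using S_add a v fav by blast
      have Qv: "Q v = 0" using v S_iff by blast
      have "Q (pW (a + v)) \<noteq> 0" unfolding pw using fwv Qv 6(1) by (simp add: Q_add)
      moreover have "f (pW (a + v)) v' \<noteq> 0" unfolding pw using 6(2)[OF v(3,4)] v by (simp add: f_bilin)
      ultimately have "sim (g (a + v)) (lift (a + v))" using lift_decomposable S v by blast
      then obtain r where r: "g (a + v) = r *s lift (a + v)" unfolding sim_def by blast
      have lv: "lift v = v" using v pU_parts pU'_parts pW_parts by (simp add: lift_def)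
      obtain q where q: "g v = q *s v" using W_fixed[OF v(1,2)] unfolding sim_def by blast
      have "f (a + v) v = 0" using fav S_self v by (simp add: f_bilin)
      then have adj: "adj (a + v) v" using S v adj_iff by blast
      obtain A B where "g (1 *s (a + v) + (-1) *s v) = A *s g (a + v) + B *s g v"
        using g_line[OF adj] by blast
      then have "g a = A *s (r *s (lift a + v)) + B *s (q *s v)"
        using r q lv vlinearD(1)[OF lift_linear, of a v] by simp
      also have "\<dots> = (A * r) *s lift a + (A * r + B * q) *s v"
        by (simp add: vec_eq_iff algebra_simps)
      finally show ?thesis by blast
    qed
    obtain A B where 1: "g a = A *s lift a + B *s w1" using step w by blast
    have w21: "f w2 w1 \<noteq> 0" using w(5) f_comm by simp
    obtain A' B' where 2: "g a = A' *s lift a + B' *s w2" using step[OF w(3,4,1,2) w21] by blast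
    have i12: "ind2 w1 w2" using ind2_nonperp w by blast
    have fu: "f ?u ?u' \<noteq> 0" using Qa 6(1) by auto
    have iu: "ind2 ?u ?u'" using ind2_nonperp[OF U_S(1)[OF pU_U] fu] .
    have "ind2 (cone w0 ?u) (cone w0 ?u')"
      by (rule ind2_sim[OF g_ind2[OF U_S(1)[OF pU_U] U_S(3)[OF pU'_U'] iu]])
        (use cone_half(1) hf w0 pU_U pU'_U' in blast)+
    then have cu: "cone w0 ?u + cone w0 ?u' \<noteq> 0"
      unfolding ind2_def by (metis one_neq_zero vec.scale_one)
    have ind: "ind3 (lift a) w1 w2" unfolding ind3_def
    proof (intro allI impI)
      fix p q r assume z: "p *s lift a + q *s w1 + r *s w2 = 0"
      let ?c = "cone w0 ?u + cone w0 ?u'"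
      have eq: "p *s ?c + (p *s ?w + (q *s w1 + r *s w2)) = 0 + 0"
        using z unfolding lift_def by (simp add: vec.scale_right_distrib add_ac)
      have in1: "p *s ?c \<in> X" "0 \<in> X"
        using lift_X X_subspace vec.subspace_scale vec.subspace_0 by blast+
      have in2: "p *s ?w + (q *s w1 + r *s w2) \<in> W" "0 \<in> W"
        using pW_W w W_comb Wp_subspace by (auto intro!: vec.subspace_add vec.subspace_scale vec.subspace_0)
      have "p *s ?c = 0" "p *s ?w + (q *s w1 + r *s w2) = 0"
        using split_eq[OF in1 in2 eq] by blast+
      moreover from this(1) have p0: "p = 0" using cu by (metis vec.scale_eq_0_iff)
      ultimately have "q *s w1 + r *s w2 = 0" by simp
      then show "p = 0 \<and> q = 0 \<and> r = 0" using p0 i12 unfolding ind2_def by blast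
    qed
    have "A *s lift a + B *s w1 + 0 *s w2 = A' *s lift a + 0 *s w1 + B' *s w2" using 1 2 by simp
    from ind3_coeffs[OF ind this] have "B = 0" by simp
    then have ga: "g a = A *s lift a" using 1 by simp
    moreover have "a \<noteq> 0" using fu by (auto simp: pU_def)
    then have "g a \<noteq> 0" using g_nz a by blast
    ultimately show ?thesis unfolding sim_def by auto
  qed
qed

end

section \<open>Decomposition into long root elations\<close>

context quadric_domestic
begin

definition "N v = lift v - v"

lemma N_linear: "vlinear N"
  by (rule vlinearI) (simp_all add: N_def vlinearD[OF lift_linear] vec.scale_right_diff_distrib)

lemma N_W: "w \<in> W \<Longrightarrow> N w = 0"
  unfolding N_def lift_def using pU_parts pU'_parts pW_parts by simp

lemma N_X: "x \<in> X \<Longrightarrow> N x \<in> X"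
proof -
  assume x: "x \<in> X"
  then have "lift x = cone w0 (pU x) + cone w0 (pU' x)" unfolding lift_def X_def by simp
  then have "lift x \<in> X" using lift_X by simp
  then show ?thesis unfolding N_def using x X_subspace by (simp add: vec.subspace_diff)
qed

lemma lift_dom: "a \<in> S \<Longrightarrow> f a (lift a) = 0" "a \<in> S \<Longrightarrow> lift a \<in> S"
  using f_sim[OF sim_refl lift_induces] dom S_sim[OF sim_sym[OF lift_induces]] g_S by blast+

text \<open>Domesticity concerns singular vectors only, so \<open>x\<close> is completed to the
  singular vector \<open>x + w\<close>, with \<open>w\<close> in \<open>W\<close> and
  \<open>Q w = - Q x\<close>; the lift fixes \<open>w\<close>. Domesticity then gives
  \<open>f x (lift x) = 2 * Q x\<close>, and singularity of the image gives
  \<open>Q (lift x) = Q x\<close>.\<close>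

lemma N_X_alternating:
  assumes x: "x \<in> X" shows "f x (N x) = 0" "Q (N x) = 0"
proof -
  obtain w1 w2 where w: "w1 \<in> W" "w1 \<in> S" "w2 \<in> W" "w2 \<in> S" "f w1 w2 \<noteq> 0" by (rule W_opposite)
  define w where "w = w1 + (- Q x / f w1 w2) *s w2"
  have wW: "w \<in> W" unfolding w_def using w W_add W_scale by blast
  have "Q w1 = 0" "Q w2 = 0" using w S_iff by auto
  then have Qw: "Q w = - Q x" using w(5) by (simp add: w_def Q_diff Q_add Q_scale f_bilin)
  have S: "x + w \<in> S" using S_iff Q_split[OF x wW] Qw by simp
  have lx: "lift x \<in> X" using N_X[OF x] x X_add[of "N x" x] unfolding N_def by simp
  have lw: "lift w = w" using N_W[OF wW] unfolding N_def by simp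
  have l: "lift (x + w) = lift x + w" using vlinearD(1)[OF lift_linear] lw by simp
  have perp: "f w (lift x) = 0" "f x w = 0" using W_X_perp[OF wW] lx x f_comm by metis+
  have "f (x + w) (lift x + w) = 0" using lift_dom(1)[OF S] l by simp
  then have 1: "f x (lift x) = 2 * Q x" using perp f_self[of w] Qw by (simp add: f_bilin)
  then show "f x (N x) = 0" unfolding N_def by (simp add: f_bilin f_self)
  have "Q (lift x + w) = 0" using lift_dom(2)[OF S] l S_iff by simp
  then have "Q (lift x) = Q x" using Q_split[OF lx wW] Qw by simp
  then show "Q (N x) = 0" unfolding N_def using 1 f_comm[of "lift x" x] by (simp add: Q_diff)
qed

lemma N_alternating: "f v (N v) = 0" "Q (N v) = 0" "N v \<in> X"
proof -
  let ?x = "pU v + pU' v"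
  have x: "?x \<in> X" using pU_U pU'_U' U_X X_add by blast
  have "N v = N (?x + pW v)" using parts_sum[of v] by simp
  also have "\<dots> = N ?x" using vlinearD(1)[OF N_linear, of ?x "pW v"] N_W[OF pW_W] by simp
  finally have e: "N v = N ?x" .
  show "Q (N v) = 0" "N v \<in> X" unfolding e using N_X_alternating N_X x by auto
  have "f (?x + pW v) (N ?x) = 0"
    using N_X_alternating(1)[OF x] W_X_perp[OF pW_W N_X[OF x]] by (simp add: f_bilin)
  then show "f v (N v) = 0" unfolding e parts_sum[symmetric] .
qed

lemma N_skew: "f v (N v') = - f v' (N v)"
proof -
  have "f (v + v') (N v + N v') = 0" using N_alternating(1)[of "v + v'"] vlinearD(1)[OF N_linear] by simp
  then show ?thesis using N_alternating(1) by (simp add: f_bilin eq_neg_iff_add_eq_0 add.commute)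
qed

lemma N_image_perp: "f (N v) (N v') = 0"
  using N_alternating(2)[of "v + v'"] N_alternating(2) by (simp add: vlinearD(1)[OF N_linear] Q_add)

text \<open>By skew-symmetry \<open>f y (N (N v)) = - f (N v) (N y) = 0\<close>. Since
  \<open>N (N v)\<close> is singular, nondegeneracy on \<open>S\<close> applies.\<close>

lemma N_N: "N (N v) = 0"
proof (rule S_nondeg)
  show "N (N v) \<in> S" using N_alternating(2) S_iff by simp
  show "f y (N (N v)) = 0" for y using N_skew[of y "N v"] N_image_perp by simp
qed

lemma N_hsys: 
  assumes "a \<in> idx i" "b \<in> idx i" shows "f (e a) (N (e b)) \<noteq> 0 \<longleftrightarrow> b = partner a"
proof -
  have "f (e a) (N (e b)) = f (e a) (lift (e b))"
    unfolding N_def using hsysD(2)[OF h] assms by (simp add: f_bilin)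
  then show ?thesis using f_sim[OF sim_refl lift_induces] e_S hsysD(3)[OF h] assms by metis
qed

definition "\<beta> j = f (e (j, True)) (N (e (j, False)))"

text \<open>Normal form of the alternating map \<open>N\<close> with respect to the symplectic basis
  \<open>e\<close>: the summand of \<open>j\<close> is the increment of a long root elation whose
  axis is spanned by \<open>N (e (j, True))\<close> and \<open>N (e (j, False))\<close>.\<close>

definition "N' v = (\<Sum>j<i. (1 / \<beta> j) *s (f v (N (e (j, False))) *s N (e (j, True))
    - f v (N (e (j, True))) *s N (e (j, False))))"

lemma idx_iff [simp]: "(j, s) \<in> idx m \<longleftrightarrow> j < m" by (simp add: idx_def)

lemma beta_nz: "j < i \<Longrightarrow> \<beta> j \<noteq> 0"
  unfolding \<beta>_def using N_hsys[of "(j, True)" "(j, False)"] by (simp add: partner_def)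

lemma N'_linear: "vlinear N'"
proof (rule vlinearI)
  show "N' (x + y) = N' x + N' y" for x y
    unfolding N'_def sum.distrib[symmetric]
    by (rule sum.cong) (simp_all add: f_bilin vec_eq_iff algebra_simps)
  show "N' (c *s x) = c *s N' x" for c x
    unfolding N'_def vec.scale_sum_right
    by (rule sum.cong) (simp_all add: f_bilin vec_eq_iff algebra_simps)
qed

lemma N'_e:
  assumes a: "a \<in> idx i" shows "N' (e a) = N (e a)"
proof -
  obtain k s where k: "a = (k, s)" "k < i" using a by (cases a) simp
  have z: "f (e (k, s)) (N (e (j, s'))) = 0" if "j < i" "\<not> (j = k \<and> s' \<noteq> s)" for j s'
    using N_hsys[of "(k, s)" "(j, s')"] that k(2) by (auto simp: partner_def)
  have "N' (e a) = (\<Sum>j<i. if j = k then N (e a) else 0)"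
    unfolding N'_def k(1)
  proof (rule sum.cong[OF refl])
    fix j assume "j \<in> {..<i}"
    then have j: "j < i" by simp
    show "(1 / \<beta> j) *s (f (e (k, s)) (N (e (j, False))) *s N (e (j, True))
        - f (e (k, s)) (N (e (j, True))) *s N (e (j, False))) = (if j = k then N (e (k, s)) else 0)"
    proof (cases "j = k")
      case False
      then show ?thesis using z[OF j] by simp
    next
      case True
      show ?thesis
      proof (cases s)
        assume s: "s"
        then have "f (e (k, s)) (N (e (k, True))) = 0" using z[OF k(2)] by simp
        then show ?thesis using True s beta_nz[OF k(2)] by (simp add: \<beta>_def)
      next
        assume s: "\<not> s"
        then have "f (e (k, s)) (N (e (k, False))) = 0" using z[OF k(2)] by simp
        moreover have "f (e (k, s)) (N (e (k, True))) = - \<beta> k"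
          using N_skew[of "e (k, False)" "e (k, True)"] s by (simp add: \<beta>_def)
        ultimately show ?thesis using True s beta_nz[OF k(2)] by simp
      qed
    qed
  qed
  also have "\<dots> = N (e a)" using k by simp
  finally show ?thesis .
qed

text \<open>The two maps agree on \<open>U\<close> by evaluation at the basis. They agree on
  \<open>U'\<close> because \<open>dual e a\<close> is proportional to some \<open>p + N p\<close>
  with \<open>p\<close> in the basis, and both maps kill \<open>N p\<close>. Both vanish on
  \<open>W\<close>, as the image of \<open>N\<close> lies in \<open>X\<close>.\<close>

lemma N_eq: "N v = N' v"
proof -
  note Nl = vlinearD[OF N_linear] and N'l = vlinearD[OF N'_linear]
  let ?K = "{v. N v = N' v}"
  have K: "vec.subspace ?K" by (simp add: vec.subspace_def Nl N'l)
  have "e ` idx i \<subseteq> ?K" using N'_e by auto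
  then have 1: "U \<subseteq> ?K" by (rule vec.span_minimal[OF _ K])
  have "dual e a \<in> ?K" if a: "a \<in> idx i" for a
  proof -
    let ?p = "e (partner a)"
    have "sim (g ?p) (lift ?p)" using lift_induces e_S a by simp
    then have "sim (dual e a) (lift ?p)" using dual_sim[OF h a] sim_trans by blast
    moreover have "lift ?p = ?p + N ?p" by (simp add: N_def)
    moreover have "?p \<in> ?K" using N'_e a by simp
    moreover have "N' (N ?p) = 0" unfolding N'_def N_image_perp by simp
    then have "N ?p \<in> ?K" using N_N[of ?p] by simp
    ultimately have "sim (dual e a) (?p + N ?p)" "?p + N ?p \<in> ?K" using vec.subspace_add[OF K] by auto
    then show ?thesis by (rule sim_subspace[OF K])
  qed
  then have 2: "U' \<subseteq> ?K" by (intro vec.span_minimal[OF _ K]) auto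
  have 3: "W \<subseteq> ?K"
  proof
    fix w assume w: "w \<in> W"
    have "f w (N x) = 0" for x using W_X_perp[OF w N_alternating(3)] .
    then show "w \<in> ?K" using N_W[OF w] by (simp add: N'_def)
  qed
  have "pU v \<in> ?K" "pU' v \<in> ?K" "pW v \<in> ?K"
    using subsetD[OF 1 pU_U] subsetD[OF 2 pU'_U'] subsetD[OF 3 pW_W] .
  then have "pU v + pU' v + pW v \<in> ?K" by (intro vec.subspace_add[OF K])
  then show ?thesis unfolding parts_sum[symmetric] by simp
qed

text \<open>The witnesses are \<open>A p = N (e p)\<close>, \<open>B p = e (partner p)\<close> and
  \<open>c j = 1 / \<beta> j\<close>. The family \<open>B\<close> records the independence of the
  vectors \<open>A p\<close>, from which the axes will be seen to be disjoint.\<close>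

lemma long_root_decomposition:
  "\<exists>A B c. (\<forall>p\<in>idx i. \<forall>q\<in>idx i. f (A q) (B p) \<noteq> 0 \<longleftrightarrow> p = q) \<and>
     (\<forall>p\<in>idx i. A p \<in> S) \<and> (\<forall>p\<in>idx i. \<forall>q\<in>idx i. f (A p) (A q) = 0) \<and> (\<forall>j<i. c j \<noteq> 0) \<and>
     (\<forall>x\<in>S. sim (g x) (x + (\<Sum>j<i. c j *s (f x (A (j, False)) *s A (j, True)
        - f x (A (j, True)) *s A (j, False)))))"
proof (intro exI conjI ballI allI impI)
  show "f (N (e q)) (e (partner p)) \<noteq> 0 \<longleftrightarrow> p = q" if "p \<in> idx i" "q \<in> idx i" for p q
    using N_hsys[of "partner p" q] that f_comm[of "N (e q)"] by auto
  show "N (e p) \<in> S" for p using N_alternating(2) S_iff by simp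
  show "f (N (e p)) (N (e q)) = 0" for p q by (rule N_image_perp)
  show "1 / \<beta> j \<noteq> 0" if "j < i" for j using beta_nz that by simp
  show "sim (g x) (x + (\<Sum>j<i. (1 / \<beta> j) *s (f x (N (e (j, False))) *s N (e (j, True))
        - f x (N (e (j, True))) *s N (e (j, False)))))" if "x \<in> S" for x
  proof -
    have "x + N' x = lift x" unfolding N_eq[symmetric] by (simp add: N_def)
    then show ?thesis using lift_induces[OF that] unfolding N'_def by simp
  qed
qed

end

section \<open>From collineations to vectors\<close>

lemma proj_points_iff:
  fixes U :: "('k::field ^ 'm::finite) set"
  assumes "vec.subspace U"
  shows "p \<in> proj_points U \<longleftrightarrow> (\<exists>x\<in>U. x \<noteq> 0 \<and> p = vec.span {x})"
proof
  assume p: "p \<in> proj_points U"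
  then have sp: "vec.subspace p" "vec.dim p = 1" "p \<subseteq> U" by (auto simp: proj_points_def)
  obtain B where B: "B \<subseteq> p" "vec.independent B" "p \<subseteq> vec.span B" "card B = vec.dim p"
    by (rule vec.basis_exists)
  then obtain x where x: "B = {x}" using sp card_1_singletonE by metis
  have "x \<noteq> 0" using B(2) x vec.dependent_zero by blast
  moreover have "p = vec.span {x}" using B sp(1) vec.span_minimal x by blast
  ultimately show "\<exists>x\<in>U. x \<noteq> 0 \<and> p = vec.span {x}" using B x sp by blast
next
  assume "\<exists>x\<in>U. x \<noteq> 0 \<and> p = vec.span {x}"
  then obtain x where x: "x \<in> U" "x \<noteq> 0" "p = vec.span {x}" by blast
  have "vec.independent {x}" using x(2) by simp
  then have "vec.dim p = 1" using vec.dim_span_eq_card_independent x(3) by fastforce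
  moreover have "p \<subseteq> U" unfolding x(3) by (rule vec.span_minimal) (use x assms in auto)
  ultimately show "p \<in> proj_points U" using x by (simp add: proj_points_def)
qed

lemma span_singleton_mem: "vec.span {x} \<subseteq> U \<longleftrightarrow> x \<in> U" if "vec.subspace U"
  using that vec.span_minimal[of "{x}" U] vec.span_base[of x "{x}"] by auto

lemma pt_mem_proj_points:
  assumes "vec.subspace U" "x \<noteq> 0" shows "vec.span {x} \<in> proj_points U \<longleftrightarrow> x \<in> U"
proof
  assume "vec.span {x} \<in> proj_points U"
  then show "x \<in> U" using span_singleton_mem[OF assms(1)] by (auto simp: proj_points_def)
qed (use proj_points_iff[OF assms(1)] assms in blast)

lemma span_eq_sim: "vec.span {x} = vec.span {y} \<longleftrightarrow> sim x y"
proof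
  assume e: "vec.span {x} = vec.span {y}"
  then have m: "x \<in> vec.span {y}" "y \<in> vec.span {x}" using vec.span_base by blast+
  obtain s where s: "x = s *s y" using m(1) unfolding vec.span_singleton by auto
  obtain t where t: "y = t *s x" using m(2) unfolding vec.span_singleton by auto
  note st = s t
  show "sim x y"
  proof (cases "s = 0")
    case True
    then show ?thesis using st by simp
  qed (use st simI in blast)
next
  have *: "vec.span {x} \<subseteq> vec.span {y}" if "sim x y" for x y :: "'a ^ 'b"
  proof -
    have "y \<in> vec.span {y}" by (simp add: vec.span_base)
    then have "x \<in> vec.span {y}" using that vec.span_scale unfolding sim_def by blast
    then show ?thesis by (simp add: vec.span_minimal)
  qed
  assume "sim x y"
  then show "vec.span {x} = vec.span {y}" using *[of x y] *[of y x] sim_sym by blast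
qed

lemma ind2_independent: "ind2 x y \<longleftrightarrow> x \<noteq> y \<and> vec.independent {x, y}"
  for x y :: "'k::field ^ 'm::finite"
proof
  assume i: "ind2 x y"
  then have "x \<noteq> y" unfolding ind2_iff by (metis vec.scale_one)
  moreover have "y \<noteq> 0" using i ind2_sym ind2_iff by blast
  moreover have "x \<notin> vec.span {y}"
    using ind2_sym[OF i] unfolding ind2_iff vec.span_singleton by auto
  ultimately show "x \<noteq> y \<and> vec.independent {x, y}" by (simp add: vec.independent_insert)
next
  assume a: "x \<noteq> y \<and> vec.independent {x, y}"
  then have "x \<noteq> 0" using vec.dependent_zero by blast
  moreover have "vec.independent {y, x}" using a by (simp add: insert_commute)
  then have "y \<notin> vec.span {x}" using a by (simp add: vec.independent_insert split: if_splits)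
  then have "y \<noteq> c *s x" for c using vec.span_scale[OF vec.span_base[of x "{x}"]] by auto
  ultimately show "ind2 x y" unfolding ind2_iff by blast
qed

lemma span_pair: "z \<in> vec.span {x, y} \<longleftrightarrow> (\<exists>a b. z = a *s x + b *s y)"
  for z :: "'k::field ^ 'm::finite"
proof
  assume "z \<in> vec.span {x, y}"
  then obtain a where "z - a *s x \<in> vec.span {y}" using vec.span_breakdown_eq by blast
  then obtain b where "z - a *s x = b *s y" unfolding vec.span_singleton by auto
  then have "z = a *s x + b *s y" by (simp add: algebra_simps)
  then show "\<exists>a b. z = a *s x + b *s y" by blast
next
  assume "\<exists>a b. z = a *s x + b *s y"
  then show "z \<in> vec.span {x, y}" by (auto simp: vec.span_add vec.span_scale vec.span_base)
qed

lemma dim_span_pair: "ind2 x y \<Longrightarrow> vec.dim (vec.span {x, y}) = 2" for x y :: "'k::field ^ 'm::finite"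
  using ind2_independent[of x y] vec.dim_span_eq_card_independent[of "{x, y}"] by simp

lemma plane_eq_span:
  assumes "vec.subspace U" "vec.dim U = 2" "x \<in> U" "y \<in> U" "ind2 x y"
  shows "U = vec.span {x, y}"
proof -
  have "vec.span {x, y} \<subseteq> U" by (rule vec.span_minimal) (use assms in auto)
  moreover have "U \<subseteq> vec.span {x, y}"
    by (rule vec.card_ge_dim_independent)
      (use assms ind2_independent[of x y] in auto)
  ultimately show ?thesis by blast
qed

section \<open>The map on vectors belonging to a collineation\<close>

locale polar_collineation = form_space f S \<epsilon>
  for f :: "'k::field ^ 'm::finite \<Rightarrow> 'k ^ 'm \<Rightarrow> 'k" and S \<epsilon> +
  fixes Sg :: "('k ^ 'm) set \<Rightarrow> bool" and \<theta> :: "('k ^ 'm) set \<Rightarrow> ('k ^ 'm) set"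
  assumes Sg_iff: "vec.subspace P \<Longrightarrow> Sg P \<longleftrightarrow> P \<subseteq> S \<and> (\<forall>x\<in>P. \<forall>y\<in>P. f x y = 0)"
    and coll: "collineation (polar_space_of Sg) \<theta>"
    and domes: "point_domestic (polar_space_of Sg) \<theta>"
begin

abbreviation "\<Delta> \<equiv> polar_space_of Sg"
abbreviation "pt x \<equiv> vec.span {x}"

lemma sing_iff: "Y \<in> sing \<Delta> d \<longleftrightarrow> (\<exists>P. vec.subspace P \<and> vec.dim P = d + 1 \<and> P \<subseteq> S \<and>
    (\<forall>x\<in>P. \<forall>y\<in>P. f x y = 0) \<and> Y = proj_points P)"
  unfolding polar_space_of_def using Sg_iff by auto

lemma Sg_pt: "Sg (pt x) \<longleftrightarrow> x \<in> S"
proof -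
  have "f y z = 0 \<and> y \<in> S" if "x \<in> S" "y \<in> pt x" "z \<in> pt x" for y z
    using that S_self[OF that(1)] S_scale unfolding vec.span_singleton by (auto simp: f_bilin)
  then show ?thesis unfolding Sg_iff[OF vec.subspace_span] using vec.span_base by blast
qed

lemma points_iff: "p \<in> points \<Delta> \<longleftrightarrow> (\<exists>x\<in>S. x \<noteq> 0 \<and> p = pt x)"
proof -
  have "p \<in> points \<Delta> \<longleftrightarrow> (\<exists>x. x \<noteq> 0 \<and> p = pt x) \<and> Sg p"
    unfolding polar_space_of_def using proj_points_iff[OF vec.subspace_UNIV, of p] by simp
  then show ?thesis using Sg_pt by metis
qed

lemma pt_in_points: "x \<in> S \<Longrightarrow> x \<noteq> 0 \<Longrightarrow> pt x \<in> points \<Delta>"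
  using points_iff by blast

lemma theta_bij: "bij_betw \<theta> (points \<Delta>) (points \<Delta>)"
  using coll by (simp add: collineation_def)

lemma theta_lines: "(\<lambda>L. \<theta> ` L) ` lines \<Delta> = lines \<Delta>"
  using coll by (simp add: collineation_def)

lemma line_through: "x \<in> S \<Longrightarrow> y \<in> S \<Longrightarrow> f x y = 0 \<Longrightarrow> ind2 x y \<Longrightarrow> proj_points (vec.span {x, y}) \<in> lines \<Delta>"
proof -
  assume a: "x \<in> S" "y \<in> S" "f x y = 0" "ind2 x y"
  have "{x, y} \<subseteq> S" "\<And>u v. u \<in> {x, y} \<Longrightarrow> v \<in> {x, y} \<Longrightarrow> f u v = 0"
    using a S_self f_sym0 by auto
  note s = span_sing[OF this]
  show ?thesis unfolding sing_iff
    by (intro exI[of _ "vec.span {x, y}"]) (use s dim_span_pair[OF a(4)] in \<open>auto simp: vec.subspace_span\<close>)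
qed

lemma line_perp: "L \<in> lines \<Delta> \<Longrightarrow> x \<noteq> 0 \<Longrightarrow> y \<noteq> 0 \<Longrightarrow> pt x \<in> L \<Longrightarrow> pt y \<in> L \<Longrightarrow> f x y = 0"
  unfolding sing_iff using pt_mem_proj_points by blast

lemma line_points: "L \<in> lines \<Delta> \<Longrightarrow> L \<subseteq> points \<Delta>"
proof
  fix p assume "L \<in> lines \<Delta>" "p \<in> L"
  then obtain P where P: "vec.subspace P" "P \<subseteq> S" "p \<in> proj_points P" unfolding sing_iff by blast
  then show "p \<in> points \<Delta>" using proj_points_iff points_iff by blast
qed

definition "g x = (if x \<in> S \<and> x \<noteq> 0 then SOME y. y \<in> S \<and> y \<noteq> 0 \<and> \<theta> (pt x) = pt y else 0)"

lemma g_pt: assumes "x \<in> S" "x \<noteq> 0" shows "g x \<in> S" "g x \<noteq> 0" "\<theta> (pt x) = pt (g x)"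
proof -
  have "\<theta> (pt x) \<in> points \<Delta>" using theta_bij pt_in_points[OF assms] bij_betwE by blast
  then have "\<exists>y. y \<in> S \<and> y \<noteq> 0 \<and> \<theta> (pt x) = pt y" using points_iff by blast
  from someI_ex[OF this] show "g x \<in> S" "g x \<noteq> 0" "\<theta> (pt x) = pt (g x)"
    using assms unfolding g_def by auto
qed

lemma g0: "g 0 = 0" by (simp add: g_def)

lemma gS: "x \<in> S \<Longrightarrow> g x \<in> S"
  using g_pt(1) g0 by (cases "x = 0") auto

lemma g_sim_iff:
  assumes "x \<in> S" "y \<in> S" shows "sim (g x) (g y) \<longleftrightarrow> sim x y"
proof (cases "x = 0 \<or> y = 0")
  case True
  then show ?thesis using g0 g_pt(2) assms sim_zero by metis
next
  case False
  then have e: "\<theta> (pt x) = pt (g x)" "\<theta> (pt y) = pt (g y)" using g_pt(3) assms by auto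
  have "sim (g x) (g y) \<longleftrightarrow> \<theta> (pt x) = \<theta> (pt y)" unfolding e span_eq_sim ..
  also have "\<dots> \<longleftrightarrow> pt x = pt y"
    using bij_betw_imp_inj_on[OF theta_bij] pt_in_points assms False by (metis inj_onD)
  finally show ?thesis unfolding span_eq_sim .
qed

lemma g_surj: "y \<in> S \<Longrightarrow> \<exists>x\<in>S. sim y (g x)"
proof (cases "y = 0")
  case True
  then show ?thesis using S_zero g0 sim_refl by metis
next
  case False
  assume "y \<in> S"
  then have "pt y \<in> \<theta> ` points \<Delta>"
    using pt_in_points[OF _ False] theta_bij unfolding bij_betw_def by simp
  then obtain p where p: "p \<in> points \<Delta>" "pt y = \<theta> p" by blast
  then obtain x where x: "x \<in> S" "x \<noteq> 0" "p = pt x" unfolding points_iff by blast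
  have "pt y = pt (g x)" using p(2) g_pt(3)[OF x(1,2)] x(3) by simp
  then show ?thesis using x(1) unfolding span_eq_sim by blast
qed

lemma not_ind2: "\<not> ind2 x y \<Longrightarrow> x = 0 \<or> y = 0 \<or> sim y x"
  unfolding ind2_iff by (metis simI vec.scale_zero_left)

lemma ind2_g: assumes "x \<in> S" "y \<in> S" "ind2 x y" shows "ind2 (g x) (g y)"
proof (rule ccontr)
  assume "\<not> ?thesis"
  moreover have "x \<noteq> 0" "y \<noteq> 0" using assms(3) ind2_sym ind2_iff by blast+
  ultimately have "sim (g y) (g x)" using not_ind2 g_pt(2) assms by blast
  then have "sim y x" using g_sim_iff assms by blast
  then show False using assms(3) unfolding ind2_iff sim_def by blast
qed

lemma image_line:
  assumes "x \<in> S" "y \<in> S" "f x y = 0" "ind2 x y"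
  shows "ind2 (g x) (g y)" "f (g x) (g y) = 0"
    "\<theta> ` proj_points (vec.span {x, y}) = proj_points (vec.span {g x, g y})"
proof -
  let ?L = "proj_points (vec.span {x, y})"
  have nz: "x \<noteq> 0" "y \<noteq> 0" using assms(4) ind2_sym ind2_iff by blast+
  have L: "?L \<in> lines \<Delta>" using line_through assms by blast
  then have L': "\<theta> ` ?L \<in> lines \<Delta>" using theta_lines by blast
  have "pt x \<in> ?L" "pt y \<in> ?L" using nz pt_mem_proj_points[OF vec.subspace_span] by (auto intro: vec.span_base)
  then have m: "pt (g x) \<in> \<theta> ` ?L" "pt (g y) \<in> \<theta> ` ?L" using g_pt(3) assms nz by (metis imageI)+
  show "f (g x) (g y) = 0" using line_perp[OF L' _ _ m] g_pt(2) assms nz by blast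
  show i: "ind2 (g x) (g y)" using ind2_g assms by blast
  obtain P where P: "vec.subspace P" "vec.dim P = 2" "\<theta> ` ?L = proj_points P"
    using L' unfolding sing_iff by auto
  have "g x \<in> P" "g y \<in> P" using m pt_mem_proj_points[OF P(1)] g_pt(2) assms nz unfolding P(3) by blast+
  then show "\<theta> ` ?L = proj_points (vec.span {g x, g y})" using plane_eq_span P i by metis
qed

text \<open>Orthogonality of independent vectors means lying on a common line. For the converse
  direction, the line through the images is itself the image of a line, which contains the original
  points by injectivity.\<close>

lemma g_perp_iff: assumes "x \<in> S" "y \<in> S" shows "f (g x) (g y) = 0 \<longleftrightarrow> f x y = 0"
proof (cases "ind2 x y")
  case False
  then consider "x = 0 \<or> y = 0" | "sim y x" using not_ind2 by blast
  then show ?thesis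
  proof cases
    case 2
    then have "sim (g y) (g x)" using g_sim_iff assms by blast
    then show ?thesis using 2 f_sim[OF sim_refl] S_self gS assms by blast
  qed (use g0 in auto)
next
  case True
  have nz: "x \<noteq> 0" "y \<noteq> 0" using True ind2_sym ind2_iff by blast+
  show ?thesis
  proof
    assume "f x y = 0"
    then show "f (g x) (g y) = 0" using image_line(2) assms True by blast
  next
    assume 0: "f (g x) (g y) = 0"
    have "ind2 (g x) (g y)" using ind2_g assms True by blast
    then have "proj_points (vec.span {g x, g y}) \<in> lines \<Delta>" using line_through gS assms 0 by blast
    then obtain L where L: "L \<in> lines \<Delta>" "proj_points (vec.span {g x, g y}) = \<theta> ` L"
      using theta_lines by blast
    have mem: "pt z \<in> L" if z: "z \<in> S" "z \<noteq> 0" "g z \<in> vec.span {g x, g y}" for z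
    proof -
      have "pt (g z) \<in> proj_points (vec.span {g x, g y})"
        using z g_pt(2) pt_mem_proj_points[OF vec.subspace_span] by blast
      then obtain q where q: "q \<in> L" "\<theta> (pt z) = \<theta> q"
        unfolding L(2) g_pt(3)[OF z(1,2), symmetric] by blast
      have "q \<in> points \<Delta>" using q line_points[OF L(1)] by blast
      then have "pt z = q"
        using inj_onD[OF bij_betw_imp_inj_on[OF theta_bij] q(2) pt_in_points[OF z(1,2)]] by blast
      then show ?thesis using q by simp
    qed
    have "pt x \<in> L" "pt y \<in> L" using mem assms nz by (simp_all add: vec.span_base)
    then show "f x y = 0" using line_perp L nz by blast
  qed
qed

lemma g_domestic: "x \<in> S \<Longrightarrow> f x (g x) = 0"
proof (cases "x = 0")
  case False
  assume x: "x \<in> S"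
  have p: "pt x \<in> points \<Delta>" "\<theta> (pt x) \<in> points \<Delta>"
    using pt_in_points g_pt x False by auto
  then have "collinear_pts \<Delta> (pt x) (\<theta> (pt x))"
    using domes unfolding point_domestic_def opposite_pts_def by blast
  then show ?thesis using line_perp g_pt x False unfolding collinear_pts_def by metis
qed simp

lemma sub_line:
  assumes "x \<in> S" "y \<in> S" "f x y = 0"
  shows "\<exists>c d. g (a *s x + b *s y) = c *s g x + d *s g y"
    "\<exists>a b t. c *s g x + d *s g y = t *s g (a *s x + b *s y)"
proof -
  have sg: "\<exists>c. g (k *s z) = c *s g z" if "z \<in> S" for k z
  proof (cases "k = 0")
    case True
    then show ?thesis using g0 by (intro exI[of _ 0]) simp
  next
    case False
    then have "sim (g (k *s z)) (g z)" using g_sim_iff that S_scale sim_scale(1) by blast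
    then show ?thesis unfolding sim_def by blast
  qed
  consider "x = 0" | k where "y = k *s x" | "ind2 x y" unfolding ind2_iff by blast
  note C = this
  have ax: "a *s x + b *s y \<in> S" for a b using S_comb assms by blast
  show "\<exists>c d. g (a *s x + b *s y) = c *s g x + d *s g y"
  proof (cases rule: C)
    case 1
    obtain c where "g (b *s y) = c *s g y" using sg[OF assms(2)] by blast
    then show ?thesis using 1 by (intro exI[of _ 0] exI[of _ c]) simp
  next
    case (2 k)
    then have "a *s x + b *s y = (a + b * k) *s x" by (simp add: vec.scale_left_distrib)
    then obtain c where "g (a *s x + b *s y) = c *s g x" using sg[OF assms(1)] by metis
    then show ?thesis by (intro exI[of _ c] exI[of _ 0]) simp
  next
    case 3
    let ?z = "a *s x + b *s y"
    show ?thesis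
    proof (cases "?z = 0")
      case True
      then show ?thesis using g0 by (intro exI[of _ 0]) simp
    next
      case False
      have "pt ?z \<in> proj_points (vec.span {x, y})"
        using pt_mem_proj_points[OF vec.subspace_span False] span_pair by blast
      then have "pt (g ?z) \<in> proj_points (vec.span {g x, g y})"
        using image_line(3)[OF assms 3] g_pt(3)[OF ax False] by (metis imageI)
      then have "g ?z \<in> vec.span {g x, g y}"
        using pt_mem_proj_points[OF vec.subspace_span] g_pt(2)[OF ax False] by blast
      then show ?thesis using span_pair by blast
    qed
  qed
  show "\<exists>a b t. c *s g x + d *s g y = t *s g (a *s x + b *s y)"
  proof (cases rule: C)
    case 1
    then show ?thesis using g0 by (intro exI[of _ 0] exI[of _ 1] exI[of _ d]) simp
  next
    case (2 k)
    then obtain c' where "g y = c' *s g x" using sg[OF assms(1)] by blast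
    then have "c *s g x + d *s g y = (c + d * c') *s g (1 *s x + 0 *s y)"
      by (simp add: vec.scale_left_distrib)
    then show ?thesis by blast
  next
    case 3
    let ?z = "c *s g x + d *s g y"
    show ?thesis
    proof (cases "?z = 0")
      case True
      then show ?thesis by (intro exI[of _ 0]) simp
    next
      case False
      have "pt ?z \<in> proj_points (vec.span {g x, g y})"
        using pt_mem_proj_points[OF vec.subspace_span False] span_pair by blast
      then obtain p where p: "p \<in> proj_points (vec.span {x, y})" "\<theta> p = pt ?z"
        using image_line(3)[OF assms 3] by (metis imageE)
      then obtain u where u: "u \<in> vec.span {x, y}" "u \<noteq> 0" "p = pt u"
        using proj_points_iff[OF vec.subspace_span] by blast
      then obtain a b where ab: "u = a *s x + b *s y" using span_pair by blast
      then have "u \<in> S" using ax by blast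
      then have "sim ?z (g u)" using p u g_pt(3) span_eq_sim by metis
      then show ?thesis unfolding ab sim_def by blast
    qed
  qed
qed

lemma g_inj:
  assumes a: "x \<in> S" "y \<in> S" "g y = c *s g x" shows "\<exists>d. y = d *s x"
proof (cases "c = 0 \<or> y = 0")
  case True
  then have "y = 0" using a g_pt(2)[of y] by auto
  then show ?thesis by (intro exI[of _ 0]) simp
next
  case False
  then have "sim (g y) (g x)" using a simI by blast
  then show ?thesis using g_sim_iff a unfolding sim_def by blast
qed

lemma domestic_perp: "domestic f S \<epsilon> g (\<lambda>x y. x \<in> S \<and> y \<in> S \<and> f x y = 0)"
proof unfold_locales
  show "\<exists>c d. g (a *s x + b *s y) = c *s g x + d *s g y" if "x \<in> S \<and> y \<in> S \<and> f x y = 0" for x y a b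
    using sub_line(1) that by blast
  show "\<exists>a b t. c *s g x + d *s g y = t *s g (a *s x + b *s y)" if "x \<in> S \<and> y \<in> S \<and> f x y = 0" for x y c d
    using sub_line(2) that by blast
  show "\<exists>d. y = d *s x" if "x \<in> S" "y \<in> S" "g y = c *s g x" for x y c
    using g_inj that by blast
  show "y \<in> S \<and> x \<in> S \<and> f y x = 0" if "x \<in> S \<and> y \<in> S \<and> f x y = 0" for x y
    using that f_sym0 by blast
qed (use g0 gS g_pt(2) g_perp_iff g_domestic S_add S_scale in \<open>auto simp: f_bilin\<close>)

lemma opposite_pt: "x \<in> S \<Longrightarrow> y \<in> S \<Longrightarrow> f x y \<noteq> 0 \<Longrightarrow> opposite_pts \<Delta> (pt x) (pt y)"
  unfolding opposite_pts_def collinear_pts_def using pt_in_points line_perp f_zero by metis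

lemma opposite_subspace:
  assumes Y: "Y \<in> sing \<Delta> d" "opposite_sing \<Delta> Y (\<theta> ` Y)" and d: "1 \<le> d"
  obtains P where "vec.subspace P" "vec.dim P = d + 1" "P \<subseteq> S" "\<And>x y. x \<in> P \<Longrightarrow> y \<in> P \<Longrightarrow> f x y = 0"
    "\<And>x. x \<in> P \<Longrightarrow> x \<noteq> 0 \<Longrightarrow> \<exists>y\<in>P. f x (g y) \<noteq> 0"
proof -
  obtain P where P: "vec.subspace P" "vec.dim P = d + 1" "P \<subseteq> S" "\<And>x y. x \<in> P \<Longrightarrow> y \<in> P \<Longrightarrow> f x y = 0"
    "Y = proj_points P" using Y(1) unfolding sing_iff by blast
  have "\<exists>y\<in>P. f x (g y) \<noteq> 0" if x: "x \<in> P" "x \<noteq> 0" for x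
  proof -
    have "pt x \<in> Y" unfolding P(5) using pt_mem_proj_points[OF P(1)] x by blast
    then obtain q where q: "q \<in> Y" "opposite_pts \<Delta> (pt x) (\<theta> q)"
      using Y(2) unfolding opposite_sing_def by blast
    then obtain y where y: "y \<in> P" "y \<noteq> 0" "q = pt y" unfolding P(5) proj_points_iff[OF P(1)] by blast
    have S: "x \<in> S" "y \<in> S" "g y \<in> S" "g y \<noteq> 0" using x y P(3) g_pt by auto
    have opp: "\<not> collinear_pts \<Delta> (pt x) (pt (g y))"
      using q(2) g_pt(3)[OF S(2) y(2)] y(3) unfolding opposite_pts_def by simp
    have "f x (g y) \<noteq> 0"
    proof
      assume 0: "f x (g y) = 0"
      show False
      proof (cases "ind2 x (g y)")
        case True
        from line_through[OF S(1,3) 0 True] opp show False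
          unfolding collinear_pts_def using pt_mem_proj_points[OF vec.subspace_span] x S
          by (metis insertCI vec.span_base)
      next
        case False
        then have "pt (g y) = pt x" using not_ind2 x S span_eq_sim by blast
        \<comment> \<open>A point is collinear with itself only if it lies on some line. As
          \<open>1 \<le> d\<close>, there is one inside \<open>P\<close>.\<close>
        moreover have "\<not> P \<subseteq> pt x"
        proof
          assume "P \<subseteq> pt x"
          then have "vec.dim P \<le> vec.dim (pt x)" by (rule vec.dim_subset)
          also have "\<dots> \<le> 1" using vec.dim_le_card[of "pt x" "{x}"] by simp
          finally show False using P(2) d by simp
        qed
        then obtain u where u: "u \<in> P" "u \<notin> pt x" by blast
        then have i: "ind2 x u" unfolding ind2_iff vec.span_singleton using x by auto
        have "proj_points (vec.span {x, u}) \<in> lines \<Delta>"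
          by (rule line_through) (use x u P i in auto)
        moreover have "pt x \<in> proj_points (vec.span {x, u})"
          using pt_mem_proj_points[OF vec.subspace_span x(2)] by (simp add: vec.span_base)
        ultimately show False using opp unfolding collinear_pts_def by metis
      qed
    qed
    then show ?thesis using y by blast
  qed
  then show thesis using that P by blast
qed

end

section \<open>The maximal symplectic system given by the opposition diagram\<close>

locale polar_diagram = polar_collineation f S \<epsilon> Sg \<theta>
  for f :: "'k::field ^ 'm::finite \<Rightarrow> 'k ^ 'm \<Rightarrow> 'k" and S \<epsilon> Sg \<theta> +
  fixes n i :: nat
  assumes diagram: "opp_diagram2 (polar_space_of Sg) n i \<theta>" and i_bounds: "1 \<le> i" "2 * i \<le> n"
    and card_le: "CARD('m) \<le> 2 * n + 1"
begin

sublocale D: domestic f S \<epsilon> g "\<lambda>x y. x \<in> S \<and> y \<in> S \<and> f x y = 0"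
  by (rule domestic_perp)

lemma hsys_i: "\<exists>e. D.hsys i e"
proof -
  have k: "2 * i \<in> {1..n}" "2 * i \<in> {2 * j |j. j \<in> {1..i}}" using i_bounds by auto
  then obtain Y where Y: "Y \<in> sing \<Delta> (2 * i - 1)" "opposite_sing \<Delta> Y (\<theta> ` Y)"
    using diagram unfolding opp_diagram2_def by blast
  have "1 \<le> 2 * i - 1" using i_bounds by simp
  from opposite_subspace[OF Y this] obtain P where P: "vec.subspace P" "vec.dim P = 2 * i - 1 + 1" "P \<subseteq> S"
    "\<And>x y. x \<in> P \<Longrightarrow> y \<in> P \<Longrightarrow> f x y = 0" "\<And>x. x \<in> P \<Longrightarrow> x \<noteq> 0 \<Longrightarrow> \<exists>y\<in>P. f x (g y) \<noteq> 0" by blast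
  have "2 * i \<le> vec.dim P" using P(2) i_bounds by simp
  from D.hsys_exists[OF P(1,3,4,5) this] show ?thesis by blast
qed

text \<open>A larger system would span a singular subspace of vector dimension
  \<open>2 * Suc i\<close> opposite its image. That \<open>2 * Suc i \<le> n\<close>, so that the
  diagram speaks about it, follows from
  \<open>4 * Suc i \<le> CARD('m) \<le> 2 * n + 1\<close>.\<close>

lemma hsys_max: "\<not> D.hsys (Suc i) e"
proof
  assume h: "D.hsys (Suc i) e"
  let ?A = "e ` idx (Suc i)"
  let ?P = "vec.span ?A" and ?P' = "vec.span (g ` ?A)"
  have A: "?A \<subseteq> S" "\<And>x y. x \<in> ?A \<Longrightarrow> y \<in> ?A \<Longrightarrow> f x y = 0" using D.hsysD[OF h] by auto
  have gA1: "g ` ?A \<subseteq> S" using A(1) gS by blast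
  have gA2: "f x y = 0" if xy: "x \<in> g ` ?A" "y \<in> g ` ?A" for x y
  proof -
    obtain u v where uv: "u \<in> ?A" "v \<in> ?A" "x = g u" "y = g v" using xy by blast
    then show ?thesis using A(2)[OF uv(1,2)] g_perp_iff[of u v] A(1) by blast
  qed
  note gA = gA1 gA2
  have P: "vec.dim ?P = 2 * Suc i" "?P \<subseteq> S" "\<forall>x\<in>?P. \<forall>y\<in>?P. f x y = 0"
    using D.hsys_span(1-3)[OF h] by auto
  have P': "?P' \<subseteq> S" "\<forall>x\<in>?P'. \<forall>y\<in>?P'. f x y = 0" using span_sing[OF gA] by blast+
  have dP': "vec.dim ?P' = 2 * Suc i"
  proof -
    have d: "f (e (partner a)) (g (e b)) \<noteq> 0 \<longleftrightarrow> a = b" if "a \<in> idx (Suc i)" "b \<in> idx (Suc i)" for a b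
      using D.hsysD(3)[OF h, of "partner a" b] that by auto
    have "inj_on (\<lambda>b. g (e b)) (idx (Suc i))" "vec.independent ((\<lambda>b. g (e b)) ` idx (Suc i))"
      using independent_dual_family[where \<phi> = "\<lambda>a. f (e (partner a))" and v = "\<lambda>b. g (e b)",
          OF finite_idx linfun_f(2) d] by fastforce+
    then show ?thesis
      using vec.dim_span_eq_card_independent[of "g ` ?A"] card_image[of "\<lambda>b. g (e b)" "idx (Suc i)"]
      by (simp add: image_image)
  qed
  have th: "\<theta> ` proj_points ?P = proj_points ?P'"
  proof (intro equalityI subsetI)
    fix q assume "q \<in> \<theta> ` proj_points ?P"
    then obtain p where p: "p \<in> proj_points ?P" "q = \<theta> p" by (rule imageE)
    obtain x where x: "x \<in> ?P" "x \<noteq> 0" "p = pt x"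
      using p(1) unfolding proj_points_iff[OF vec.subspace_span] by (elim bexE conjE)
    have xS: "x \<in> S" by (rule subsetD[OF P(2) x(1)])
    have "q = pt (g x)" using g_pt(3)[OF xS x(2)] x(3) p(2) by simp
    moreover have "pt (g x) \<in> proj_points ?P'"
      using pt_mem_proj_points[OF vec.subspace_span g_pt(2)[OF xS x(2)]] D.g_span[OF A x(1)] by blast
    ultimately show "q \<in> proj_points ?P'" by simp
  next
    fix q assume "q \<in> proj_points ?P'"
    then obtain z where z: "z \<in> ?P'" "z \<noteq> 0" "q = pt z"
      unfolding proj_points_iff[OF vec.subspace_span] by (elim bexE conjE)
    obtain x t where x: "x \<in> ?P" "z = t *s g x" using D.g_span_onto[OF A z(1)] by blast
    then have nz: "x \<noteq> 0" "t \<noteq> 0" using z g0 by auto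
    have xS: "x \<in> S" using x P by blast
    have "pt z = pt (g x)" unfolding span_eq_sim using x(2) nz(2) by (rule simI)
    then have "q = \<theta> (pt x)" using z(3) g_pt(3)[OF xS nz(1)] by simp
    moreover have "pt x \<in> proj_points ?P" using pt_mem_proj_points[OF vec.subspace_span nz(1)] x by blast
    ultimately show "q \<in> \<theta> ` proj_points ?P" by blast
  qed
  have s: "proj_points ?P \<in> sing \<Delta> (2 * Suc i - 1)"
    unfolding sing_iff by (intro exI[of _ ?P]) (use P in \<open>simp add: vec.subspace_span\<close>)
  have s': "proj_points ?P' \<in> sing \<Delta> (2 * Suc i - 1)"
    unfolding sing_iff by (intro exI[of _ ?P']) (use P' dP' in \<open>simp add: vec.subspace_span\<close>)
  have "opposite_sing \<Delta> (proj_points ?P) (\<theta> ` proj_points ?P)"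
    unfolding opposite_sing_def
  proof (intro conjI ballI)
    show "\<exists>d. proj_points ?P \<in> sing \<Delta> d \<and> \<theta> ` proj_points ?P \<in> sing \<Delta> d"
      unfolding th using s s' by blast
    fix p assume "p \<in> proj_points ?P"
    then obtain x where x: "x \<in> ?P" "x \<noteq> 0" "p = pt x"
      unfolding proj_points_iff[OF vec.subspace_span] by (elim bexE conjE)
    then obtain a where a: "a \<in> idx (Suc i)" "f x (g (e a)) \<noteq> 0" using D.hsys_span(4)[OF h] by blast
    have "g (e a) \<in> ?P'" by (rule vec.span_base) (use a in blast)
    moreover have "g (e a) \<noteq> 0" using a by auto
    ultimately have "pt (g (e a)) \<in> \<theta> ` proj_points ?P"
      unfolding th using pt_mem_proj_points[OF vec.subspace_span] by blast
    moreover have "opposite_pts \<Delta> p (pt (g (e a)))"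
      unfolding x(3) by (rule opposite_pt) (use a x P A gS in auto)
    ultimately show "\<exists>q\<in>\<theta> ` proj_points ?P. opposite_pts \<Delta> p q" by blast
  qed
  moreover have "4 * Suc i \<le> CARD('m)" using D.hsys_independent(3)[OF h] .
  then have "2 * Suc i \<in> {1..n}" using card_le by simp
  ultimately have "2 * Suc i \<in> {2 * j |j. j \<in> {1..i}}"
    using diagram s unfolding opp_diagram2_def by blast
  then show False by auto
qed

end

section \<open>The three families\<close>

lemma proj_points_eq: "vec.subspace U \<Longrightarrow> proj_points U = (\<lambda>x. vec.span {x}) ` (U - {0})"
  using proj_points_iff[of U] by auto

lemma linear_image_span_singleton:
  assumes "vlinear G" shows "G ` vec.span {x} = vec.span {G x}"
  unfolding vec.span_singleton image_image vlinearD(2)[OF assms] ..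

context polar_collineation
begin

text \<open>When all vectors are singular, the span of any \<open>x\<close> and \<open>y\<close>
  consists of the vectors orthogonal to everything orthogonal to both. Orthogonality is preserved in
  both directions and \<open>g\<close> reaches every point, so hyperbolic lines are also mapped to
  lines.\<close>

lemma domestic_all:
  assumes U: "S = UNIV" shows "domestic f UNIV \<epsilon> g (\<lambda>_ _. True)"
proof -
  have f0: "x = 0" if "\<And>y. f y x = 0" for x using S_nondeg that U by blast
  have comb: "\<exists>a b. z = a *s x + b *s y" if k: "\<And>u. f u x = 0 \<Longrightarrow> f u y = 0 \<Longrightarrow> f u z = 0" for x y z
  proof -
    obtain a b where ab: "\<And>u. f u z = a * f u x + b * f u y"
      using functional_combination[OF linfun_f(1) linfun_f(1) linfun_f(1) k] by blast
    have "z - (a *s x + b *s y) = 0" by (rule f0) (simp add: f_bilin ab)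
    then have "z = a *s x + b *s y" by simp
    then show ?thesis by blast
  qed
  have surj: "\<exists>x. sim y (g x)" for y using g_surj U by blast
  have perp: "f (g x) (g y) = 0 \<longleftrightarrow> f x y = 0" for x y using g_perp_iff U by blast
  have line: "\<exists>c d. g (a *s x + b *s y) = c *s g x + d *s g y" for a b x y
  proof (rule comb)
    fix u assume u: "f u (g x) = 0" "f u (g y) = 0"
    obtain v where v: "sim u (g v)" using surj by blast
    have "f v x = 0" "f v y = 0" using u f_sim[OF v sim_refl] perp by blast+
    then have "f v (a *s x + b *s y) = 0" by (simp add: f_bilin)
    then show "f u (g (a *s x + b *s y)) = 0" using f_sim[OF v sim_refl] perp by blast
  qed
  have onto: "\<exists>a b t. c *s g x + d *s g y = t *s g (a *s x + b *s y)" for c d x y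
  proof -
    obtain z where z: "sim (c *s g x + d *s g y) (g z)" using surj by blast
    have "\<exists>a b. z = a *s x + b *s y"
    proof (rule comb)
      fix u assume "f u x = 0" "f u y = 0"
      then have "f (g u) (g x) = 0" "f (g u) (g y) = 0" using perp by auto
      then have "f (g u) (c *s g x + d *s g y) = 0" by (simp add: f_bilin)
      then show "f u z = 0" using f_sim[OF sim_refl z] perp by blast
    qed
    then show ?thesis using z unfolding sim_def by blast
  qed
  have "domestic f S \<epsilon> g (\<lambda>x y. x \<in> S \<and> y \<in> S \<and> f x y = 0)" by (rule domestic_perp)
  then interpret D: domestic f UNIV \<epsilon> g "\<lambda>x y. x \<in> UNIV \<and> y \<in> UNIV \<and> f x y = 0" unfolding U .
  show ?thesis
  proof unfold_locales
    show "\<exists>d. y = d *s x" if "g y = c *s g x" for x y c using D.g_inj that by blast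
    show "\<exists>c d. g (a *s x + b *s y) = c *s g x + d *s g y" for x y a b by (rule line)
    show "\<exists>a b t. c *s g x + d *s g y = t *s g (a *s x + b *s y)" for x y c d by (rule onto)
  qed (use D.g_zero D.g_nz D.g_perp D.dom in auto)
qed

end

lemma symplectic_case:
  fixes f :: "'k::field ^ 'm::finite \<Rightarrow> 'k ^ 'm \<Rightarrow> 'k"
  assumes f: "symplectic_form f" and char: "CHAR('k) \<noteq> 2" and m: "CARD('m) = 2 * n" "3 \<le> n"
    and col: "collineation (symplectic f) \<theta>" "point_domestic (symplectic f) \<theta>"
    and i: "1 \<le> i" "2 * i + 1 \<le> n \<or> 2 * i = n \<and> (\<exists>p\<in>points (symplectic f). \<theta> p = p)"
    and diag: "opp_diagram2 (symplectic f) n i \<theta>"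
  shows "homology (symplectic f) (2 * n - 2 * i) (2 * i) \<theta>"
proof -
  have lin1: "Vector_Spaces.linear (*s) (*) (f x)" "Vector_Spaces.linear (*s) (*) (\<lambda>x. f x y)"
    and alt: "f x x = 0" and nd: "(\<forall>y. f x y = 0) \<Longrightarrow> x = 0" for x y
    using f unfolding symplectic_form_def by blast+
  have add: "f (x + y) z = f x z + f y z" "f z (x + y) = f z x + f z y"
    and scale: "f (c *s x) z = c * f x z" for x y z c
    using lin1(1)[of z] lin1(2)[of z]
    by (auto simp: Vector_Spaces.linear_def module_hom_def module_hom_axioms_def)
  have skew: "f y x = - 1 * f x y" for x y
  proof -
    have "f y x + f x y = 0" using alt[of "x + y"] alt[of x] alt[of y] by (simp add: add)
    then show ?thesis by (simp add: eq_neg_iff_add_eq_0)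
  qed
  have two: "(2 :: 'k) \<noteq> 0"
  proof
    assume "(2 :: 'k) = 0"
    then have "CHAR('k) dvd 2" using of_nat_eq_0_iff_char_dvd[where 'a = 'k, of 2] by simp
    then have "CHAR('k) = 1" using char by (metis prime_nat_iff two_is_prime_nat)
    then show False using of_nat_CHAR[where 'a = 'k] by simp
  qed
  let ?Sg = "\<lambda>U. \<forall>x\<in>U. \<forall>y\<in>U. f x y = 0"
  have sp: "symplectic f = polar_space_of ?Sg" by (simp add: symplectic_def)
  interpret polar_diagram f UNIV "- 1" ?Sg \<theta> n i
  proof unfold_locales
    show "x = 0" if "\<And>y. f y x = 0" for x
      by (rule nd) (use that skew[of _ x] in auto)
    show "\<exists>c. w + c *s b \<in> UNIV" for w b :: "'k ^ 'm" by simp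
    show "2 * i \<le> n" using i by auto
    show "f y x = - 1 * f x y" for x y by (rule skew)
  qed (use add(1) scale alt col diag i m in \<open>auto simp: sp\<close>)
  interpret symplectic_domestic f "- 1" g
    by (intro symplectic_domestic.intro domestic_all) simp
  obtain e where h: "hsys i e" using hsys_i by blast
  have "\<exists>v0. v0 \<noteq> 0 \<and> sim (g v0) v0"
    using i(2)
  proof
    assume "2 * i + 1 \<le> n"
    \<comment> \<open>Since \<open>2 * n - 4 * i \<ge> 2\<close>, the complement is nonzero, and all
      its points are fixed.\<close>
    then have "2 \<le> vec.dim (Wp i e)" using Wp_dim[of i e] m by linarith
    moreover have "vec.dim {0 :: 'k ^ 'm} = 0" by simp
    ultimately have "\<not> Wp i e \<subseteq> {0}" using vec.dim_subset[of "Wp i e" "{0}"] by linarith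
    then obtain w where "w \<in> Wp i e" "w \<noteq> 0" by blast
    then show ?thesis using Wp_fixed[OF h hsys_max] by blast
  next
    assume "2 * i = n \<and> (\<exists>p\<in>points (symplectic f). \<theta> p = p)"
    then obtain p where p: "p \<in> points \<Delta>" "\<theta> p = p" unfolding sp by blast
    then obtain x where x: "x \<noteq> 0" "p = pt x" unfolding points_iff by blast
    then have "pt (g x) = pt x" using g_pt(3)[OF UNIV_I x(1)] p by simp
    then show ?thesis using x(1) unfolding span_eq_sim by blast
  qed
  then obtain v0 where v0: "v0 \<noteq> 0" "sim (g v0) v0" by blast
  have "CARD('m) \<ge> 3" using m by simp
  from symplectic_homology[OF h hsys_max two v0 this]
  obtain G b J where G: "vlinear G" "\<And>x. sim (g x) (G x)"
    and b: "inj b" "vec.independent (range b)" "vec.span (range b) = UNIV"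
    "card (- J) = CARD('m) - 2 * i" "card J = 2 * i" "\<And>j :: 'm. G (b j) = (if j \<in> J then - b j else b j)"
    by blast
  have mat: "matrix G *v x = G x" for x using matrix_works[OF G(1)] .
  then have fn: "(*v) (matrix G) = G" by (rule ext)
  have "\<theta> p = (*v) (matrix G) ` p" if p: "p \<in> points (symplectic f)" for p
  proof -
    obtain x where x: "x \<noteq> 0" "p = pt x"
      using p unfolding sp points_iff by (elim bexE conjE)
    have "pt (g x) = pt (G x)" unfolding span_eq_sim by (rule G(2))
    then have "\<theta> p = pt (G x)" using g_pt(3)[OF UNIV_I x(1)] x(2) by simp
    then show ?thesis unfolding fn x(2) linear_image_span_singleton[OF G(1)] .
  qed
  then show ?thesis
    unfolding homology_def using col(1) b m mat
    by (intro conjI exI[of _ "matrix G"] exI[of _ b] exI[of _ J]) auto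
qed

section \<open>Quadratic forms and their long root elations\<close>

locale quadratic_form =
  fixes Q :: "'k::field ^ 'm::finite \<Rightarrow> 'k" and f
  assumes Q_add: "Q (x + y) = Q x + Q y + f x y"
    and Q_scale: "Q (c *s x) = c * c * Q x"
    and f_add: "f (x + y) z = f x z + f y z"
    and f_scale: "f (c *s x) z = c * f x z"
    and nondeg: "Q x = 0 \<Longrightarrow> (\<And>y. f y x = 0) \<Longrightarrow> x = 0"
begin

abbreviation "Sg \<equiv> \<lambda>P. \<forall>x\<in>P. Q x = 0"
abbreviation "\<Delta>Q \<equiv> polar_space_of Sg"

sublocale form_space f "{x. Q x = 0}" 1
proof
  show comm: "f y x = 1 * f x y" for x y
    using Q_add[of x y] Q_add[of y x] by (simp add: add.commute)
  have Q0: "Q 0 = 0" using Q_scale[of 0 0] by simp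
  then show "0 \<in> {x. Q x = 0}" by simp
  show "f x x = 0" if "x \<in> {x. Q x = 0}" for x
  proof -
    have "Q (x + x) = Q (2 *s x)" by (simp add: vec_eq_iff arg_cong[of _ _ Q])
    then show ?thesis using that Q_add[of x x] Q_scale[of 2 x] by simp
  qed
  show "\<exists>c. w + c *s b \<in> {x. Q x = 0}" if "b \<in> {x. Q x = 0}" "f w b \<noteq> 0" for w b
  proof
    have "f w ((- Q w / f w b) *s b) = (- Q w / f w b) * f w b"
      using comm[of w "(- Q w / f w b) *s b"] comm[of b w] by (simp only: f_scale mult_1)
    then show "w + (- Q w / f w b) *s b \<in> {x. Q x = 0}"
      using that unfolding mem_Collect_eq Q_add Q_scale by simp
  qed
qed (use Q_add Q_scale f_add f_scale nondeg in auto)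

lemma comm: "f y x = f x y" using f_swap by simp

lemma Sg_iff: "vec.subspace P \<Longrightarrow> Sg P \<longleftrightarrow> P \<subseteq> {x. Q x = 0} \<and> (\<forall>x\<in>P. \<forall>y\<in>P. f x y = 0)"
proof -
  assume P: "vec.subspace P"
  have "f x y = 0" if "Sg P" "x \<in> P" "y \<in> P" for x y
    using Q_add[of x y] that vec.subspace_add[OF P that(2,3)] by simp
  then show ?thesis by blast
qed

lemma isometry_collineation:
  assumes G: "vlinear G" "vlinear H" "\<And>x. G (H x) = x" "\<And>x. H (G x) = x" "\<And>x. Q (G x) = Q x"
  shows "collineation (\<Delta>Q) (\<lambda>p. G ` p)"
proof -
  have QH: "Q (H x) = Q x" for x using G(3)[of x] G(5)[of "H x"] by simp
  have sub: "vec.subspace (K ` P) \<and> vec.dim (K ` P) = vec.dim P"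
    if "vlinear K" "inj K" "vec.subspace P" for K :: "'k ^ 'm \<Rightarrow> 'k ^ 'm" and P
  proof -
    interpret K: Vector_Spaces.linear "(*s)" "(*s)" K by (rule that(1))
    show ?thesis using K.subspace_image[OF that(3)] vec.dim_image_eq[OF that(1), of P] that(2)
      by (auto intro: inj_on_subset)
  qed
  have inj: "inj G" "inj H" using G(3,4) by (metis injI)+
  have img: "G ` H ` P = P" "H ` G ` P = P" for P by (auto simp: image_iff G)
  have pp: "(\<lambda>p. K ` p) ` proj_points P = proj_points (K ` P)"
    if K: "vlinear K" "vec.subspace P" "inj K" for K :: "'k ^ 'm \<Rightarrow> 'k ^ 'm" and P
  proof -
    have z: "K x = 0 \<longleftrightarrow> x = 0" for x using K(3) vlinearD(3)[OF K(1)] by (metis injD)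
    have "(\<lambda>p. K ` p) ` proj_points P = (\<lambda>x. vec.span {K x}) ` (P - {0})"
      unfolding proj_points_eq[OF K(2)] image_image linear_image_span_singleton[OF K(1)] ..
    also have "\<dots> = (\<lambda>y. vec.span {y}) ` (K ` P - {0})"
    proof -
      have "K ` (P - {0}) = K ` P - {0}" using z by auto
      moreover have "(\<lambda>x. vec.span {K x}) ` (P - {0}) = (\<lambda>y. vec.span {y}) ` K ` (P - {0})"
        by (simp only: image_image)
      ultimately show ?thesis by simp
    qed
    also have "\<dots> = proj_points (K ` P)"
      using proj_points_eq[of "K ` P"] sub[OF K(1,3,2)] by simp
    finally show ?thesis .
  qed
  have pts: "K ` p \<in> points (\<Delta>Q)"
    if "vlinear K" "inj K" "\<And>x. Q (K x) = Q x" "p \<in> points (\<Delta>Q)" for K :: "'k ^ 'm \<Rightarrow> 'k ^ 'm" and p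
    using that sub unfolding polar_space_of_def proj_points_def by auto
  have lns: "(\<lambda>p. K ` p) ` L \<in> lines (\<Delta>Q)"
    if K: "vlinear K" "inj K" "\<And>x. Q (K x) = Q x" and L: "L \<in> lines (\<Delta>Q)" for K :: "'k ^ 'm \<Rightarrow> 'k ^ 'm" and L
  proof -
    obtain P where P: "L = proj_points P" "vec.subspace P" "vec.dim P = 2" "Sg P"
      using L unfolding polar_space_of_def by auto
    then have "(\<lambda>p. K ` p) ` L = proj_points (K ` P)" using pp K by blast
    moreover have "vec.subspace (K ` P)" "vec.dim (K ` P) = 2" "Sg (K ` P)"
      using sub[OF K(1,2) P(2)] P K(3) by auto
    ultimately show ?thesis unfolding polar_space_of_def by auto
  qed
  have "bij_betw (\<lambda>p. G ` p) (points (\<Delta>Q)) (points (\<Delta>Q))"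
    by (rule bij_betw_byWitness[where f' = "\<lambda>p. H ` p"])
      (use img pts[OF G(1) inj(1) G(5)] pts[OF G(2) inj(2) QH] in auto)
  moreover have "(\<lambda>L. (\<lambda>p. G ` p) ` L) ` lines (\<Delta>Q) = lines (\<Delta>Q)"
  proof (intro equalityI subsetI)
    fix L assume L: "L \<in> lines (\<Delta>Q)"
    have "L = (\<lambda>p. G ` p) ` ((\<lambda>p. H ` p) ` L)" unfolding image_image G(3) by simp
    then show "L \<in> (\<lambda>L. (\<lambda>p. G ` p) ` L) ` lines (\<Delta>Q)"
      using lns[OF G(2) inj(2) QH L] by (rule image_eqI)
  qed (use lns[OF G(1) inj(1) G(5)] in auto)
  ultimately show ?thesis unfolding collineation_def by blast
qed

text \<open>The Siegel transformation of the line spanned by \<open>a\<close> and \<open>b\<close>;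
  if this line is singular, the inverse is \<open>root (- c) a b\<close>.\<close>

definition root :: "'k \<Rightarrow> 'k ^ 'm \<Rightarrow> 'k ^ 'm \<Rightarrow> 'k ^ 'm \<Rightarrow> 'k ^ 'm" where
  "root c a b v = v + c *s (f v b *s a - f v a *s b)"

lemma root_linear: "vlinear (root c a b)"
  by (rule vlinearI) (simp_all add: root_def f_bilin vec_eq_iff algebra_simps)

lemma Q_diff: "Q (x - y) = Q x + Q y - f x y"
  using Q_add[of x "-y"] Q_scale[of "-1" y] by (simp add: f_bilin)

lemma pt_points: "p \<in> points (\<Delta>Q) \<longleftrightarrow> (\<exists>x. Q x = 0 \<and> x \<noteq> 0 \<and> p = vec.span {x})"
proof -
  have "Sg (vec.span {x}) \<longleftrightarrow> Q x = 0" for x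
    using vec.span_base[of x "{x}"] unfolding vec.span_singleton by (auto simp: Q_scale)
  then show ?thesis
    unfolding polar_space_of_def using proj_points_iff[OF vec.subspace_UNIV, of p] by auto
qed

lemma span_sing_space:
  assumes "\<And>a. a \<in> A \<Longrightarrow> Q a = 0" "\<And>a b. a \<in> A \<Longrightarrow> b \<in> A \<Longrightarrow> f a b = 0" "vec.independent A" "card A = d + 1"
  shows "proj_points (vec.span A) \<in> sing (\<Delta>Q) d"
proof -
  have "Sg (vec.span A)" using span_sing(1)[of A] assms(1,2) by blast
  then show ?thesis
    using vec.dim_span_eq_card_independent[OF assms(3)] assms(4)
    unfolding polar_space_of_def by (auto simp: vec.subspace_span)
qed

text \<open>If a singular line meets the axis in the point of \<open>u\<close>, each vector
  \<open>y\<close> on it satisfies \<open>f y u = 0\<close>. This equation makes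
  \<open>f y b *s a - f y a *s b\<close> a multiple of \<open>u\<close>, so \<open>y\<close> is
  moved within the line.\<close>

lemma root_elation:
  assumes ab: "Q a = 0" "Q b = 0" "f a b = 0" "ind2 a b" and c: "c \<noteq> 0"
  shows "long_root_elation (\<Delta>Q) (proj_points (vec.span {a, b})) (\<lambda>p. root c a b ` p)"
proof -
  let ?L = "proj_points (vec.span {a, b})" and ?R = "root c a b"
  have z: "f a a = 0" "f b b = 0" "f b a = 0" using S_self ab comm by auto
  have fr: "f (root k a b v) a = f v a" "f (root k a b v) b = f v b" for k v
    using z ab by (simp_all add: root_def f_bilin)
  have inv: "root k a b (root (- k) a b v) = v" for k v
    unfolding root_def[of k] fr by (simp add: root_def)
  have inv': "root (- k) a b (root k a b v) = v" for k v
    using inv[of "- k"] by simp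
  have iso: "Q (root k a b v) = Q v" for k v
  proof -
    have "Q (f v b *s a - f v a *s b) = 0" using ab by (simp add: Q_diff Q_scale f_bilin)
    moreover have "f v (f v b *s a - f v a *s b) = 0" by (simp add: f_bilin)
    ultimately show ?thesis unfolding root_def Q_add Q_scale f_scale_right by simp
  qed
  have "proj_points (vec.span {a, b}) \<in> sing (\<Delta>Q) 1"
    by (rule span_sing_space) (use ab z ind2_independent[of a b] in auto)
  moreover have "collineation (\<Delta>Q) (\<lambda>p. ?R ` p)"
    by (rule isometry_collineation[OF root_linear root_linear[of "- c"]]) (rule inv inv' iso)+
  moreover have "\<exists>p\<in>points (\<Delta>Q). ?R ` p \<noteq> p"
  proof -
    have "b \<noteq> 0" using ind2_sym[OF ab(4)] ind2_iff by blast
    \<comment> \<open>A singular \<open>?x\<close> not orthogonal to \<open>b\<close> is moved: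
      pairing with \<open>b\<close> would force the eigenvalue 1, and then \<open>a\<close> and
      \<open>b\<close> would be dependent.\<close>
    then obtain y where y: "f y b \<noteq> 0" using nondeg ab(2) by blast
    obtain k where k: "Q (y + k *s b) = 0" using S_lift[of b y] ab(2) y by auto
    let ?x = "y + k *s b"
    have x: "f ?x b \<noteq> 0" using y z by (simp add: f_bilin)
    then have x0: "?x \<noteq> 0" by (metis f_zero(1))
    have "?R ` vec.span {?x} \<noteq> vec.span {?x}"
    proof
      assume "?R ` vec.span {?x} = vec.span {?x}"
      then have "sim (?R ?x) ?x" unfolding linear_image_span_singleton[OF root_linear] span_eq_sim .
      then obtain t where t: "?R ?x = t *s ?x" unfolding sim_def by blast
      have "f (?R ?x) b = t * f ?x b" unfolding t by (simp only: f_scale)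
      then have "t = 1" using x unfolding fr by simp
      then have "c *s (f ?x b *s a - f ?x a *s b) = 0" using t unfolding root_def by simp
      then have "f ?x b *s a - f ?x a *s b = 0" using c by (metis vec.scale_eq_0_iff)
      then have "f ?x b *s a + (- f ?x a) *s b = 0" by simp
      then show False using ab(4) x unfolding ind2_def by blast
    qed
    then show ?thesis using k x0 pt_points by blast
  qed
  moreover have "(\<lambda>p. ?R ` p) ` M = M"
    if M: "M \<in> lines (\<Delta>Q)" "M \<inter> ?L \<noteq> {}" for M
  proof -
    obtain P where P: "M = proj_points P" "vec.subspace P" "Sg P"
      using M(1) unfolding polar_space_of_def by auto
    obtain p where p: "p \<in> M" "p \<in> ?L" using M(2) by blast
    obtain u where u: "u \<in> P" "u \<noteq> 0" "p = vec.span {u}"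
      using p(1) unfolding P(1) proj_points_iff[OF P(2)] by blast
    then have "u \<in> vec.span {a, b}" using p(2) pt_mem_proj_points[OF vec.subspace_span] by blast
    then obtain s t where st: "u = s *s a + t *s b" unfolding span_pair by blast
    have inP: "root k a b y \<in> P" if y: "y \<in> P" for k y
    proof -
      have "f y u = 0" using Sg_iff[OF P(2)] P(3) u(1) y by blast
      then have fy: "s * f y a + t * f y b = 0" unfolding st by (simp add: f_bilin)
      have "\<exists>r. f y b *s a - f y a *s b = r *s u"
      proof (cases "s = 0")
        case False
        then have "f y a = - (t * f y b) / s" using fy by (simp add: field_simps eq_neg_iff_add_eq_0)
        then have "f y b *s a - f y a *s b = (f y b / s) *s u"
          using False unfolding st by (simp add: vec.scale_right_distrib mult.commute)
        then show ?thesis by blast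
      next
        case True
        then have "t \<noteq> 0" using u(2) st by auto
        then have "f y b = 0" using fy True by simp
        then have "f y b *s a - f y a *s b = (- f y a / t) *s u"
          using True \<open>t \<noteq> 0\<close> unfolding st by simp
        then show ?thesis by blast
      qed
      then obtain r where "f y b *s a - f y a *s b = r *s u" by blast
      then have "root k a b y = y + k *s (r *s u)" unfolding root_def by (rule arg_cong)
      then show ?thesis using P(2) y u(1) by (simp add: vec.subspace_add vec.subspace_scale)
    qed
    have maps: "root k a b ` p \<in> M" if "p \<in> M" for k p
    proof -
      obtain x where x: "x \<in> P" "x \<noteq> 0" "p = vec.span {x}"
        using \<open>p \<in> M\<close> unfolding P(1) proj_points_iff[OF P(2)] by blast
      have "root k a b x \<noteq> 0" using inv'[of k x] x(2) vlinearD(3)[OF root_linear] by metis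
      then show ?thesis using inP x pt_mem_proj_points[OF P(2)]
        unfolding P(1) x(3) linear_image_span_singleton[OF root_linear] by blast
    qed
    have "p = ?R ` (root (- c) a b ` p)" for p by (simp add: image_image inv)
    then have "M \<subseteq> (\<lambda>p. ?R ` p) ` M" using maps by blast
    then show ?thesis using maps by blast
  qed
  ultimately show ?thesis unfolding long_root_elation_def by blast
qed

text \<open>The increment of each factor is orthogonal to the axes of the others, so the factors do
  not see one another and their increments add up.\<close>

lemma foldr_roots:
  assumes perp: "\<And>j k. j \<in> set js \<Longrightarrow> k \<in> set js \<Longrightarrow> f (a j) (a k) = 0 \<and> f (a j) (b k) = 0 \<and>
      f (b j) (a k) = 0 \<and> f (b j) (b k) = 0"
  shows "foldr (\<circ>) (map (\<lambda>j. root (c j) (a j) (b j)) js) id v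
    = v + (\<Sum>j\<leftarrow>js. c j *s (f v (b j) *s a j - f v (a j) *s b j))"
  using perp
proof (induction js)
  case (Cons j js)
  let ?s = "\<lambda>js. \<Sum>j\<leftarrow>js. c j *s (f v (b j) *s a j - f v (a j) *s b j)"
  have zero: "f (?s ks) x = 0" if "set ks \<subseteq> set (j # js)" "x = a j \<or> x = b j" for ks x
    using that(1)
  proof (induction ks)
    case (Cons k ks)
    then have "k \<in> set (j # js)" "f (?s ks) x = 0" by auto
    moreover from this(1) have "f (a k) x = 0 \<and> f (b k) x = 0"
      using Cons.prems that(2) \<open>\<And>j' k. j' \<in> set (j # js) \<Longrightarrow> k \<in> set (j # js) \<Longrightarrow> f (a j') (a k) = 0 \<and> f (a j') (b k) = 0 \<and>
      f (b j') (a k) = 0 \<and> f (b j') (b k) = 0\<close>[of k j] by auto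
    ultimately show ?case by (simp add: f_bilin)
  qed simp
  have z: "f (?s js) (a j) = 0" "f (?s js) (b j) = 0"
    using zero[of js "a j"] zero[of js "b j"] by auto
  have "foldr (\<circ>) (map (\<lambda>j. root (c j) (a j) (b j)) (j # js)) id v = root (c j) (a j) (b j) (v + ?s js)"
  proof -
    have "foldr (\<circ>) (map (\<lambda>j. root (c j) (a j) (b j)) js) id v = v + ?s js"
      by (rule Cons.IH) (use Cons.prems in auto)
    then show ?thesis by (simp only: list.map foldr.simps o_apply)
  qed
  also have "\<dots> = v + ?s (j # js)" using z by (simp add: root_def f_bilin add_ac)
  finally show ?case .
qed simp

lemma foldr_images: "foldr (\<circ>) (map (\<lambda>j p. R j ` p) js) id p = foldr (\<circ>) (map R js) id ` p"
  by (induction js) (auto simp: image_image)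

text \<open>Distinct axes satisfy the second alternative of orthogonality. The dual family
  \<open>B\<close> shows that they are disjoint, and their four spanning vectors are independent and
  pairwise orthogonal, so they span a singular 3-space.\<close>

lemma product_of_roots:
  fixes A B :: "nat \<times> bool \<Rightarrow> 'k ^ 'm"
  assumes dual: "\<And>p q. p \<in> idx i \<Longrightarrow> q \<in> idx i \<Longrightarrow> f (A q) (B p) \<noteq> 0 \<longleftrightarrow> p = q"
    and sing: "\<And>p. p \<in> idx i \<Longrightarrow> Q (A p) = 0"
    and perp: "\<And>p q. p \<in> idx i \<Longrightarrow> q \<in> idx i \<Longrightarrow> f (A p) (A q) = 0"
    and c: "\<And>j. j < i \<Longrightarrow> c j \<noteq> 0"
    and \<theta>: "\<And>x. Q x = 0 \<Longrightarrow> x \<noteq> 0 \<Longrightarrow> \<theta> (vec.span {x}) =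
      vec.span {x + (\<Sum>j<i. c j *s (f x (A (j, False)) *s A (j, True) - f x (A (j, True)) *s A (j, False)))}"
  shows "product_of_orthogonal_lres (\<Delta>Q) i \<theta>"
proof -
  let ?a = "\<lambda>j. A (j, True)" and ?b = "\<lambda>j. A (j, False)"
  let ?R = "\<lambda>j. root (c j) (?a j) (?b j)"
  let ?L = "\<lambda>j. proj_points (vec.span {?a j, ?b j})"
  have mem: "(j, s) \<in> idx i \<longleftrightarrow> j < i" for j s by (simp add: idx_def)
  have ind: "inj_on A (idx i)" "vec.independent (A ` idx i)"
    using independent_dual_family[where \<phi> = "\<lambda>p x. f x (B p)" and v = A, OF finite_idx linfun_f(1) dual]
    by fastforce+
  have subind: "vec.independent (A ` I)" "card (A ` I) = card I" if "I \<subseteq> idx i" for I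
    using vec.independent_mono[OF ind(2)] card_image inj_on_subset[OF ind(1) that] that by (auto simp: image_mono)
  have i2: "ind2 (?a j) (?b j)" if "j < i" for j
  proof -
    have "{(j, True), (j, False)} \<subseteq> idx i" using that mem by auto
    from subind[OF this] have "vec.independent {?a j, ?b j}" "card {?a j, ?b j} = 2" by auto
    then show ?thesis unfolding ind2_independent by (metis card_2_iff doubleton_eq_iff)
  qed
  have lre: "long_root_elation (\<Delta>Q) (?L j) (\<lambda>p. ?R j ` p)" if "j < i" for j
    by (rule root_elation) (use sing perp i2 c that mem in auto)
  have orth: "orthogonal_axes (\<Delta>Q) (?L j) (?L k)" if jk: "j < i" "k < i" "j \<noteq> k" for j k
  proof -
    have "?L j \<inter> ?L k = {}"
    proof (rule ccontr)
      assume "?L j \<inter> ?L k \<noteq> {}"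
      then obtain p where p: "p \<in> ?L j" "p \<in> ?L k" by blast
      obtain x where x: "x \<in> vec.span {?a j, ?b j}" "x \<noteq> 0" "p = vec.span {x}"
        using p(1) unfolding proj_points_iff[OF vec.subspace_span] by blast
      have "x \<in> vec.span {?a k, ?b k}" using p(2) x pt_mem_proj_points[OF vec.subspace_span] by blast
      then obtain s t s' t' where e: "x = s *s ?a j + t *s ?b j" "x = s' *s ?a k + t' *s ?b k"
        using x(1) unfolding span_pair by blast
      have d: "f (A (k, v)) (B (j, u)) = 0" "f (A (j, v)) (B (j, u)) \<noteq> 0 \<longleftrightarrow> u = v" for u v
        using dual[of "(j, u)" "(k, v)"] dual[of "(j, u)" "(j, v)"] jk mem by auto
      have "f x (B (j, u)) = 0" for u unfolding e(2) using d by (simp add: f_bilin)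
      then have "s * f (?a j) (B (j, u)) + t * f (?b j) (B (j, u)) = 0" for u
        unfolding e(1) by (simp add: f_bilin)
      moreover have "f (?a j) (B (j, False)) = 0" "f (?b j) (B (j, True)) = 0"
        "f (?a j) (B (j, True)) \<noteq> 0" "f (?b j) (B (j, False)) \<noteq> 0"
        using d(2)[of True False] d(2)[of False True] d(2)[of True True] d(2)[of False False] by simp_all
      ultimately have "s = 0" "t = 0" by (metis add.left_neutral add.right_neutral mult_eq_0_iff)+
      then show False using x(2) e(1) by simp
    qed
    moreover have "\<exists>E\<in>sing (\<Delta>Q) 3. ?L j \<union> ?L k \<subseteq> E"
    proof
      let ?I = "{(j, True), (j, False), (k, True), (k, False)}"
      have I: "?I \<subseteq> idx i" "card ?I = 4" using jk mem by auto
      show "proj_points (vec.span (A ` ?I)) \<in> sing (\<Delta>Q) 3"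
        by (rule span_sing_space) (use subind[OF I(1)] I sing perp in auto)
      have "vec.span {?a j, ?b j} \<subseteq> vec.span (A ` ?I)" "vec.span {?a k, ?b k} \<subseteq> vec.span (A ` ?I)"
        by (rule vec.span_mono; auto)+
      then show "?L j \<union> ?L k \<subseteq> proj_points (vec.span (A ` ?I))"
        unfolding proj_points_def by blast
    qed
    ultimately show ?thesis unfolding orthogonal_axes_def by blast
  qed
  let ?gs = "map (\<lambda>j p. ?R j ` p) [0..<i]" and ?Ls = "map ?L [0..<i]"
  have "\<theta> p = foldr (\<circ>) ?gs id p" if p: "p \<in> points (\<Delta>Q)" for p
  proof -
    obtain x where x: "Q x = 0" "x \<noteq> 0" "p = vec.span {x}" using p unfolding pt_points by blast
    let ?F = "foldr (\<circ>) (map ?R [0..<i]) id"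
    have F: "?F v = v + (\<Sum>j<i. c j *s (f v (?b j) *s ?a j - f v (?a j) *s ?b j))" for v
      by (subst foldr_roots) (use perp mem in \<open>auto simp: interv_sum_list_conv_sum_set_nat atLeast0LessThan\<close>)
    have "vlinear ?F" by (rule vlinearI)
      (simp_all add: F f_bilin vec_eq_iff sum.distrib sum_distrib_left algebra_simps sum_subtractf)
    then have "?F ` p = vec.span {?F x}" unfolding x(3) by (rule linear_image_span_singleton)
    then show ?thesis unfolding foldr_images using \<theta>[OF x(1,2)] x(3) F by simp
  qed
  then show ?thesis unfolding product_of_orthogonal_lres_def
    by (intro exI[of _ ?gs] exI[of _ ?Ls]) (use lre orth in auto)
qed

text \<open>The singular subspace \<open>T\<close> has dimension at least \<open>n > 2 * i\<close>,
  so \<open>Wp_singular_exists\<close> provides the fixed singular point in \<open>W\<close> with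
  which the lift is normalised.\<close>

lemma orthogonal_case:
  assumes col: "collineation (\<Delta>Q) \<theta>" "point_domestic (\<Delta>Q) \<theta>"
    and diag: "opp_diagram2 (\<Delta>Q) n i \<theta>" and i: "1 \<le> i" "2 * i + 1 \<le> n"
    and card: "CARD('m) \<le> 2 * n + 1" "4 * i + 3 \<le> CARD('m)" and K: "CARD('k) \<noteq> 2"
    and T: "vec.subspace T" "\<And>x. x \<in> T \<Longrightarrow> Q x = 0" "n \<le> vec.dim T"
  shows "product_of_orthogonal_lres (\<Delta>Q) i \<theta>"
proof -
  interpret polar_diagram f "{x. Q x = 0}" 1 Sg \<theta> n i
    by unfold_locales (use Sg_iff col diag i card in auto)
  obtain e where h: "D.hsys i e" using hsys_i by blast
  have three: "\<exists>t. t \<noteq> 0 \<and> t \<noteq> d" for d :: 'k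
  proof (rule ccontr)
    assume "\<not> ?thesis"
    then have U: "(UNIV :: 'k set) = {0, d}" by auto
    then have "d \<noteq> 0" by (metis UNIV_I insert_absorb2 one_neq_zero singletonD)
    then have "CARD('k) = 2" unfolding U by simp
    then show False using K by simp
  qed
  have Tp: "T \<subseteq> {x. Q x = 0}" "\<And>x y. x \<in> T \<Longrightarrow> y \<in> T \<Longrightarrow> f x y = 0"
    using Sg_iff[OF T(1)] T(2) by blast+
  have "2 * i < vec.dim T" using T(3) i by simp
  from D.Wp_singular_exists[OF h T(1) Tp this]
  have W: "\<exists>w. w \<in> D.Wp i e \<and> w \<in> {x. Q x = 0} \<and> w \<noteq> 0" .
  interpret Z: quadric_domestic f "{x. Q x = 0}" g
    "\<lambda>x y. x \<in> {x. Q x = 0} \<and> y \<in> {x. Q x = 0} \<and> f x y = 0" Q i e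
    by unfold_locales (use Q_add Q_scale h hsys_max W three card in auto)
  obtain A B c where D: "\<forall>p\<in>idx i. \<forall>q\<in>idx i. f (A q) (B p) \<noteq> 0 \<longleftrightarrow> p = q"
    "\<forall>p\<in>idx i. A p \<in> {x. Q x = 0}" "\<forall>p\<in>idx i. \<forall>q\<in>idx i. f (A p) (A q) = 0" "\<forall>j<i. c j \<noteq> 0"
    "\<forall>x\<in>{x. Q x = 0}. sim (g x) (x + (\<Sum>j<i. c j *s (f x (A (j, False)) *s A (j, True)
        - f x (A (j, True)) *s A (j, False))))"
    using Z.long_root_decomposition by (elim exE conjE)
  show ?thesis
  proof (rule product_of_roots)
    show "f (A q) (B p) \<noteq> 0 \<longleftrightarrow> p = q" if "p \<in> idx i" "q \<in> idx i" for p q using D(1) that by blast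
    show "Q (A p) = 0" if "p \<in> idx i" for p using D(2) that by simp
    show "f (A p) (A q) = 0" if "p \<in> idx i" "q \<in> idx i" for p q using D(3) that by simp
    show "c j \<noteq> 0" if "j < i" for j using D(4) that by simp
    fix x assume x: "Q x = 0" "x \<noteq> 0"
    let ?y = "x + (\<Sum>j<i. c j *s (f x (A (j, False)) *s A (j, True) - f x (A (j, True)) *s A (j, False)))"
    have "\<theta> (pt x) = pt (g x)" using x by (intro g_pt(3)) auto
    moreover have "sim (g x) ?y" using D(5) x(1) by simp
    then have "pt (g x) = pt ?y" unfolding span_eq_sim .
    ultimately show "\<theta> (pt x) = pt ?y" by (rule trans)
  qed
qed

end

text \<open>Used to exhibit a singular subspace of dimension \<open>n\<close> on each quadric,
  namely where all coordinates but those of one half vanish.\<close>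

lemma coordinate_subspace:
  fixes h :: "'n::finite \<Rightarrow> 'm::finite" and T :: "('k::field ^ 'm) set"
  assumes "inj h" defines "T \<equiv> {x. \<forall>a. a \<notin> range h \<longrightarrow> x $ a = 0}"
  shows "vec.subspace T" "CARD('n) \<le> vec.dim T"
proof -
  let ?v = "\<lambda>b. axis (h b) 1 :: 'k ^ 'm"
  show "vec.subspace T" by (simp add: T_def vec.subspace_def)
  have d: "?v b $ h a \<noteq> 0 \<longleftrightarrow> a = b" for a b using assms(1) by (simp add: axis_def inj_eq)
  have lin: "linfun (\<lambda>x :: 'k ^ 'm. x $ a)" for a by (simp add: linfun_def)
  have ind: "inj ?v" "vec.independent (range ?v)"
    using independent_dual_family[where J = UNIV and \<phi> = "\<lambda>a x. x $ h a" and v = ?v, OF finite lin d] by auto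
  have "card (range ?v) \<le> vec.dim T"
    by (rule vec.independent_card_le_dim[OF _ ind(2)]) (auto simp: axis_def T_def)
  then show "CARD('n) \<le> vec.dim T" using card_image[OF ind(1)] by simp
qed

lemma hyperbolic_case:
  fixes \<theta> :: "('k::field ^ ('n::finite + 'n)) set \<Rightarrow> ('k ^ ('n + 'n)) set"
  assumes coll: "collineation hyperbolic \<theta>" "point_domestic hyperbolic \<theta>"
    and diag: "opp_diagram2 hyperbolic CARD('n) i \<theta>" and i: "1 \<le> i" "2 * i + 2 \<le> CARD('n)"
    and K: "CARD('k) \<noteq> 2"
  shows "product_of_orthogonal_lres hyperbolic i \<theta>"
proof -
  let ?Q = "\<lambda>x :: 'k ^ ('n + 'n). \<Sum>j\<in>UNIV. x $ Inl j * x $ Inr j"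
  let ?f = "\<lambda>x y :: 'k ^ ('n + 'n). \<Sum>j\<in>UNIV. x $ Inl j * y $ Inr j + y $ Inl j * x $ Inr j"
  interpret quadratic_form ?Q ?f
  proof
    fix x assume "\<And>y. ?f y x = 0"
    then have "?f (axis k 1) x = 0" for k by blast
    from this[of "Inl _"] this[of "Inr _"] have "x $ Inl j = 0" "x $ Inr j = 0" for j
      by (simp_all add: axis_def if_distrib[of "\<lambda>z. z * _"] if_distrib[of "\<lambda>z. _ * z"] cong: if_cong)
    then show "x = 0" by (simp add: vec_eq_iff split_sum_all)
  qed (simp_all add: algebra_simps sum.distrib sum_distrib_left)
  have eq: "hyperbolic = \<Delta>Q" by (simp add: hyperbolic_def)
  let ?T = "{x :: 'k ^ ('n + 'n). \<forall>a. a \<notin> range Inl \<longrightarrow> x $ a = 0}"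
  have T: "vec.subspace ?T" "CARD('n) \<le> vec.dim ?T" by (rule coordinate_subspace; simp)+
  have TQ: "?Q x = 0" if "x \<in> ?T" for x
  proof -
    have "x $ Inr j = 0" for j using that by (simp add: image_iff)
    then show ?thesis by simp
  qed
  \<comment> \<open>The space has dimension \<open>2 * n\<close>, and
    \<open>2 * i + 2 \<le> n\<close> gives \<open>4 * i + 4 \<le> 2 * n\<close>.\<close>
  show ?thesis unfolding eq
    by (rule orthogonal_case[OF _ _ _ i(1) _ _ _ K T(1) TQ T(2)]) (use coll diag i eq in auto)
qed

lemma parabolic_case:
  fixes \<theta> :: "('k::field ^ (('n::finite + 'n) option)) set \<Rightarrow> ('k ^ (('n + 'n) option)) set"
  assumes coll: "collineation parabolic \<theta>" "point_domestic parabolic \<theta>"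
    and diag: "opp_diagram2 parabolic CARD('n) i \<theta>" and i: "1 \<le> i" "2 * i + 1 \<le> CARD('n)"
    and K: "CARD('k) \<noteq> 2"
  shows "product_of_orthogonal_lres parabolic i \<theta>"
proof -
  let ?Q = "\<lambda>x :: 'k ^ (('n + 'n) option). (\<Sum>j\<in>UNIV. x $ Some (Inl j) * x $ Some (Inr j)) - (x $ None)^2"
  let ?f = "\<lambda>x y :: 'k ^ (('n + 'n) option). (\<Sum>j\<in>UNIV. x $ Some (Inl j) * y $ Some (Inr j)
      + y $ Some (Inl j) * x $ Some (Inr j)) - 2 * x $ None * y $ None"
  interpret quadratic_form ?Q ?f
  proof
    fix x assume Q: "?Q x = 0" and "\<And>y. ?f y x = 0"
    then have "?f (axis (Some k) 1) x = 0" for k by blast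
    from this[of "Inl _"] this[of "Inr _"] have z: "x $ Some (Inl j) = 0" "x $ Some (Inr j) = 0" for j
      by (simp_all add: axis_def if_distrib[of "\<lambda>z. z * _"] if_distrib[of "\<lambda>z. _ * z"] cong: if_cong)
    \<comment> \<open>In characteristic 2 the form \<open>?f\<close> does not see this coordinate;
      it is recovered from \<open>?Q x = 0\<close>.\<close>
    then have "x $ None = 0" using Q by simp
    then show "x = 0" using z by (simp add: vec_eq_iff split_option_all split_sum_all)
  qed (simp_all add: algebra_simps sum.distrib sum_distrib_left power2_eq_square)
  have eq: "parabolic = \<Delta>Q" by (simp add: parabolic_def)
  let ?h = "Some \<circ> Inl :: 'n \<Rightarrow> ('n + 'n) option"
  let ?T = "{x :: 'k ^ (('n + 'n) option). \<forall>a. a \<notin> range ?h \<longrightarrow> x $ a = 0}"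
  have "inj ?h" by (simp add: inj_def)
  note T = coordinate_subspace[OF this]
  have TQ: "?Q x = 0" if "x \<in> ?T" for x
  proof -
    have "x $ Some (Inr j) = 0" "x $ None = 0" for j using that by (simp_all add: image_iff)
    then show ?thesis by simp
  qed
  \<comment> \<open>The space has dimension \<open>2 * n + 1\<close>, so here
    \<open>2 * i + 1 \<le> n\<close> gives exactly the required \<open>4 * i + 3\<close>.\<close>
  show ?thesis unfolding eq
    by (rule orthogonal_case[OF _ _ _ i(1) _ _ _ K T(1) TQ T(2)]) (use coll diag i eq in auto)
qed

theorem theorem4:
  assumes rank: "CARD('n::finite) \<ge> 3"
    and no_Fano: "CARD('k::field) \<noteq> 2"  \<comment> \<open>\<open>CARD('k) = 0\<close> if the field is infinite\<close>
  shows
    "(\<forall>(\<theta> :: ('k ^ (('n + 'n) option)) set \<Rightarrow> ('k ^ (('n + 'n) option)) set) i.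
        collineation parabolic \<theta> \<and> point_domestic parabolic \<theta> \<and>
        1 \<le> i \<and> 2 * i + 1 \<le> CARD('n) \<and> opp_diagram2 parabolic CARD('n) i \<theta>
        \<longrightarrow> product_of_orthogonal_lres parabolic i \<theta>) \<and>
     (\<forall>(f :: 'k ^ ('n + 'n) \<Rightarrow> 'k ^ ('n + 'n) \<Rightarrow> 'k) \<theta> i.
        CHAR('k) \<noteq> 2 \<and> symplectic_form f \<and>
        collineation (symplectic f) \<theta> \<and> point_domestic (symplectic f) \<theta> \<and>
        1 \<le> i \<and> (2 * i + 1 \<le> CARD('n) \<or>
                 2 * i = CARD('n) \<and> (\<exists>p\<in>points (symplectic f). \<theta> p = p)) \<and>
        opp_diagram2 (symplectic f) CARD('n) i \<theta>
        \<longrightarrow> homology (symplectic f) (2 * CARD('n) - 2 * i) (2 * i) \<theta>) \<and>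
     (\<forall>(\<theta> :: ('k ^ ('n + 'n)) set \<Rightarrow> ('k ^ ('n + 'n)) set) i.
        collineation hyperbolic \<theta> \<and> point_domestic hyperbolic \<theta> \<and>
        1 \<le> i \<and> 2 * i + 2 \<le> CARD('n) \<and> opp_diagram2 hyperbolic CARD('n) i \<theta>
        \<longrightarrow> product_of_orthogonal_lres hyperbolic i \<theta>)"
proof (intro conjI allI impI)
  fix \<theta> :: "('k ^ (('n + 'n) option)) set \<Rightarrow> ('k ^ (('n + 'n) option)) set" and i
  assume "collineation parabolic \<theta> \<and> point_domestic parabolic \<theta> \<and>
    1 \<le> i \<and> 2 * i + 1 \<le> CARD('n) \<and> opp_diagram2 parabolic CARD('n) i \<theta>"
  then show "product_of_orthogonal_lres parabolic i \<theta>" using parabolic_case no_Fano by blast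
next
  fix f :: "'k ^ ('n + 'n) \<Rightarrow> 'k ^ ('n + 'n) \<Rightarrow> 'k" and \<theta> i
  assume a: "CHAR('k) \<noteq> 2 \<and> symplectic_form f \<and>
    collineation (symplectic f) \<theta> \<and> point_domestic (symplectic f) \<theta> \<and>
    1 \<le> i \<and> (2 * i + 1 \<le> CARD('n) \<or>
             2 * i = CARD('n) \<and> (\<exists>p\<in>points (symplectic f). \<theta> p = p)) \<and>
    opp_diagram2 (symplectic f) CARD('n) i \<theta>"
  have "CARD('n + 'n) = 2 * CARD('n)" by simp
  then show "homology (symplectic f) (2 * CARD('n) - 2 * i) (2 * i) \<theta>"
    using a rank by (intro symplectic_case) auto
next
  fix \<theta> :: "('k ^ ('n + 'n)) set \<Rightarrow> ('k ^ ('n + 'n)) set" and i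
  assume "collineation hyperbolic \<theta> \<and> point_domestic hyperbolic \<theta> \<and>
    1 \<le> i \<and> 2 * i + 2 \<le> CARD('n) \<and> opp_diagram2 hyperbolic CARD('n) i \<theta>"
  then show "product_of_orthogonal_lres hyperbolic i \<theta>" using hyperbolic_case no_Fano by blast
qed

end
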